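(* Let $A$ be an $A_\infty$ algebra over a commutative unital ring $R$, $M$ an $A_\infty$ module over $A$, and $I:M\to M^*$ an $A_\infty$ inner product on $M$. Let $k,\ell\ge 0$ with $k+\ell\ge 1$. Then the $(k,\ell)^{th}$ Massey inner product set induces a well-defined map to the power set $\mathcal P(R)$ of $R$, $$\underbrace{H(A)\times\dots\times H(A)}_{k}\times H(M)\times \underbrace{H(A)\times\dots\times H(A)}_{\ell}\times H(M)\to\mathcal P(R),$$ $$\langle [x_1],\dots,[x_{k+\ell+2}]\rangle_I:=\langle x_1,\dots,x_{k+\ell+2}\rangle_I ,$$ i.e. for cocycles $x_i$ the set $\langle x_1,\dots,x_{k+\ell+2}\rangle_I\subseteq R$ depends only on the cohomology classes $[x_i]$.
   Context: Shift and $A_\infty$ algebras. For a graded $R$-module $A=\bigoplus_{k\ge0}A_k$, $\underline A$ is $A$ shifted down by one: $|\underline a|=|a|-1$; $\mathfrak s:A\to\underline A$, $a\mapsto\underline a$. An $A_\infty$ algebra has maps $\mu_k:A^{\otimes k}\to A$ ($k\ge1$) of degree $2-k$ whose shifts $\underline{\mu_k}=\mathfrak s\circ\mu_k\circ(\mathfrak s^{-1})^{\otimes k}$ (of degree $1$) satisfy, for all $n\ge1$, $\sum_{k+\ell-1=n}\sum_{i+j+1=k}\underline{\mu_k}\circ(id^{\otimes i}\otimes\underline{\mu_\ell}\otimes id^{\otimes j})=0$. All signs are given by the Koszul rule in shifted degrees; underlines denote shifted versions of maps and elements. $d=\mu_1$ and $H(A)$ is its cohomology. Elements are homogeneous. $A_\infty$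 modules. An $A_\infty$ module $M$ over $A$ has maps $\beta_{k,\ell}:A^{\otimes k}\otimes M\otimes A^{\otimes\ell}\to M$ ($k,\ell\ge0$) of degree $1-k-\ell$ whose shifts (of degree $1$) satisfy, for all $r,s\ge0$, $\sum_{k+\ell-1=r}\sum_{i+j+1=k}\underline{\beta_{k,s}}(id^{\otimes i}\otimes\underline{\mu_\ell}\otimes id^{\otimes j}\otimes id_{\underline M}\otimes id^{\otimes s})+\sum_{k+i=r,\,\ell+j=s}\underline{\beta_{i,j}}(id^{\otimes i}\otimes\underline{\beta_{k,\ell}}\otimes id^{\otimes j})+\sum_{k+\ell-1=s}\sum_{i+j+1=k}\underline{\beta_{r,k}}(id^{\otimes r}\otimes id_{\underline M}\otimes id^{\otimes i}\otimes\underline{\mu_\ell}\otimes id^{\otimes j})=0$. The differential of $M$ is $d=\beta_{0,0}$, with cohomology $H(M)$. A morphism $F:M\to N$ of degree $|F|$ of $A_\infty$ modules $(M,\beta),(N,\gamma)$ over $id_A$ consists of maps $F_{k,\ell}:A^{\otimes k}\otimes M\otimes A^{\otimes\ell}\to N$ of degree $|F|-k-\ell$ with $\delta(F)=0$, where $\underline{\delta(F)_{r,s}}$ is the expression of the previous display with the outer maps $\underline{\beta_{k,s}},\underline{\beta_{i,j}},\underline{\beta_{r,k}}$ replaced by $\underline{F_{k,s}},\underline{F_{i,j}},\underline{F_{r,k}}$, minus $(-1)^{|F|}\sum_{k+i=r,\,\ell+j=s}\underline{\gamma_{i,j}}(id^{\otimes i}\otimes\underline{F_{k,\ell}}\otimes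 id^{\otimes j})$. Dual module and inner products. $M^*=Hom(M,R)$ is an $A_\infty$ module over $A$ via $\underline{\beta'_{k,\ell}}(\underline{a_1},\dots,\underline{a_k},\underline{m^*},\underline{\tilde a_1},\dots,\underline{\tilde a_\ell})(\underline{\tilde m})=-(-1)^{\varepsilon}\,\underline{m^*}(\underline{\beta_{\ell,k}}(\underline{\tilde a_1},\dots,\underline{\tilde a_\ell},\underline{\tilde m},\underline{a_1},\dots,\underline{a_k}))$, with $\varepsilon=(|\underline{a_1}|+\dots+|\underline{a_k}|)(|\underline{m^*}|+|\underline{\tilde a_1}|+\dots+|\underline{\tilde a_\ell}|+|\underline{\tilde m}|)+|\underline{m^*}|$; elements of the shift of $M^*$ are evaluated on $\underline M$ by $\underline{m^*}(\underline m)=m^*(m)$. An $A_\infty$ inner product on $M$ is a morphism $I:M\to M^*$ of $A_\infty$ modules over $id_A$. Cyclic defining systems. Put $N=k+\ell+2$ and let $(x_1,\dots,x_N)\in A^{\times k}\times M\times A^{\times\ell}\times M$ (so $x_{k+1},x_N\in M$). A cyclic triangular system consists of a family $(x_{i,j})_{1\le i\le j\le N-1}$ and a family $(x'_{i,j})$ indexed by pairs $i\preceq j$ in the linear order $k+2\prec\dots\prec N\prec1\prec\dots\prec k$ (corner entries of both families included), with $x_{i,i}=x_i$, $x'_{i,i}=x_i$; $x_{i,j}\in M$ if $i\le k+1\le j$ and $x_{i,j}\in A$ otherwise; $x'_{i,j}\in M$ if $i\preceq N\preceq j$ and $x'_{i,j}\in A$ otherwise; the shifted degree $|\underline{x_{i,j}}|$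 (resp. $|\underline{x'_{i,j}}|$) equals $\sum|\underline{x_m}|$ over $m$ from $i$ to $j$ in the respective order; and $x_{i,j}=x'_{i,j}$ whenever $1\le i\le j\le k$ or $k+2\le i\le j\le k+\ell+1$. The staircase product $\mathcal S^{i,j}$ of either family is defined by letting $\underline{\mathcal S^{i,j}}$ be the sum, over all ways of cutting the interval from $i$ to $j$ (in the respective order) into $t\ge2$ consecutive nonempty subintervals $[u_1,v_1],\dots,[u_t,v_t]$, of $\underline{\mu_t}$ (if all entries are in $A$) or $\underline{\beta_{r,s}}$ with $r+s+1=t$ (if the $(r+1)$-st entry is in $M$) applied to the shifted entries with indices $(u_1,v_1),\dots,(u_t,v_t)$. The system is a cyclic defining system if $d(x_{i,j})=-\mathcal S^{i,j}(\{x_{\bullet\bullet}\})$ and $d(x'_{i,j})=-\mathcal S^{i,j}(\{x'_{\bullet\bullet}\})$ for all $(i,j)$, corners included. Massey inner product. The staircase inner product of a cyclic defining system is $$\mathcal I=\sum(-1)^{\varepsilon}\,\underline{I_{r,s}}(\underline{x_{u_1,v_1}},\dots,\underline{x_{u_{r+s+1},v_{r+s+1}}})(\underline{x'_{q+1,p-1}})\in R,$$ summed over all $1\le p\le k+1\le q\le k+\ell+1$ and all ways of cutting $[p,q]$ into consecutive nonempty subintervals $[u_1,v_1],\dots,[u_{r+s+1},v_{r+s+1}]$, where the $(r+1)$-st is the one containing $k+1$; for $p=1$, $p-1$ means $k+\ell+2$; and $(-1)^\varepsilon$ is the Koszul sign of moving $\underline{x_1},\dots,\underline{x_{p-1}}$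 to the end, $\varepsilon=(|\underline{x_1}|+\dots+|\underline{x_{p-1}}|)(|\underline{x_p}|+\dots+|\underline{x_N}|)$. For $k+\ell\ge1$ the $(k,\ell)^{th}$ Massey inner product set $\langle x_1,\dots,x_N\rangle_I\subseteq R$ is the set of all values $\mathcal I$ over all cyclic defining systems for $(x_1,\dots,x_N)$. *)

theory Defs
  imports Complex_Main "HOL-Library.FuncSet" "HOL-Library.Function_Algebras"
begin

section \<open>Graded modules, shifted elements and Koszul signs\<close>

text \<open>
  The graded \<open>R\<close>-module is the whole type \<open>'b\<close>, the internal direct sum of its homogeneous
  parts \<open>grade n\<close>, \<open>n \<in> \<int>\<close>. Integer degrees are needed because dual modules have negative ones.
\<close>

locale graded_module = module scale
  for scale :: "'r::comm_ring_1 \<Rightarrow> 'b::ab_group_add \<Rightarrow> 'b" +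
  fixes grade :: "int \<Rightarrow> 'b set"
  assumes grade_subspace: "subspace (grade n)"
    and grade_direct_sum:
      "\<exists>!c. (\<forall>n. c n \<in> grade n) \<and> finite {n. c n \<noteq> 0} \<and> x = (\<Sum>n | c n \<noteq> 0. c n)"

definition hcomp :: "(int \<Rightarrow> 'b::ab_group_add set) \<Rightarrow> int \<Rightarrow> 'b \<Rightarrow> 'b" where
  "hcomp grade n x =
     (THE c. (\<forall>n. c n \<in> grade n) \<and> finite {n. c n \<noteq> 0} \<and> x = (\<Sum>n | c n \<noteq> 0. c n)) n"

text \<open>
  A pair \<open>(n, a)\<close> of type \<open>'b shifted\<close> stands for the element \<open>s(a)\<close> of the shifted module,
  homogeneous of shifted degree \<open>n\<close>; so the unshifted degree of \<open>a\<close> is \<open>n + 1\<close>. Carrying the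
  degree along makes the Koszul signs functions of the arguments, also for \<open>a = 0\<close>.
\<close>

type_synonym 'b shifted = "int \<times> 'b"

definition is_shifted :: "(int \<Rightarrow> 'b set) \<Rightarrow> 'b shifted \<Rightarrow> bool" where
  "is_shifted grade x \<longleftrightarrow> snd x \<in> grade (fst x + 1)"

definition sdeg :: "'b shifted list \<Rightarrow> int" where
  "sdeg xs = sum_list (map fst xs)"

definition sg :: "int \<Rightarrow> 'b::ab_group_add \<Rightarrow> 'b" where
  "sg n x = (if even n then x else - x)"

text \<open>
  Koszul exponent of \<open>(s\<^sup>-\<^sup>1)\<^sup>\<otimes>\<^sup>k\<close> applied to elements of shifted degrees \<open>es\<close>: the element in
  position \<open>i\<close> is passed by the copies of \<open>s\<^sup>-\<^sup>1\<close> (of degree 1) standing to the right of position \<open>i\<close>.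
\<close>

definition desusp :: "int list \<Rightarrow> int" where
  "desusp es = (\<Sum>i<length es. int (length es - Suc i) * es ! i)"


section \<open>A-infinity algebras\<close>

text \<open>The family \<open>(\<mu>\<^sub>k)\<close> is one function on lists, \<open>\<mu>\<^sub>k\<close> being its restriction to lists of length \<open>k \<ge> 1\<close>.\<close>

definition alg_shift :: "('a list \<Rightarrow> 'a::ab_group_add) \<Rightarrow> 'a shifted list \<Rightarrow> 'a shifted" where
  "alg_shift mu xs = (1 + sdeg xs, sg (desusp (map fst xs)) (mu (map snd xs)))"

locale ainf_algebra = graded_module sA A
  for sA :: "'r::comm_ring_1 \<Rightarrow> 'a::ab_group_add \<Rightarrow> 'a" and A :: "int \<Rightarrow> 'a set" +
  fixes mu :: "'a list \<Rightarrow> 'a"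
  assumes nonneg_graded: "n < 0 \<Longrightarrow> A n = {0}"
    and mu_multilinear: "module_hom sA sA (\<lambda>a. mu (us @ a # vs))"
    and mu_degree: "xs \<noteq> [] \<Longrightarrow> \<forall>x\<in>set xs. is_shifted A x \<Longrightarrow>
          mu (map snd xs) \<in> A (2 - int (length xs) + (\<Sum>x\<leftarrow>xs. fst x + 1))"
    and mu_relation: "xs \<noteq> [] \<Longrightarrow> \<forall>x\<in>set xs. is_shifted A x \<Longrightarrow>
          (\<Sum>i<length xs. \<Sum>l=1..length xs - i.
             sg (sdeg (take i xs))
               (snd (alg_shift mu
                 (take i xs @ alg_shift mu (take l (drop i xs)) # drop (i + l) xs)))) = 0"


section \<open>A-infinity modules and their morphisms\<close>

text \<open>
  A family of maps \<open>A\<^sup>\<otimes>\<^sup>k \<otimes> M \<otimes> A\<^sup>\<otimes>\<^sup>l \<rightarrow> N\<close> is one function, \<open>k\<close> and \<open>l\<close> being the lengths of the list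
  arguments. Its shift is given for a family of total degree \<open>D\<close> (i.e. of degrees \<open>D - k - l\<close>).
\<close>

definition bi_shift ::
  "int \<Rightarrow> ('a list \<Rightarrow> 'm \<Rightarrow> 'a list \<Rightarrow> 'n::ab_group_add) \<Rightarrow>
   'a shifted list \<Rightarrow> 'm shifted \<Rightarrow> 'a shifted list \<Rightarrow> 'n shifted" where
  "bi_shift D F xs y zs =
     (D + sdeg xs + fst y + sdeg zs,
      sg (desusp (map fst xs @ fst y # map fst zs)) (F (map snd xs) (snd y) (map snd zs)))"

definition bi_multilinear ::
  "('r::comm_ring_1 \<Rightarrow> 'a::ab_group_add \<Rightarrow> 'a) \<Rightarrow> ('r \<Rightarrow> 'm::ab_group_add \<Rightarrow> 'm) \<Rightarrow>
   ('r \<Rightarrow> 'n::ab_group_add \<Rightarrow> 'n) \<Rightarrow> ('a list \<Rightarrow> 'm \<Rightarrow> 'a list \<Rightarrow> 'n) \<Rightarrow> bool" where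
  "bi_multilinear sA sM sN F \<longleftrightarrow>
     (\<forall>us vs m bs. module_hom sA sN (\<lambda>a. F (us @ a # vs) m bs)) \<and>
     (\<forall>as bs. module_hom sM sN (\<lambda>m. F as m bs)) \<and>
     (\<forall>as m us vs. module_hom sA sN (\<lambda>a. F as m (us @ a # vs)))"

definition bi_degree ::
  "(int \<Rightarrow> 'a set) \<Rightarrow> (int \<Rightarrow> 'm set) \<Rightarrow> (int \<Rightarrow> 'n set) \<Rightarrow> int \<Rightarrow>
   ('a list \<Rightarrow> 'm \<Rightarrow> 'a list \<Rightarrow> 'n) \<Rightarrow> bool" where
  "bi_degree A M N D F \<longleftrightarrow>
     (\<forall>xs y zs. (\<forall>x\<in>set xs. is_shifted A x) \<longrightarrow> is_shifted M y \<longrightarrow> (\<forall>z\<in>set zs. is_shifted A z) \<longrightarrow>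
        F (map snd xs) (snd y) (map snd zs) \<in>
          N (D - int (length xs) - int (length zs)
             + (\<Sum>x\<leftarrow>xs. fst x + 1) + (fst y + 1) + (\<Sum>z\<leftarrow>zs. fst z + 1)))"

text \<open>
  The three-part sum of the module relation, with the outer maps taken from the family \<open>F\<close> of
  total degree \<open>D\<close> and the inner ones from \<open>\<mu>\<close> and \<open>\<beta>\<close>; for \<open>F = \<beta>\<close>, \<open>D = 1\<close> it is the left-hand
  side of the module relation.
\<close>

definition inner_sum ::
  "('a list \<Rightarrow> 'a::ab_group_add) \<Rightarrow> ('a list \<Rightarrow> 'm::ab_group_add \<Rightarrow> 'a list \<Rightarrow> 'm) \<Rightarrow>
   int \<Rightarrow> ('a list \<Rightarrow> 'm \<Rightarrow> 'a list \<Rightarrow> 'n::ab_group_add) \<Rightarrow>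
   'a shifted list \<Rightarrow> 'm shifted \<Rightarrow> 'a shifted list \<Rightarrow> 'n" where
  "inner_sum mu beta D F xs y zs =
     (\<Sum>i<length xs. \<Sum>l=1..length xs - i.
        sg (sdeg (take i xs))
          (snd (bi_shift D F (take i xs @ alg_shift mu (take l (drop i xs)) # drop (i + l) xs) y zs)))
   + (\<Sum>i\<le>length xs. \<Sum>l\<le>length zs.
        sg (sdeg (take i xs))
          (snd (bi_shift D F (take i xs) (bi_shift 1 beta (drop i xs) y (take l zs)) (drop l zs))))
   + (\<Sum>i<length zs. \<Sum>l=1..length zs - i.
        sg (sdeg xs + fst y + sdeg (take i zs))
          (snd (bi_shift D F xs y (take i zs @ alg_shift mu (take l (drop i zs)) # drop (i + l) zs))))"

locale ainf_module = ainf_algebra sA A mu + M: graded_module sM M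
  for sA :: "'r::comm_ring_1 \<Rightarrow> 'a::ab_group_add \<Rightarrow> 'a" and A :: "int \<Rightarrow> 'a set"
    and mu :: "'a list \<Rightarrow> 'a"
    and sM :: "'r \<Rightarrow> 'm::ab_group_add \<Rightarrow> 'm" and M :: "int \<Rightarrow> 'm set" +
  fixes beta :: "'a list \<Rightarrow> 'm \<Rightarrow> 'a list \<Rightarrow> 'm"
  assumes beta_multilinear: "bi_multilinear sA sM sM beta"
    and beta_degree: "bi_degree A M M 1 beta"
    and beta_relation:
      "\<forall>x\<in>set xs. is_shifted A x \<Longrightarrow> is_shifted M y \<Longrightarrow> \<forall>z\<in>set zs. is_shifted A z \<Longrightarrow>
         inner_sum mu beta 1 beta xs y zs = 0"

text \<open>
  Morphisms \<open>(M, \<beta>) \<rightarrow> (N, \<gamma>)\<close> of degree \<open>D\<close> over the identity of \<open>A\<close>. The structure maps of the target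
  enter only through their shifts \<open>gamma_s\<close>, the form in which those of a dual module are given.
\<close>

definition delta ::
  "('a list \<Rightarrow> 'a::ab_group_add) \<Rightarrow> ('a list \<Rightarrow> 'm::ab_group_add \<Rightarrow> 'a list \<Rightarrow> 'm) \<Rightarrow>
   ('a shifted list \<Rightarrow> 'n shifted \<Rightarrow> 'a shifted list \<Rightarrow> 'n shifted) \<Rightarrow>
   int \<Rightarrow> ('a list \<Rightarrow> 'm \<Rightarrow> 'a list \<Rightarrow> 'n::ab_group_add) \<Rightarrow>
   'a shifted list \<Rightarrow> 'm shifted \<Rightarrow> 'a shifted list \<Rightarrow> 'n" where
  "delta mu beta gamma_s D F xs y zs =
     inner_sum mu beta D F xs y zs
     - sg D (\<Sum>i\<le>length xs. \<Sum>l\<le>length zs.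
         sg (D * sdeg (take i xs))
           (snd (gamma_s (take i xs) (bi_shift D F (drop i xs) y (take l zs)) (drop l zs))))"

definition ainf_module_morphism ::
  "('r::comm_ring_1 \<Rightarrow> 'a::ab_group_add \<Rightarrow> 'a) \<Rightarrow> (int \<Rightarrow> 'a set) \<Rightarrow> ('a list \<Rightarrow> 'a) \<Rightarrow>
   ('r \<Rightarrow> 'm::ab_group_add \<Rightarrow> 'm) \<Rightarrow> (int \<Rightarrow> 'm set) \<Rightarrow> ('a list \<Rightarrow> 'm \<Rightarrow> 'a list \<Rightarrow> 'm) \<Rightarrow>
   ('r \<Rightarrow> 'n::ab_group_add \<Rightarrow> 'n) \<Rightarrow> (int \<Rightarrow> 'n set) \<Rightarrow>
   ('a shifted list \<Rightarrow> 'n shifted \<Rightarrow> 'a shifted list \<Rightarrow> 'n shifted) \<Rightarrow>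
   int \<Rightarrow> ('a list \<Rightarrow> 'm \<Rightarrow> 'a list \<Rightarrow> 'n) \<Rightarrow> bool" where
  "ainf_module_morphism sA A mu sM M beta sN N gamma_s D F \<longleftrightarrow>
     bi_multilinear sA sM sN F \<and> bi_degree A M N D F \<and>
     (\<forall>xs y zs. (\<forall>x\<in>set xs. is_shifted A x) \<longrightarrow> is_shifted M y \<longrightarrow> (\<forall>z\<in>set zs. is_shifted A z) \<longrightarrow>
        delta mu beta gamma_s D F xs y zs = 0)"


section \<open>Dual module and inner products\<close>

text \<open>
  Homogeneous parts of \<open>Hom(M, R)\<close>, with \<open>R\<close> in degree 0, as submodules of the function space
  \<open>'m \<Rightarrow> 'r\<close> with pointwise operations.
\<close>

definition dual_grade ::
  "('r::comm_ring_1 \<Rightarrow> 'm::ab_group_add \<Rightarrow> 'm) \<Rightarrow> (int \<Rightarrow> 'm set) \<Rightarrow> int \<Rightarrow> ('m \<Rightarrow> 'r) set" where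
  "dual_grade sM M n =
     {f. module_hom sM (*) f \<and> (\<forall>j. j \<noteq> - n \<longrightarrow> (\<forall>m\<in>M j. f m = 0))}"

definition dual_scale :: "'r::comm_ring_1 \<Rightarrow> ('m \<Rightarrow> 'r) \<Rightarrow> 'm \<Rightarrow> 'r" where
  "dual_scale r f = (\<lambda>m. r * f m)"

text \<open>
  The shifted structure maps of the dual. The defining formula is for homogeneous arguments
  \<open>(j, mt)\<close> of the resulting functional; summing over homogeneous components extends it linearly.
\<close>

definition dual_shifted ::
  "(int \<Rightarrow> 'm::ab_group_add set) \<Rightarrow> ('a list \<Rightarrow> 'm \<Rightarrow> 'a list \<Rightarrow> 'm) \<Rightarrow>
   'a shifted list \<Rightarrow> ('m \<Rightarrow> 'r::comm_ring_1) shifted \<Rightarrow> 'a shifted list \<Rightarrow> ('m \<Rightarrow> 'r) shifted" where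
  "dual_shifted M beta xs f zs =
     (1 + sdeg xs + fst f + sdeg zs,
      \<lambda>m. \<Sum>j | hcomp M (j + 1) m \<noteq> 0.
        - sg (sdeg xs * (fst f + sdeg zs + j) + fst f)
            (snd f (snd (bi_shift 1 beta zs (j, hcomp M (j + 1) m) xs))))"

locale ainf_inner_product = ainf_module sA A mu sM M beta
  for sA :: "'r::comm_ring_1 \<Rightarrow> 'a::ab_group_add \<Rightarrow> 'a" and A :: "int \<Rightarrow> 'a set"
    and mu :: "'a list \<Rightarrow> 'a"
    and sM :: "'r \<Rightarrow> 'm::ab_group_add \<Rightarrow> 'm" and M :: "int \<Rightarrow> 'm set"
    and beta :: "'a list \<Rightarrow> 'm \<Rightarrow> 'a list \<Rightarrow> 'm" +
  fixes D :: int and I :: "'a list \<Rightarrow> 'm \<Rightarrow> 'a list \<Rightarrow> 'm \<Rightarrow> 'r"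
  assumes I_morphism:
    "ainf_module_morphism sA A mu sM M beta dual_scale (dual_grade sM M) (dual_shifted M beta) D I"


section \<open>Cohomology\<close>

definition cocycles :: "(int \<Rightarrow> 'b::ab_group_add set) \<Rightarrow> ('b \<Rightarrow> 'b) \<Rightarrow> int \<Rightarrow> 'b set" where
  "cocycles grade d n = {x \<in> grade n. d x = 0}"

definition cohomologous :: "(int \<Rightarrow> 'b::ab_group_add set) \<Rightarrow> ('b \<Rightarrow> 'b) \<Rightarrow> int \<Rightarrow> ('b \<times> 'b) set" where
  "cohomologous grade d n =
     {(x, y). x \<in> cocycles grade d n \<and> y \<in> cocycles grade d n \<and> x - y \<in> d ` grade (n - 1)}"

definition cohomology :: "(int \<Rightarrow> 'b::ab_group_add set) \<Rightarrow> ('b \<Rightarrow> 'b) \<Rightarrow> int \<Rightarrow> 'b set set" where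
  "cohomology grade d n = cocycles grade d n // cohomologous grade d n"

definition coclass :: "(int \<Rightarrow> 'b::ab_group_add set) \<Rightarrow> ('b \<Rightarrow> 'b) \<Rightarrow> int \<Rightarrow> 'b \<Rightarrow> 'b set" where
  "coclass grade d n x = cohomologous grade d n `` {x}"

definition diff_A :: "('a list \<Rightarrow> 'a) \<Rightarrow> 'a \<Rightarrow> 'a" where
  "diff_A mu a = mu [a]"

definition diff_M :: "('a list \<Rightarrow> 'm \<Rightarrow> 'a list \<Rightarrow> 'm) \<Rightarrow> 'm \<Rightarrow> 'm" where
  "diff_M beta m = beta [] m []"


section \<open>Cyclic defining systems\<close>

text \<open>
  With \<open>N = k + l + 2\<close>, the linear order \<open>k+2, \<dots>, N, 1, \<dots>, k\<close> is realised by the natural numbers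
  \<open>k+2, \<dots>, N+k\<close>, where \<open>N + i\<close> stands for the index \<open>i\<close> if \<open>1 \<le> i \<le> k\<close>. Thus \<open>x'\<close> with indices
  \<open>q+1, p-1\<close> is the entry at \<open>(q+1, N+p-1)\<close>, which covers the convention for \<open>p = 1\<close>.
\<close>

definition label :: "nat \<Rightarrow> nat \<Rightarrow> nat" where
  "label N i = (if i \<le> N then i else i - N)"

definition A_idx :: "nat \<Rightarrow> nat \<Rightarrow> nat set" where
  "A_idx k l = {1..k} \<union> {k+2..k+l+1}"

definition M_idx :: "nat \<Rightarrow> nat \<Rightarrow> nat set" where
  "M_idx k l = {k+1, k+l+2}"

text \<open>Cuts of the interval from \<open>i\<close> to \<open>j\<close> into consecutive nonempty subintervals.\<close>

definition cuts :: "nat \<Rightarrow> nat \<Rightarrow> (nat \<times> nat) list set" where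
  "cuts i j = {bs. (\<forall>(u, v)\<in>set bs. u \<le> v) \<and> concat (map (\<lambda>(u, v). [u..<Suc v]) bs) = [i..<Suc j]}"

text \<open>The same cuts, split at the subinterval that contains \<open>c\<close>.\<close>

definition cuts_at ::
  "nat \<Rightarrow> nat \<Rightarrow> nat \<Rightarrow> ((nat \<times> nat) list \<times> (nat \<times> nat) \<times> (nat \<times> nat) list) set" where
  "cuts_at c i j =
     {(bs, (u, v), bs') | bs u v bs'. bs @ (u, v) # bs' \<in> cuts i j \<and> u \<le> c \<and> c \<le> v}"

text \<open>Sums over infinite sets would be 0, so we record that these sets are finite.\<close>

lemma finite_cuts: "finite (cuts i j)"
proof (rule finite_subset)
  show "cuts i j \<subseteq> {bs. set bs \<subseteq> {i..j} \<times> {i..j} \<and> length bs \<le> length [i..<Suc j]}"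
  proof
    fix bs assume "bs \<in> cuts i j"
    then have le: "\<forall>(u, v)\<in>set bs. u \<le> v"
      and eq: "concat (map (\<lambda>(u, v). [u..<Suc v]) bs) = [i..<Suc j]"
      by (auto simp: cuts_def)
    have "set bs \<subseteq> {i..j} \<times> {i..j}"
    proof clarify
      fix u v assume uv: "(u, v) \<in> set bs"
      then have "u \<le> v" using le by auto
      then have "{u, v} \<subseteq> set (concat (map (\<lambda>(u, v). [u..<Suc v]) bs))"
        using uv by (auto intro!: bexI[of _ "(u, v)"] simp del: upt_Suc)
      then show "u \<in> {i..j} \<and> v \<in> {i..j}" unfolding eq by (auto simp del: upt_Suc)
    qed
    moreover have "length bs \<le> length (concat (map (\<lambda>(u, v). [u..<Suc v]) bs))"
      using le by (induction bs) (auto simp del: upt_Suc)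
    ultimately show "bs \<in> {bs. set bs \<subseteq> {i..j} \<times> {i..j} \<and> length bs \<le> length [i..<Suc j]}"
      unfolding eq by blast
  qed
qed (rule finite_lists_length_le, simp)

lemma finite_cuts_at: "finite (cuts_at c i j)"
proof (rule finite_imageD)
  show "finite ((\<lambda>(bs, b, bs'). (bs @ b # bs', length bs)) ` cuts_at c i j)"
  proof (rule finite_subset)
    show "(\<lambda>(bs, b, bs'). (bs @ b # bs', length bs)) ` cuts_at c i j
            \<subseteq> (SIGMA bs : cuts i j. {..length bs})"
      by (auto simp: cuts_at_def)
  qed (simp add: finite_cuts)
qed (auto simp: inj_on_def)

text \<open>
  A triangular family consists of \<open>XA :: nat \<Rightarrow> nat \<Rightarrow> 'a\<close> and \<open>XM :: nat \<Rightarrow> nat \<Rightarrow> 'm\<close>, whose values at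
  \<open>(i, j)\<close> are the entry if it lies in \<open>A\<close>, respectively in \<open>M\<close>; the other value is never used. The
  unshifted degree of \<open>x\<^sub>m\<close> is \<open>deg m\<close>.
\<close>

definition seg_deg :: "nat \<Rightarrow> (nat \<Rightarrow> int) \<Rightarrow> nat \<Rightarrow> nat \<Rightarrow> int" where
  "seg_deg N deg i j = (\<Sum>m=i..j. deg (label N m) - 1)"

definition entry :: "nat \<Rightarrow> (nat \<Rightarrow> int) \<Rightarrow> (nat \<Rightarrow> nat \<Rightarrow> 'b) \<Rightarrow> nat \<times> nat \<Rightarrow> 'b shifted" where
  "entry N deg X = (\<lambda>(u, v). (seg_deg N deg u v, X u v))"

definition staircase_A ::
  "('a list \<Rightarrow> 'a::ab_group_add) \<Rightarrow> nat \<Rightarrow> (nat \<Rightarrow> int) \<Rightarrow> (nat \<Rightarrow> nat \<Rightarrow> 'a) \<Rightarrow> nat \<Rightarrow> nat \<Rightarrow> 'a" where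
  "staircase_A mu N deg XA i j =
     (\<Sum>bs | bs \<in> cuts i j \<and> 2 \<le> length bs. snd (alg_shift mu (map (entry N deg XA) bs)))"

definition staircase_M ::
  "('a list \<Rightarrow> 'm \<Rightarrow> 'a list \<Rightarrow> 'm::ab_group_add) \<Rightarrow> nat \<Rightarrow> (nat \<Rightarrow> int) \<Rightarrow> nat \<Rightarrow>
   (nat \<Rightarrow> nat \<Rightarrow> 'a) \<Rightarrow> (nat \<Rightarrow> nat \<Rightarrow> 'm) \<Rightarrow> nat \<Rightarrow> nat \<Rightarrow> 'm" where
  "staircase_M beta N deg c XA XM i j =
     (\<Sum>(bs, b, bs') | (bs, b, bs') \<in> cuts_at c i j \<and> 2 \<le> length (bs @ b # bs').
        snd (bi_shift 1 beta (map (entry N deg XA) bs) (entry N deg XM b) (map (entry N deg XA) bs')))"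

text \<open>
  One of the two families of a defining system, on the index range from \<open>lo\<close> to \<open>hi\<close> with
  the only \<open>M\<close>-position \<open>c\<close>.
\<close>

definition defining_family ::
  "(int \<Rightarrow> 'a::ab_group_add set) \<Rightarrow> ('a list \<Rightarrow> 'a) \<Rightarrow>
   (int \<Rightarrow> 'm::ab_group_add set) \<Rightarrow> ('a list \<Rightarrow> 'm \<Rightarrow> 'a list \<Rightarrow> 'm) \<Rightarrow>
   nat \<Rightarrow> (nat \<Rightarrow> int) \<Rightarrow> (nat \<Rightarrow> 'a) \<Rightarrow> (nat \<Rightarrow> 'm) \<Rightarrow> nat \<Rightarrow> nat \<Rightarrow> nat \<Rightarrow>
   (nat \<Rightarrow> nat \<Rightarrow> 'a) \<Rightarrow> (nat \<Rightarrow> nat \<Rightarrow> 'm) \<Rightarrow> bool" where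
  "defining_family A mu M beta N deg xA xM lo c hi XA XM \<longleftrightarrow>
     (\<forall>i\<in>{lo..hi}. if i = c then XM i i = xM (label N i) else XA i i = xA (label N i)) \<and>
     (\<forall>i j. lo \<le> i \<and> i \<le> j \<and> j \<le> hi \<longrightarrow>
        (if i \<le> c \<and> c \<le> j
         then is_shifted M (entry N deg XM (i, j)) \<and>
              diff_M beta (XM i j) = - staircase_M beta N deg c XA XM i j
         else is_shifted A (entry N deg XA (i, j)) \<and>
              diff_A mu (XA i j) = - staircase_A mu N deg XA i j))"

definition cyclic_defining_system ::
  "(int \<Rightarrow> 'a::ab_group_add set) \<Rightarrow> ('a list \<Rightarrow> 'a) \<Rightarrow>
   (int \<Rightarrow> 'm::ab_group_add set) \<Rightarrow> ('a list \<Rightarrow> 'm \<Rightarrow> 'a list \<Rightarrow> 'm) \<Rightarrow>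
   nat \<Rightarrow> nat \<Rightarrow> (nat \<Rightarrow> int) \<Rightarrow> (nat \<Rightarrow> 'a) \<Rightarrow> (nat \<Rightarrow> 'm) \<Rightarrow>
   (nat \<Rightarrow> nat \<Rightarrow> 'a) \<Rightarrow> (nat \<Rightarrow> nat \<Rightarrow> 'm) \<Rightarrow> (nat \<Rightarrow> nat \<Rightarrow> 'a) \<Rightarrow> (nat \<Rightarrow> nat \<Rightarrow> 'm) \<Rightarrow> bool" where
  "cyclic_defining_system A mu M beta k l deg xA xM XA XM XA' XM' \<longleftrightarrow>
     (let N = k + l + 2 in
        defining_family A mu M beta N deg xA xM 1 (k + 1) (N - 1) XA XM \<and>
        defining_family A mu M beta N deg xA xM (k + 2) N (N + k) XA' XM' \<and>
        (\<forall>i j. 1 \<le> i \<and> i \<le> j \<and> j \<le> k \<longrightarrow> XA i j = XA' (N + i) (N + j)) \<and>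
        (\<forall>i j. k + 2 \<le> i \<and> i \<le> j \<and> j \<le> k + l + 1 \<longrightarrow> XA i j = XA' i j))"


section \<open>The Massey inner product\<close>

definition staircase_inner_product ::
  "int \<Rightarrow> ('a list \<Rightarrow> 'm \<Rightarrow> 'a list \<Rightarrow> 'm \<Rightarrow> 'r::comm_ring_1) \<Rightarrow> nat \<Rightarrow> nat \<Rightarrow> (nat \<Rightarrow> int) \<Rightarrow>
   (nat \<Rightarrow> nat \<Rightarrow> 'a) \<Rightarrow> (nat \<Rightarrow> nat \<Rightarrow> 'm) \<Rightarrow> (nat \<Rightarrow> nat \<Rightarrow> 'm) \<Rightarrow> 'r" where
  "staircase_inner_product D I k l deg XA XM XM' =
     (let N = k + l + 2 in
        \<Sum>p=1..k+1. \<Sum>q=k+1..k+l+1. \<Sum>(bs, b, bs')\<in>cuts_at (k + 1) p q.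
          sg ((\<Sum>m=1..<p. deg m - 1) * (\<Sum>m=p..N. deg m - 1))
            (snd (bi_shift D I (map (entry N deg XA) bs) (entry N deg XM b) (map (entry N deg XA) bs'))
              (XM' (q + 1) (N + p - 1))))"

definition massey_inner_product ::
  "(int \<Rightarrow> 'a::ab_group_add set) \<Rightarrow> ('a list \<Rightarrow> 'a) \<Rightarrow>
   (int \<Rightarrow> 'm::ab_group_add set) \<Rightarrow> ('a list \<Rightarrow> 'm \<Rightarrow> 'a list \<Rightarrow> 'm) \<Rightarrow>
   int \<Rightarrow> ('a list \<Rightarrow> 'm \<Rightarrow> 'a list \<Rightarrow> 'm \<Rightarrow> 'r::comm_ring_1) \<Rightarrow>
   nat \<Rightarrow> nat \<Rightarrow> (nat \<Rightarrow> int) \<Rightarrow> (nat \<Rightarrow> 'a) \<Rightarrow> (nat \<Rightarrow> 'm) \<Rightarrow> 'r set" where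
  "massey_inner_product A mu M beta D I k l deg xA xM =
     {staircase_inner_product D I k l deg XA XM XM' | XA XM XA' XM'.
        cyclic_defining_system A mu M beta k l deg xA xM XA XM XA' XM'}"

end

theory Submission
  imports Defs
begin

text \<open>
  Call the curvature of a family of entries over an interval the sum of the structure maps over all cuts of
  the interval, including the trivial one; a defining system is a family with vanishing curvature. The
  \<open>A\<^sub>\<infinity>\<close> relations imply Bianchi identities for arbitrary families: the sum over all cuts, with one block
  replaced by its curvature, vanishes. The morphism relation of \<open>I\<close> gives the cyclic analogue, in which the
  structure map of the dual module turns into the module curvature of the block that wraps around.

  To replace \<open>x\<^sub>i\<close> by \<open>x\<^sub>i + d y\<close>, consider the family with \<open>y\<close> in place of \<open>x\<^sub>i\<close> and zero in all other entries
  whose interval contains \<open>i\<close>. Its curvature is concentrated on the intervals containing \<open>i\<close>; adding it, up to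
  Koszul signs, to the given system changes \<open>x\<^sub>i\<close> to \<open>x\<^sub>i + d y\<close>. Since a cut has only one block containing
  \<open>i\<close>, the effect of this change on the curvature and on the inner product is linear, and it is zero by the
  Bianchi identities. So every value for \<open>x\<close> is a value for the changed tuple, and changing the entries one at
  a time gives equality for cohomologous tuples.
\<close>

section \<open>Cuts of intervals\<close>

text \<open>The exponent \<open>s(u)\<close> in the correction of the entry at \<open>(u, v)\<close>
  is forced. On an interval starting at \<open>p\<close>, the Bianchi identity weights the curvature
  of a block starting at \<open>u\<close> by the degree of \<open>[p, u)\<close>. As
  \<open>s(p)\<close> is that degree plus \<open>s(u)\<close>, both signs together give
  \<open>(-1)^s(p)\<close>, the same for every cut, which factors out. For the inner product the
  common sign is \<open>(-1)^s(1)\<close>; there the rotation signs are compared for two degree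
  functions, since \<open>y\<close> has one degree less than the entry it replaces.

  The inserted family need not be flat, but away from the position it coincides with the given one
  and inherits its flatness.

  Consistency is the other difficulty: an index \<open>i \<le> k\<close> appears as \<open>i\<close>
  in one family and as \<open>N + i\<close> in the other. Hence the position is given by a
  predicate, the degrees are periodic, and one function \<open>s\<close> serves both families, so
  that the corrections agree on shared entries. The cyclic identity involves the curvature of every
  interval of both families, the longest included; this is where the corner entries enter.\<close>

fun chain :: "nat \<Rightarrow> (nat \<times> nat) list \<Rightarrow> nat \<Rightarrow> bool" where
  "chain p [] q \<longleftrightarrow> p = q"
| "chain p (b # bs) q \<longleftrightarrow> fst b = p \<and> p \<le> snd b \<and> chain (Suc (snd b)) bs q"

lemma chain_le: "chain p bs q \<Longrightarrow> p \<le> q"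
  by (induction bs arbitrary: p) force+

lemma chain_append: "chain p (bs @ cs) q \<longleftrightarrow> (\<exists>u. chain p bs u \<and> chain u cs q)"
  by (induction bs arbitrary: p) auto

lemma chain_mem: "chain p bs q \<Longrightarrow> b \<in> set bs \<Longrightarrow> p \<le> fst b \<and> fst b \<le> snd b \<and> snd b < q"
proof (induction bs arbitrary: p)
  case (Cons a bs)
  then show ?case using chain_le[of "Suc (snd a)" bs q] by fastforce
qed simp

lemma chain_length: "chain p bs q \<Longrightarrow> p + length bs \<le> q"
proof (induction bs arbitrary: p)
  case (Cons a bs)
  then show ?case by force
qed simp

lemma finite_chain [simp]: "finite {bs. chain p bs q}"
proof (rule finite_subset)
  show "{bs. chain p bs q} \<subseteq> {bs. set bs \<subseteq> {..q} \<times> {..q} \<and> length bs \<le> q}"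
    using chain_mem chain_length by fastforce
qed (rule finite_lists_length_le, simp)

lemma chain_refl: "chain p bs p \<longleftrightarrow> bs = []"
  using chain_length by fastforce

lemma chain_nth:
  assumes "chain p bs q" "j < length bs"
  shows "chain p (take j bs) (fst (bs ! j))" "fst (bs ! j) \<le> snd (bs ! j)"
    "chain (Suc (snd (bs ! j))) (drop (Suc j) bs) q"
proof -
  have "chain p (take j bs @ bs ! j # drop (Suc j) bs) q"
    using assms by (simp add: Cons_nth_drop_Suc)
  then show "chain p (take j bs) (fst (bs ! j))" "fst (bs ! j) \<le> snd (bs ! j)"
    "chain (Suc (snd (bs ! j))) (drop (Suc j) bs) q"
    by (auto simp: chain_append)
qed

text \<open>Ties the recursion to the concatenation in \<open>cuts\<close>. The conjunct
  \<open>p \<le> q\<close> has to be stated separately: \<open>[p..<q]\<close> is empty also for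
  \<open>q < p\<close>, and the empty list would then pass. The half-open end \<open>q\<close> lets
  adjacent chains compose without index shifts.\<close>

lemma chain_iff:
  "chain p bs q \<longleftrightarrow> p \<le> q \<and> (\<forall>(u, v)\<in>set bs. u \<le> v) \<and>
     concat (map (\<lambda>(u, v). [u..<Suc v]) bs) = [p..<q]"
proof (induction bs arbitrary: p)
  case Nil
  then show ?case by (auto simp: eq_commute[of "[]"])
next
  case (Cons b bs)
  obtain u v where b: "b = (u, v)" by (cases b)
  have 1: "[u..<Suc v] @ [Suc v..<q] = [u..<q]" if "u \<le> v" "Suc v \<le> q"
    using that by (metis le_Suc_eq le_add_diff_inverse upt_add_eq_append)
  have 2: "p = u \<and> Suc v \<le> q \<and> cs = [Suc v..<q]"
    if uv: "u \<le> v" and eq: "[u..<Suc v] @ cs = [p..<q]" for cs :: "nat list"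
  proof -
    have "p < q" using eq uv by (cases "p < q") auto
    then have pu: "p = u" using arg_cong[OF eq, of hd] uv by (simp add: hd_append del: upt_Suc)
    have len: "Suc v - u + length cs = q - p" using arg_cong[OF eq, of length] by (simp del: upt_Suc)
    then have "Suc v \<le> q" using uv pu by linarith
    moreover have "cs = [Suc v..<q]"
      using arg_cong[OF eq, of "drop (Suc v - u)"] uv pu by (simp del: upt_Suc)
    ultimately show ?thesis using pu by simp
  qed
  show ?case
  proof
    assume "chain p (b # bs) q"
    then have uv: "p = u" "u \<le> v" "chain (Suc v) bs q" by (auto simp: b)
    then have "Suc v \<le> q" using chain_le by blast
    then show "p \<le> q \<and> (\<forall>(u, v)\<in>set (b # bs). u \<le> v) \<and>
      concat (map (\<lambda>(u, v). [u..<Suc v]) (b # bs)) = [p..<q]"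
      using 1 uv Cons.IH[of "Suc v"] by (simp add: b del: upt_Suc)
  next
    assume r: "p \<le> q \<and> (\<forall>(u, v)\<in>set (b # bs). u \<le> v) \<and>
      concat (map (\<lambda>(u, v). [u..<Suc v]) (b # bs)) = [p..<q]"
    then have "u \<le> v" "[u..<Suc v] @ concat (map (\<lambda>(u, v). [u..<Suc v]) bs) = [p..<q]"
      by (simp_all add: b del: upt_Suc)
    from 2[OF this] show "chain p (b # bs) q"
      using \<open>u \<le> v\<close> r Cons.IH[of "Suc v"] by (simp add: b del: upt_Suc)
  qed
qed

lemma cuts_chain: "i \<le> Suc j \<Longrightarrow> cuts i j = {bs. chain i bs (Suc j)}"
  unfolding cuts_def chain_iff by blast

lemma cuts_at_chain:
  assumes "i \<le> Suc j"
  shows "cuts_at c i j = {(bs, b, bs'). chain i bs (fst b) \<and> fst b \<le> c \<and> c \<le> snd b \<and>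
    chain (Suc (snd b)) bs' (Suc j)}"
  unfolding cuts_at_def cuts_chain[OF assms]
  by (auto simp: chain_append)

lemma chain_distinct: "chain p bs q \<Longrightarrow> distinct bs"
proof (induction bs arbitrary: p)
  case (Cons b bs)
  then have "chain (Suc (snd b)) bs q" "fst b \<le> snd b" by auto
  then have "b \<notin> set bs" using chain_mem by fastforce
  then show ?case using Cons by auto
qed simp

lemma chain_disjoint:
  assumes "chain p bs q" "b \<in> set bs" "b' \<in> set bs" "fst b \<le> m" "m \<le> snd b" "fst b' \<le> m" "m \<le> snd b'"
  shows "b = b'"
  using assms
proof (induction bs arbitrary: p)
  case (Cons a bs)
  then have "chain (Suc (snd a)) bs q" by auto
  then have "snd a < fst x" if "x \<in> set bs" for x
    using that chain_mem[of "Suc (snd a)" bs q x] by auto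
  then show ?case using Cons by (metis chain.simps(2) leD order.strict_trans1 order.trans set_ConsD)
qed simp

lemma chain_shift: "chain (p + n) (map (\<lambda>(u, v). (u + n, v + n)) bs) (q + n) \<longleftrightarrow> chain p bs q"
proof (induction bs arbitrary: p)
  case (Cons b bs)
  show ?case using Cons[of "Suc (snd b)"] by (cases b) simp
qed simp

lemma chain_shift_image:
  "{bs. chain (p + n) bs (q + n)} = map (\<lambda>(u, v). (u + n, v + n)) ` {bs. chain p bs q}"
proof (intro subset_antisym subsetI)
  fix bs assume bs: "bs \<in> {bs. chain (p + n) bs (q + n)}"
  \<comment> \<open>Subtraction on \<open>nat\<close> loses nothing here, because all blocks of a
    chain from \<open>p + n\<close> have endpoints at least \<open>n\<close>.\<close>
  define cs where "cs = map (\<lambda>(u, v). (u - n, v - n)) bs"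
  have "n \<le> fst b \<and> n \<le> snd b" if "b \<in> set bs" for b
    using chain_mem[of "p + n" bs "q + n" b] bs that by auto
  then have "map (\<lambda>(u, v). (u + n, v + n)) cs = bs"
    unfolding cs_def map_map by (intro map_idI) (auto simp: case_prod_beta)
  then show "bs \<in> map (\<lambda>(u, v). (u + n, v + n)) ` {bs. chain p bs q}"
    using bs chain_shift[of p n cs q] by (auto intro!: image_eqI[of _ _ cs])
qed (auto simp: chain_shift)

lemma inj_shift_map: "inj (map (\<lambda>(u, v). (u + n, v + n :: nat)))"
  by (rule inj_mapI) (auto simp: inj_def)

lemma chain_endpoints:
  assumes "chain u cs (Suc v)" "u \<le> v"
  shows "fst (hd cs) = u" "snd (last cs) = v"
proof -
  have "cs \<noteq> []" using assms by auto
  then obtain b bs where 1: "cs = b # bs" by (cases cs) auto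
  obtain b' bs' where 2: "cs = bs' @ [b']" using \<open>cs \<noteq> []\<close> by (cases cs rule: rev_cases) auto
  show "fst (hd cs) = u" using assms(1) by (simp add: 1)
  show "snd (last cs) = v" using assms(1) by (simp add: 2 chain_append)
qed

lemma cuts_at_block:
  assumes "(bs, b, bs') \<in> cuts_at c p q" "p \<le> Suc q"
  shows "chain p bs (fst b)" "fst b \<le> c" "c \<le> snd b" "chain (Suc (snd b)) bs' (Suc q)" "p \<le> fst b" "snd b \<le> q"
    "chain p (bs @ b # bs') (Suc q)"
proof -
  show 1: "chain p bs (fst b)" "fst b \<le> c" "c \<le> snd b" "chain (Suc (snd b)) bs' (Suc q)"
    using assms(1) unfolding cuts_at_chain[OF assms(2)] by auto
  show "p \<le> fst b" "snd b \<le> q" using chain_le[OF 1(1)] chain_le[OF 1(4)] by auto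
  show "chain p (bs @ b # bs') (Suc q)" using 1 by (auto simp: chain_append)
qed

lemma chain_hd: "chain u cs (fst b) \<Longrightarrow> fst (hd (cs @ [b])) = u"
  by (cases cs) auto

lemma chain_last: "chain (Suc (snd b)) cs (Suc v) \<Longrightarrow> snd (last (b # cs)) = v"
  by (cases cs rule: rev_cases) (auto simp: chain_append)

section \<open>Rearranging sums over nested cuts\<close>

text \<open>Both sides sum over all cuts of \<open>[p, q)\<close> with a distinguished nonempty run of consecutive blocks.\<close>

lemma sum_chain_coarsen:
  fixes H :: "(nat \<times> nat) list \<Rightarrow> (nat \<times> nat) list \<Rightarrow> (nat \<times> nat) list \<Rightarrow> 'g::comm_monoid_add"
  shows "(\<Sum>bs | chain p bs q. \<Sum>i<length bs. \<Sum>l=1..length bs - i.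
            H (take i bs) (take l (drop i bs)) (drop (i + l) bs)) =
         (\<Sum>bs | chain p bs q. \<Sum>j<length bs. \<Sum>cs | chain (fst (bs ! j)) cs (Suc (snd (bs ! j))).
            H (take j bs) cs (drop (Suc j) bs))"
proof -
  \<comment> \<open>The common index set of both sides: the blocks before the run, the nonempty run,
    the blocks after it.\<close>
  let ?T = "{(c1, c2, c3). c2 \<noteq> [] \<and> chain p (c1 @ c2 @ c3) q}"
  have "(\<Sum>bs | chain p bs q. \<Sum>i<length bs. \<Sum>l=1..length bs - i.
            H (take i bs) (take l (drop i bs)) (drop (i + l) bs)) =
        (\<Sum>(bs, i, l)\<in>(SIGMA bs:{bs. chain p bs q}. SIGMA i:{..<length bs}. {1..length bs - i}).
            H (take i bs) (take l (drop i bs)) (drop (i + l) bs))"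
    by (simp add: sum.Sigma split_def)
  also have "\<dots> = (\<Sum>(c1, c2, c3)\<in>?T. H c1 c2 c3)"
  proof (rule sum.reindex_bij_witness[where
          i = "\<lambda>(c1, c2, c3). (c1 @ c2 @ c3, length c1, length c2)" and
          j = "\<lambda>(bs, i, l). (take i bs, take l (drop i bs), drop (i + l) bs)"], goal_cases)
    case (1 t)
    obtain bs i l where t: "t = (bs, i, l)" by (metis prod.collapse)
    have e: "take l (drop i bs) @ drop (i + l) bs = drop i bs"
      by (metis add.commute append_take_drop_id drop_drop)
    show ?case using 1 unfolding t by (simp add: e)
  next
    case (2 t)
    obtain bs i l where t: "t = (bs, i, l)" by (metis prod.collapse)
    have e: "take l (drop i bs) @ drop (i + l) bs = drop i bs"
      by (metis add.commute append_take_drop_id drop_drop)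
    show ?case using 2 unfolding t by (auto simp: e)
  next
    case (4 t)
    then show ?case by (cases t) (auto simp: Suc_le_eq)
  qed auto
  also have "\<dots> = (\<Sum>(bs, j, cs)\<in>(SIGMA bs:{bs. chain p bs q}. SIGMA j:{..<length bs}.
            {cs. chain (fst (bs ! j)) cs (Suc (snd (bs ! j)))}). H (take j bs) cs (drop (Suc j) bs))"
  \<comment> \<open>The run \<open>c2\<close> is merged into the one block that it covers, and
    \<open>cs\<close> records how this block was cut.\<close>
  proof (rule sum.reindex_bij_witness[where
          j = "\<lambda>(c1, c2, c3). (c1 @ (fst (hd c2), snd (last c2)) # c3, length c1, c2)" and
          i = "\<lambda>(bs, j, cs). (take j bs, cs, drop (Suc j) bs)"], goal_cases)
    case (1 t)
    then show ?case by (cases t) auto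
  next
    case (2 t)
    obtain c1 c2 c3 where t: "t = (c1, c2, c3)" by (cases t)
    with 2 obtain u v where uv: "chain p c1 u" "chain u c2 v" "chain v c3 q" "c2 \<noteq> []"
      by (auto simp: chain_append)
    moreover have "u < v" using uv chain_length[of u c2 v] by (cases c2) auto
    then obtain v' where "v = Suc v'" "u \<le> v'" by (cases v) auto
    ultimately show ?case using chain_endpoints[of u c2 v'] uv
      by (simp add: t chain_append del: chain.simps(1))
  next
    case (3 t)
    obtain bs j cs where t: "t = (bs, j, cs)" by (cases t)
    with 3 have b: "chain p bs q" "j < length bs" "chain (fst (bs ! j)) cs (Suc (snd (bs ! j)))"
      by auto
    have "(fst (hd cs), snd (last cs)) = bs ! j" using chain_endpoints[OF b(3) chain_nth(2)[OF b(1,2)]] by simp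
    then show ?case using b by (simp add: t Cons_nth_drop_Suc)
  next
    case (4 t)
    obtain bs j cs where t: "t = (bs, j, cs)" by (cases t)
    with 4 have b: "chain p bs q" "j < length bs" "chain (fst (bs ! j)) cs (Suc (snd (bs ! j)))"
      by auto
    have "cs \<noteq> []" using b chain_nth(2)[OF b(1,2)] by auto
    moreover have "chain p (take j bs @ cs @ drop (Suc j) bs) q"
      using b chain_nth[OF b(1,2)] unfolding chain_append by blast
    ultimately show ?case by (simp add: t)
  next
    case (5 t)
    then show ?case by (cases t) auto
  qed
  also have "\<dots> = (\<Sum>bs | chain p bs q. \<Sum>j<length bs. \<Sum>cs | chain (fst (bs ! j)) cs (Suc (snd (bs ! j))).
            H (take j bs) cs (drop (Suc j) bs))"
    by (simp add: sum.Sigma split_def)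
  finally show ?thesis .
qed

text \<open>Module version of the preceding rearrangement. The run must contain the block around
  \<open>c\<close>, so it is described by a cut point in each of the two side lists and may consist
  of that block alone.\<close>

lemma sum_cuts_at_coarsen:
  fixes H :: "(nat \<times> nat) list \<Rightarrow> (nat \<times> nat) list \<Rightarrow> nat \<times> nat \<Rightarrow> (nat \<times> nat) list \<Rightarrow> (nat \<times> nat) list \<Rightarrow> 'g::comm_monoid_add"
  assumes "p \<le> Suc q"
  shows "(\<Sum>(bs, b, bs')\<in>cuts_at c p q. \<Sum>i\<le>length bs. \<Sum>l\<le>length bs'.
            H (take i bs) (drop i bs) b (take l bs') (drop l bs')) =
         (\<Sum>(bs, b, bs')\<in>cuts_at c p q. \<Sum>(cs, b0, cs')\<in>cuts_at c (fst b) (snd b). H bs cs b0 cs' bs')"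
proof -
  let ?S = "SIGMA t:cuts_at c p q. SIGMA i:{..length (fst t)}. {..length (snd (snd t))}"
  let ?T = "SIGMA t:cuts_at c p q. cuts_at c (fst (fst (snd t))) (snd (fst (snd t)))"
  note cuts_at = cuts_at_chain[OF assms]
  have "(\<Sum>(bs, b, bs')\<in>cuts_at c p q. \<Sum>i\<le>length bs. \<Sum>l\<le>length bs'.
            H (take i bs) (drop i bs) b (take l bs') (drop l bs')) =
        (\<Sum>((bs, b, bs'), i, l)\<in>?S. H (take i bs) (drop i bs) b (take l bs') (drop l bs'))"
    by (simp add: sum.Sigma split_def finite_cuts_at)
  also have "\<dots> = (\<Sum>((bs, b, bs'), cs, b0, cs')\<in>?T. H bs cs b0 cs' bs')"
  \<comment> \<open>\<open>hd\<close> and \<open>last\<close> are taken of lists that include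
    \<open>b\<close>, since \<open>drop i bs\<close> and \<open>take l bs'\<close> may be
    empty.\<close>
  proof (rule sum.reindex_bij_witness[where
          j = "\<lambda>((bs, b, bs'), i, l). ((take i bs, (fst (hd (drop i bs @ [b])), snd (last (b # take l bs'))), drop l bs'),
                  drop i bs, b, take l bs')" and
          i = "\<lambda>((bs, b, bs'), cs, b0, cs'). ((bs @ cs, b0, cs' @ bs'), length bs, length cs')"], goal_cases)
    case (1 t)
    then show ?case by auto
  next
    case (2 t)
    obtain bs b bs' i l where t: "t = ((bs, b, bs'), i, l)" by (metis prod.collapse)
    then have c: "chain p (take i bs @ drop i bs) (fst b)" "fst b \<le> c" "c \<le> snd b"
      "chain (Suc (snd b)) (take l bs' @ drop l bs') (Suc q)"
      using 2 by (auto simp: cuts_at)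
    then obtain u v where uv: "chain p (take i bs) u" "chain u (drop i bs) (fst b)"
      "chain (Suc (snd b)) (take l bs') v" "chain v (drop l bs') (Suc q)"
      unfolding chain_append by blast
    then obtain v' where v': "v = Suc v'" using chain_le by (metis Suc_le_D)
    have le: "u \<le> fst b" "snd b \<le> v'" using uv chain_le v' by blast+
    have uv': "u \<le> Suc v'" using le c by simp
    have "(take i bs, (u, v'), drop l bs') \<in> cuts_at c p q"
      using uv le c unfolding cuts_at v' by simp
    moreover have "(drop i bs, b, take l bs') \<in> cuts_at c u v'"
      using uv c unfolding cuts_at_chain[OF uv'] v' by simp
    ultimately show ?case using chain_hd[OF uv(2)] chain_last[OF uv(3)[unfolded v']] unfolding t
      by (simp del: last.simps)
  next
    case (3 t)
    obtain bs b bs' cs b0 cs' where t: "t = ((bs, b, bs'), cs, b0, cs')" by (metis prod.collapse)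
    have b: "fst b \<le> c" "c \<le> snd b" using 3 by (auto simp: t cuts_at)
    then have "fst b \<le> Suc (snd b)" by simp
    from cuts_at_chain[OF this] have "chain (fst b) cs (fst b0)" "chain (Suc (snd b0)) cs' (Suc (snd b))"
      using 3 by (auto simp: t)
    then show ?case using chain_hd chain_last by (simp add: t del: last.simps)
  next
    case (4 t)
    obtain bs b bs' cs b0 cs' where t: "t = ((bs, b, bs'), cs, b0, cs')" by (metis prod.collapse)
    have b: "fst b \<le> c" "c \<le> snd b" "chain p bs (fst b)" "chain (Suc (snd b)) bs' (Suc q)"
      using 4 by (auto simp: t cuts_at)
    then have "fst b \<le> Suc (snd b)" by simp
    from cuts_at_chain[OF this] have "chain (fst b) cs (fst b0)" "fst b0 \<le> c" "c \<le> snd b0"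
      "chain (Suc (snd b0)) cs' (Suc (snd b))"
      using 4 by (auto simp: t)
    then have "(bs @ cs, b0, cs' @ bs') \<in> cuts_at c p q"
      using b unfolding cuts_at by (auto simp: chain_append)
    then show ?case by (simp add: t)
  next
    case (5 t)
    then show ?case by auto
  qed
  also have "\<dots> = (\<Sum>(bs, b, bs')\<in>cuts_at c p q. \<Sum>(cs, b0, cs')\<in>cuts_at c (fst b) (snd b). H bs cs b0 cs' bs')"
    by (simp add: sum.Sigma split_def finite_cuts_at)
  finally show ?thesis .
qed

text \<open>Once the block around \<open>c\<close> is fixed, its two sides vary independently; each
  becomes a sum over chains to which the rearrangement for algebras applies.\<close>

lemma sum_cuts_at:
  fixes f :: "(nat \<times> nat) list \<Rightarrow> nat \<times> nat \<Rightarrow> (nat \<times> nat) list \<Rightarrow> 'g::comm_monoid_add"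
  assumes "p \<le> Suc q"
  shows "(\<Sum>(bs, b, bs')\<in>cuts_at c p q. f bs b bs') =
    (\<Sum>b\<in>{p..c} \<times> {c..q}. \<Sum>bs | chain p bs (fst b). \<Sum>bs' | chain (Suc (snd b)) bs' (Suc q). f bs b bs')"
proof -
  have "(\<Sum>b\<in>{p..c} \<times> {c..q}. \<Sum>bs | chain p bs (fst b). \<Sum>bs' | chain (Suc (snd b)) bs' (Suc q). f bs b bs') =
    (\<Sum>(b, bs, bs')\<in>(SIGMA b:{p..c} \<times> {c..q}. {bs. chain p bs (fst b)} \<times> {bs'. chain (Suc (snd b)) bs' (Suc q)}).
       f bs b bs')"
    by (simp add: sum.Sigma split_def)
  also have "\<dots> = (\<Sum>(bs, b, bs')\<in>cuts_at c p q. f bs b bs')"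
    by (rule sum.reindex_bij_witness[where
          j = "\<lambda>(b, bs, bs'). (bs, b, bs')" and i = "\<lambda>(bs, b, bs'). (b, bs, bs')"])
      (auto simp: cuts_at_chain[OF assms] dest: chain_le)
  finally show ?thesis by simp
qed

section \<open>Additive functions of lists of shifted elements\<close>

text \<open>The degree label \<open>d\<close> stays fixed while the element varies, because the
  Koszul signs in \<open>G\<close> depend on the label.\<close>

definition slot_additive :: "('b::ab_group_add shifted list \<Rightarrow> 'g::ab_group_add) \<Rightarrow> bool" where
  "slot_additive G \<longleftrightarrow> (\<forall>us d vs. additive (\<lambda>a. G (us @ (d, a) # vs)))"

lemma slot_additiveD: "slot_additive G \<Longrightarrow> additive (\<lambda>a. G (us @ (d, a) # vs))"
  by (simp add: slot_additive_def)

lemma sg_add_exp: "sg (m + n) x = sg m (sg n x)"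
  by (simp add: sg_def)

lemma sg_zero [simp]: "sg n 0 = 0"
  by (simp add: sg_def)

lemma sg_eq_0_iff: "sg n x = 0 \<longleftrightarrow> x = 0"
  by (simp add: sg_def)

lemma sg_plus: "sg n (x + y) = sg n x + sg n y"
  by (simp add: sg_def)

lemma sg_sum: "sg n (sum f S) = (\<Sum>x\<in>S. sg n (f x))"
  by (simp add: sg_def sum_negf)

lemma sg_parity: "even (m - n) \<Longrightarrow> sg m x = sg n x"
  by (simp add: sg_def)

lemma additive_sg: "additive f \<Longrightarrow> f (sg n a) = sg n (f a)"
  by (simp add: sg_def additive.minus)

text \<open>The derivative of \<open>G\<close> at the entries \<open>e\<close> in the direction
  \<open>z\<close>. The labels of \<open>z\<close> may differ from those of \<open>e\<close>: a
  curvature has degree one more than the entry whose place it takes.\<close>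

definition variation ::
  "('b::ab_group_add shifted list \<Rightarrow> 'g::ab_group_add) \<Rightarrow> ('i \<Rightarrow> 'b shifted) \<Rightarrow> ('i \<Rightarrow> 'b shifted) \<Rightarrow> 'i list \<Rightarrow> 'g" where
  "variation G e z bs = (\<Sum>j<length bs. G (map e (take j bs) @ z (bs ! j) # map e (drop (Suc j) bs)))"

lemma variation_eq_0:
  assumes G: "slot_additive G" and z: "\<And>b. b \<in> set bs \<Longrightarrow> snd (z b) = 0"
  shows "variation G e z bs = 0"
  unfolding variation_def
proof (rule sum.neutral, clarsimp)
  fix j assume "j < length bs"
  then have "z (bs ! j) = (fst (z (bs ! j)), 0)" using z by (metis nth_mem prod.collapse)
  then show "G (map e (take j bs) @ z (bs ! j) # map e (drop (Suc j) bs)) = 0"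
    using additive.zero[OF slot_additiveD[OF G]] by metis
qed

text \<open>Only the block \<open>b0\<close> can change, so the multilinear expansion has no terms
  beyond first order. The block need not occur in \<open>bs\<close>; then both sides are
  unchanged.\<close>

lemma variation_single:
  assumes G: "slot_additive G"
    and off: "\<And>b. b \<in> set bs \<Longrightarrow> b \<noteq> b0 \<Longrightarrow> snd (z b) = 0"
    and e': "\<And>b. b \<in> set bs \<Longrightarrow> fst (z b) = fst (e b) \<and> e' b = (fst (e b), snd (e b) + snd (z b))"
    and "distinct bs"
  shows "G (map e' bs) = G (map e bs) + variation G e z bs"
proof (cases "b0 \<in> set bs")
  case False
  then have z0: "\<And>b. b \<in> set bs \<Longrightarrow> snd (z b) = 0" using off by metis
  then have "map e' bs = map e bs" using e' by simp
  then show ?thesis using variation_eq_0[of G bs z e, OF G z0] by (metis add_0_right)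
next
  case True
  then obtain cs ds where bs: "bs = cs @ b0 # ds" by (meson split_list)
  then have "b0 \<notin> set cs" "b0 \<notin> set ds" using \<open>distinct bs\<close> by auto
  then have z0: "snd (z b) = 0" if "b \<in> set cs \<union> set ds" for b using that off bs by auto
  then have cd: "map e' cs = map e cs" "map e' ds = map e ds" using e' by (simp_all add: bs)
  have e0: "e' b0 = (fst (e b0), snd (e b0) + snd (z b0))" "z b0 = (fst (e b0), snd (z b0))"
    using e'[of b0] by (auto simp: bs prod_eq_iff)
  have "variation G e z bs = (\<Sum>j\<in>{length cs}. G (map e (take j bs) @ z (bs ! j) # map e (drop (Suc j) bs)))"
    unfolding variation_def
  proof (rule sum.mono_neutral_right)
    show "\<forall>j\<in>{..<length bs} - {length cs}. G (map e (take j bs) @ z (bs ! j) # map e (drop (Suc j) bs)) = 0"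
    proof
      fix j assume j: "j \<in> {..<length bs} - {length cs}"
      then have "bs ! j \<noteq> b0" using \<open>distinct bs\<close> nth_eq_iff_index_eq[of bs j "length cs"]
        by (auto simp: bs)
      then have "z (bs ! j) = (fst (z (bs ! j)), 0)" using off[of "bs ! j"] j by (auto simp: prod_eq_iff)
      then show "G (map e (take j bs) @ z (bs ! j) # map e (drop (Suc j) bs)) = 0"
        using additive.zero[OF slot_additiveD[OF G]] by metis
    qed
  qed (auto simp: bs)
  also have "\<dots> = G (map e cs @ z b0 # map e ds)" by (simp add: bs)
  finally have "variation G e z bs = G (map e cs @ (fst (e b0), snd (z b0)) # map e ds)"
    using e0(2) by simp
  moreover have "G (map e' bs) = G (map e cs @ (fst (e b0), snd (e b0)) # map e ds) +
     G (map e cs @ (fst (e b0), snd (z b0)) # map e ds)"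
    unfolding bs using additive.add[OF slot_additiveD[OF G]] by (simp add: cd e0(1))
  ultimately show ?thesis by (simp add: bs)
qed

definition bi_additive ::
  "('a::ab_group_add shifted list \<Rightarrow> 'm::ab_group_add shifted \<Rightarrow> 'a shifted list \<Rightarrow> 'g::ab_group_add) \<Rightarrow> bool" where
  "bi_additive G \<longleftrightarrow> (\<forall>y zs. slot_additive (\<lambda>xs. G xs y zs)) \<and>
     (\<forall>xs d zs. additive (\<lambda>a. G xs (d, a) zs)) \<and> (\<forall>xs y. slot_additive (G xs y))"

lemma bi_additiveD:
  assumes "bi_additive G"
  shows "slot_additive (\<lambda>xs. G xs y zs)" "additive (\<lambda>a. G xs (d, a) zs)" "slot_additive (G xs y)"
  using assms unfolding bi_additive_def by blast+

definition bi_variation ::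
  "('a::ab_group_add shifted list \<Rightarrow> 'm::ab_group_add shifted \<Rightarrow> 'a shifted list \<Rightarrow> 'g::ab_group_add) \<Rightarrow>
   ('i \<Rightarrow> 'a shifted) \<Rightarrow> ('i \<Rightarrow> 'm shifted) \<Rightarrow> ('i \<Rightarrow> 'a shifted) \<Rightarrow> ('i \<Rightarrow> 'm shifted) \<Rightarrow>
   'i list \<Rightarrow> 'i \<Rightarrow> 'i list \<Rightarrow> 'g" where
  "bi_variation G e m zA zM bs b bs' =
     variation (\<lambda>xs. G xs (m b) (map e bs')) e zA bs + G (map e bs) (zM b) (map e bs')
     + variation (G (map e bs) (m b)) e zA bs'"

lemma bi_variation_eq_0:
  assumes G: "bi_additive G"
    and z: "\<And>x. x \<in> set bs \<union> set bs' \<Longrightarrow> snd (zA x) = 0" "snd (zM b) = 0"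
  shows "bi_variation G e m zA zM bs b bs' = 0"
proof -
  note G' = bi_additiveD[OF G]
  have "G (map e bs) (zM b) (map e bs') = 0"
    using additive.zero[OF G'(2), of "map e bs" "fst (zM b)" "map e bs'"] z(2) by (metis prod.collapse)
  then show ?thesis
    using variation_eq_0[OF G'(1), of bs zA] variation_eq_0[OF G'(3), of bs' zA] z(1)
    by (simp add: bi_variation_def)
qed

lemma bi_variation_single:
  assumes G: "bi_additive G"
    and off: "\<And>x. x \<in> set bs \<union> set bs' \<Longrightarrow> x \<noteq> b0 \<Longrightarrow> snd (zA x) = 0" "b \<noteq> b0 \<Longrightarrow> snd (zM b) = 0"
    and e': "\<And>x. x \<in> set bs \<union> set bs' \<Longrightarrow> fst (zA x) = fst (e x) \<and> e' x = (fst (e x), snd (e x) + snd (zA x))"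
    and m': "fst (zM b) = fst (m b)" "m' b = (fst (m b), snd (m b) + snd (zM b))"
    and "distinct (bs @ b # bs')"
  shows "G (map e' bs) (m' b) (map e' bs') = G (map e bs) (m b) (map e bs') + bi_variation G e m zA zM bs b bs'"
proof -
  have left: "slot_additive (\<lambda>xs. G xs (m b) (map e bs'))"
    and mid: "additive (\<lambda>a. G (map e bs) (fst (m b), a) (map e bs'))"
    and right: "slot_additive (G (map e bs) (m b))"
    using bi_additiveD[OF G] by blast+
  have same: "e' x = e x" if "x \<in> set bs \<union> set bs'" "x \<noteq> b0" for x
    using e' off(1) that by (simp add: prod_eq_iff)
  have zM: "zM b = (fst (m b), snd (zM b))" using m'(1) by (simp add: prod_eq_iff)
  have m'_split: "G (map e bs) (m' b) (map e bs') = G (map e bs) (m b) (map e bs') + G (map e bs) (zM b) (map e bs')"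
    using additive.add[OF mid, of "snd (m b)" "snd (zM b)"] zM m'(2) by simp
  have left0: "variation (\<lambda>xs. G xs (m b) (map e bs')) e zA bs = 0" "map e' bs = map e bs" if "b0 \<notin> set bs"
    using off(1) same that by (auto intro!: variation_eq_0[OF left])
  have right0: "variation (G (map e bs) (m b)) e zA bs' = 0" "map e' bs' = map e bs'" if "b0 \<notin> set bs'"
    using off(1) same that by (auto intro!: variation_eq_0[OF right])
  have mid0: "G (map e bs) (zM b) (map e bs') = 0" "m' b = m b" if "b \<noteq> b0"
    using off(2)[OF that] additive.zero[OF mid] zM m'(2) by (metis, simp)
  \<comment> \<open>The second case comprises \<open>b = b0\<close> as well as the absence of
    \<open>b0\<close>; additivity in the middle argument treats both alike.\<close>
  consider "b0 \<in> set bs" "b0 \<notin> set bs'" "b \<noteq> b0" | "b0 \<notin> set bs" "b0 \<notin> set bs'"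
    | "b0 \<notin> set bs" "b0 \<in> set bs'" "b \<noteq> b0"
    using \<open>distinct (bs @ b # bs')\<close> by auto
  then show ?thesis
  proof cases
    case 1
    have "G (map e' bs) (m b) (map e bs') = G (map e bs) (m b) (map e bs') +
        variation (\<lambda>xs. G xs (m b) (map e bs')) e zA bs"
      by (rule variation_single[OF left, where ?b0.0 = b0]) (use off e' assms(7) in auto)
    then show ?thesis using 1 mid0 right0 by (simp add: bi_variation_def del: map_eq_conv)
  next
    case 2
    then show ?thesis using m'_split left0 right0 by (simp add: bi_variation_def del: map_eq_conv)
  next
    case 3
    have "G (map e bs) (m b) (map e' bs') = G (map e bs) (m b) (map e bs') +
        variation (G (map e bs) (m b)) e zA bs'"
      by (rule variation_single[OF right, where ?b0.0 = b0]) (use off e' assms(7) in auto)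
    then show ?thesis using 3 mid0 left0 by (simp add: bi_variation_def del: map_eq_conv)
  qed
qed

section \<open>Curvature and Bianchi identities\<close>

definition weight :: "(nat \<Rightarrow> int) \<Rightarrow> nat \<Rightarrow> nat \<Rightarrow> int" where
  "weight w p q = (\<Sum>m=p..<q. w m)"

text \<open>A variant of \<open>entry\<close> with an arbitrary function \<open>w\<close> of shifted
  degrees, so that the degree at a single position can be lowered later.\<close>

definition block_entry :: "(nat \<Rightarrow> int) \<Rightarrow> (nat \<Rightarrow> nat \<Rightarrow> 'b) \<Rightarrow> nat \<times> nat \<Rightarrow> 'b shifted" where
  "block_entry w X b = (weight w (fst b) (Suc (snd b)), X (fst b) (snd b))"

definition signed :: "int \<Rightarrow> 'b::ab_group_add shifted \<Rightarrow> 'b shifted" where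
  "signed n x = (fst x, sg n (snd x))"

lemma weight_add: "p \<le> u \<Longrightarrow> u \<le> q \<Longrightarrow> weight w p u + weight w u q = weight w p q"
  unfolding weight_def by (rule sum.atLeastLessThan_concat)

lemma sdeg_simps [simp]: "sdeg [] = 0" "sdeg (x # xs) = fst x + sdeg xs" "sdeg (xs @ ys) = sdeg xs + sdeg ys"
  by (simp_all add: sdeg_def)

lemma sdeg_chain: "chain p bs q \<Longrightarrow> sdeg (map (block_entry w X) bs) = weight w p q"
proof (induction bs arbitrary: p)
  case (Cons b bs)
  then have "chain (Suc (snd b)) bs q" "fst b = p" "p \<le> snd b" by auto
  then show ?case using Cons.IH chain_le[of "Suc (snd b)" bs q] weight_add[of p "Suc (snd b)" q w]
    by (auto simp: block_entry_def)
qed (simp add: weight_def)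

definition curvature_A ::
  "('a list \<Rightarrow> 'a::ab_group_add) \<Rightarrow> (nat \<Rightarrow> int) \<Rightarrow> (nat \<Rightarrow> nat \<Rightarrow> 'a) \<Rightarrow> nat \<times> nat \<Rightarrow> 'a shifted" where
  "curvature_A mu w X b = (1 + weight w (fst b) (Suc (snd b)),
     \<Sum>bs | chain (fst b) bs (Suc (snd b)). snd (alg_shift mu (map (block_entry w X) bs)))"

definition curvature_M ::
  "('a list \<Rightarrow> 'm \<Rightarrow> 'a list \<Rightarrow> 'm::ab_group_add) \<Rightarrow> (nat \<Rightarrow> int) \<Rightarrow> nat \<Rightarrow>
   (nat \<Rightarrow> nat \<Rightarrow> 'a) \<Rightarrow> (nat \<Rightarrow> nat \<Rightarrow> 'm) \<Rightarrow> nat \<times> nat \<Rightarrow> 'm shifted" where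
  "curvature_M beta w c XA XM b = (1 + weight w (fst b) (Suc (snd b)),
     \<Sum>(bs, b', bs')\<in>cuts_at c (fst b) (snd b).
       snd (bi_shift 1 beta (map (block_entry w XA) bs) (block_entry w XM b') (map (block_entry w XA) bs')))"

text \<open>The inner products over all cuts of one block add up to its curvature, by additivity of
  \<open>G\<close> in that slot; this is possible because the Koszul sign depends only on where the
  block starts. The offset \<open>d\<close> is the degree of whatever stands to the left of the
  list.\<close>

lemma sum_inner_alg:
  fixes w :: "nat \<Rightarrow> int" and X :: "nat \<Rightarrow> nat \<Rightarrow> 'a::ab_group_add" and G :: "'a shifted list \<Rightarrow> 'g::ab_group_add"
  assumes G: "slot_additive G"
  defines "e \<equiv> block_entry w X"
  shows "(\<Sum>bs | chain p bs q. \<Sum>i<length bs. \<Sum>l=1..length bs - i.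
      sg (d + sdeg (map e (take i bs)))
        (G (map e (take i bs) @ alg_shift mu (map e (take l (drop i bs))) # map e (drop (i + l) bs)))) =
    (\<Sum>bs | chain p bs q. variation G e (\<lambda>b. signed (d + weight w p (fst b)) (curvature_A mu w X b)) bs)"
    (is "?L = ?R")
proof -
  have "?L = (\<Sum>bs | chain p bs q. \<Sum>j<length bs. \<Sum>cs | chain (fst (bs ! j)) cs (Suc (snd (bs ! j))).
      sg (d + sdeg (map e (take j bs))) (G (map e (take j bs) @ alg_shift mu (map e cs) # map e (drop (Suc j) bs))))"
    by (rule sum_chain_coarsen[where H = "\<lambda>c1 c2 c3. sg (d + sdeg (map e c1))
        (G (map e c1 @ alg_shift mu (map e c2) # map e c3))"])
  also have "\<dots> = ?R"
    unfolding variation_def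
  proof (intro sum.cong refl)
    fix bs j assume "bs \<in> {bs. chain p bs q}" "j \<in> {..<length bs}"
    then have bs: "chain p bs q" "j < length bs" by auto
    let ?u = "fst (bs ! j)" and ?v = "Suc (snd (bs ! j))"
    let ?G = "\<lambda>a. G (map e (take j bs) @ (1 + weight w ?u ?v, a) # map e (drop (Suc j) bs))"
    have add: "additive ?G" by (rule slot_additiveD[OF G])
    have "(\<Sum>cs | chain ?u cs ?v. sg (d + sdeg (map e (take j bs)))
          (G (map e (take j bs) @ alg_shift mu (map e cs) # map e (drop (Suc j) bs)))) =
        (\<Sum>cs | chain ?u cs ?v. ?G (sg (d + weight w p ?u) (snd (alg_shift mu (map e cs)))))"
      using chain_nth(1)[OF bs]
      by (intro sum.cong refl) (simp add: additive_sg[OF add[unfolded e_def]] e_def sdeg_chain alg_shift_def)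
    also have "\<dots> = G (map e (take j bs) @ signed (d + weight w p ?u) (curvature_A mu w X (bs ! j)) # map e (drop (Suc j) bs))"
      by (simp add: signed_def curvature_A_def additive.sum[OF add[unfolded e_def]] sg_sum e_def)
    finally show "(\<Sum>cs | chain ?u cs ?v. sg (d + sdeg (map e (take j bs)))
          (G (map e (take j bs) @ alg_shift mu (map e cs) # map e (drop (Suc j) bs)))) =
       G (map e (take j bs) @ signed (d + weight w p ?u) (curvature_A mu w X (bs ! j)) # map e (drop (Suc j) bs))" .
  qed
  finally show ?thesis .
qed

text \<open>Abstracts the outer map of \<open>inner_sum\<close>, so that one rearrangement serves
  both \<open>beta\<close> and the scalars obtained from \<open>I\<close> by fixing its last
  argument.\<close>

definition inner_sum_of ::
  "('a list \<Rightarrow> 'a::ab_group_add) \<Rightarrow> ('a list \<Rightarrow> 'm::ab_group_add \<Rightarrow> 'a list \<Rightarrow> 'm) \<Rightarrow>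
   ('a shifted list \<Rightarrow> 'm shifted \<Rightarrow> 'a shifted list \<Rightarrow> 'g::ab_group_add) \<Rightarrow>
   'a shifted list \<Rightarrow> 'm shifted \<Rightarrow> 'a shifted list \<Rightarrow> 'g" where
  "inner_sum_of mu beta G xs y zs =
     (\<Sum>i<length xs. \<Sum>l=1..length xs - i.
        sg (sdeg (take i xs)) (G (take i xs @ alg_shift mu (take l (drop i xs)) # drop (i + l) xs) y zs))
   + (\<Sum>i\<le>length xs. \<Sum>l\<le>length zs.
        sg (sdeg (take i xs)) (G (take i xs) (bi_shift 1 beta (drop i xs) y (take l zs)) (drop l zs)))
   + (\<Sum>i<length zs. \<Sum>l=1..length zs - i.
        sg (sdeg xs + fst y + sdeg (take i zs))
          (G xs y (take i zs @ alg_shift mu (take l (drop i zs)) # drop (i + l) zs)))"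

lemma inner_sum_eq: "inner_sum mu beta D F = inner_sum_of mu beta (\<lambda>xs y zs. snd (bi_shift D F xs y zs))"
  by (intro ext) (simp add: inner_sum_def inner_sum_of_def)

text \<open>The three groups of terms of the module relation become the variations in the left list,
  the module slot and the right list.\<close>

lemma sum_inner_sum_of:
  fixes G :: "'a::ab_group_add shifted list \<Rightarrow> 'm::ab_group_add shifted \<Rightarrow> 'a shifted list \<Rightarrow> 'g::ab_group_add"
    and w :: "nat \<Rightarrow> int" and XA :: "nat \<Rightarrow> nat \<Rightarrow> 'a" and XM :: "nat \<Rightarrow> nat \<Rightarrow> 'm"
  assumes G: "bi_additive G" and pq: "p \<le> Suc q"
  defines "e \<equiv> block_entry w XA" and "m \<equiv> block_entry w XM"
  shows "(\<Sum>(bs, b, bs')\<in>cuts_at c p q. inner_sum_of mu beta G (map e bs) (m b) (map e bs')) =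
    (\<Sum>(bs, b, bs')\<in>cuts_at c p q. bi_variation G e m
       (\<lambda>b. signed (weight w p (fst b)) (curvature_A mu w XA b))
       (\<lambda>b. signed (weight w p (fst b)) (curvature_M beta w c XA XM b)) bs b bs')"
proof -
  let ?zA = "\<lambda>b. signed (weight w p (fst b)) (curvature_A mu w XA b)"
  let ?zM = "\<lambda>b. signed (weight w p (fst b)) (curvature_M beta w c XA XM b)"
  have left: "(\<Sum>(bs, b, bs')\<in>cuts_at c p q. \<Sum>i<length bs. \<Sum>l=1..length bs - i.
        sg (sdeg (map e (take i bs))) (G (map e (take i bs) @ alg_shift mu (map e (take l (drop i bs))) # map e (drop (i + l) bs)) (m b) (map e bs'))) =
     (\<Sum>(bs, b, bs')\<in>cuts_at c p q. variation (\<lambda>xs. G xs (m b) (map e bs')) e ?zA bs)"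
  proof -
    have *: "slot_additive (\<lambda>xs. G xs y zs)" for y zs using bi_additiveD[OF G] by blast
    show ?thesis
      unfolding sum_cuts_at[OF pq] e_def
    proof (rule sum.cong[OF refl], goal_cases)
      case (1 b)
      \<comment> \<open>The list being rearranged is \<open>bs\<close>, so its sum is moved inside
        the sum over \<open>bs'\<close> and moved back afterwards.\<close>
      show ?case
        by (rule trans[OF sum.swap trans[OF _ sum.swap]], rule sum.cong[OF refl])
          (use sum_inner_alg[OF *, where d = 0 and w = w and X = XA] in simp)
    qed
  qed
  have right: "(\<Sum>(bs, b, bs')\<in>cuts_at c p q. \<Sum>i<length bs'. \<Sum>l=1..length bs' - i.
        sg (sdeg (map e bs) + fst (m b) + sdeg (map e (take i bs')))
          (G (map e bs) (m b) (map e (take i bs') @ alg_shift mu (map e (take l (drop i bs'))) # map e (drop (i + l) bs')))) =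
     (\<Sum>(bs, b, bs')\<in>cuts_at c p q. variation (G (map e bs) (m b)) e ?zA bs')"
    unfolding sum_cuts_at[OF pq]
  proof (rule sum.cong[OF refl], rule sum.cong[OF refl], goal_cases)
    case (1 b bs)
    have *: "slot_additive (G (map e bs) (m b))" using bi_additiveD[OF G] by blast
    have bs: "chain p bs (fst b)" "fst b \<le> snd b" using 1 by auto
    then have "p \<le> fst b" using chain_le by blast
    \<comment> \<open>An inner \<open>mu\<close> among the right arguments has passed the left list
      and the module entry; this is the offset \<open>d\<close>.\<close>
    then have d: "sdeg (map e bs) + fst (m b) = weight w p (Suc (snd b))"
      using bs weight_add[of p "fst b" "Suc (snd b)" w] by (simp add: e_def m_def sdeg_chain block_entry_def)
    have "weight w p (Suc (snd b)) + weight w (Suc (snd b)) (fst b') = weight w p (fst b')"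
      if "chain (Suc (snd b)) bs' (Suc q)" "b' \<in> set bs'" for bs' b'
      using chain_mem[OF that] \<open>p \<le> fst b\<close> bs by (intro weight_add) auto
    then have z: "variation (G (map e bs) (m b)) e
       (\<lambda>b'. signed (weight w p (Suc (snd b)) + weight w (Suc (snd b)) (fst b')) (curvature_A mu w XA b')) bs' =
      variation (G (map e bs) (m b)) e ?zA bs'" if "chain (Suc (snd b)) bs' (Suc q)" for bs'
      unfolding variation_def using that by (intro sum.cong refl) simp
    show ?case unfolding d
      using sum_inner_alg[OF *, where d = "weight w p (Suc (snd b))" and w = w and X = XA
          and p = "Suc (snd b)" and q = "Suc q" and mu = mu] z
      by (simp add: e_def)
  qed
  have mid: "(\<Sum>(bs, b, bs')\<in>cuts_at c p q. \<Sum>i\<le>length bs. \<Sum>l\<le>length bs'.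
        sg (sdeg (map e (take i bs))) (G (map e (take i bs))
          (bi_shift 1 beta (map e (drop i bs)) (m b) (map e (take l bs'))) (map e (drop l bs')))) =
     (\<Sum>(bs, b, bs')\<in>cuts_at c p q. G (map e bs) (?zM b) (map e bs'))"
    unfolding sum_cuts_at_coarsen[OF pq, where H = "\<lambda>c1 c2 b c3 c4. sg (sdeg (map e c1)) (G (map e c1)
          (bi_shift 1 beta (map e c2) (m b) (map e c3)) (map e c4))"]
  proof (intro sum.cong refl, clarify)
    fix bs u v bs' assume "(bs, (u, v), bs') \<in> cuts_at c p q"
    then have bs: "chain p bs u" "u \<le> c" "c \<le> v" by (auto simp: cuts_at_chain[OF pq])
    let ?G = "\<lambda>a. G (map e bs) (1 + weight w u (Suc v), a) (map e bs')"
    have add: "additive ?G" using bi_additiveD[OF G] by blast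
    \<comment> \<open>The label of an inner \<open>beta\<close> depends only on the interval it
      covers and not on how this is cut, so all these terms sit in the same slot and additivity
      applies to their sum.\<close>
    have deg: "sdeg (map e cs) + fst (m b0) + sdeg (map e cs') = weight w u (Suc v)"
      if t: "(cs, b0, cs') \<in> cuts_at c u v" for cs b0 cs'
    proof -
      have "u \<le> Suc v" using bs by simp
      from t[unfolded cuts_at_chain[OF this]] have ch: "chain u cs (fst b0)" "fst b0 \<le> snd b0"
        "chain (Suc (snd b0)) cs' (Suc v)" by auto
      then have "u \<le> fst b0" "Suc (snd b0) \<le> Suc v" using chain_le by blast+
      then show ?thesis using ch weight_add[of u "fst b0" "Suc v" w] weight_add[of "fst b0" "Suc (snd b0)" "Suc v" w]
        by (simp add: e_def m_def sdeg_chain block_entry_def)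
    qed
    have "(\<Sum>(cs, b0, cs')\<in>cuts_at c u v. sg (sdeg (map e bs)) (G (map e bs)
          (bi_shift 1 beta (map e cs) (m b0) (map e cs')) (map e bs'))) =
        (\<Sum>(cs, b0, cs')\<in>cuts_at c u v. ?G (sg (weight w p u) (snd (bi_shift 1 beta (map e cs) (m b0) (map e cs')))))"
      using bs(1) deg
      by (intro sum.cong refl) (auto simp: additive_sg[OF add[unfolded e_def]] e_def sdeg_chain bi_shift_def add.assoc)
    also have "\<dots> = G (map e bs) (?zM (u, v)) (map e bs')"
      by (simp add: signed_def curvature_M_def additive.sum[OF add[unfolded e_def]] sg_sum e_def m_def split_def)
    finally show "(\<Sum>(cs, b0, cs')\<in>cuts_at c (fst (u, v)) (snd (u, v)). sg (sdeg (map e bs)) (G (map e bs)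
          (bi_shift 1 beta (map e cs) (m b0) (map e cs')) (map e bs'))) = G (map e bs) (?zM (u, v)) (map e bs')"
      by simp
  qed
  show ?thesis
    unfolding inner_sum_of_def bi_variation_def split_def sum.distrib length_map take_map drop_map
    using left mid right by (simp add: split_def)
qed

section \<open>Degrees and additivity of the structure maps, and the Bianchi identities\<close>

context graded_module
begin

lemma zero_grade: "0 \<in> grade n"
  using subspace_0[OF grade_subspace] .

lemma sg_grade: "x \<in> grade n \<Longrightarrow> sg i x \<in> grade n"
  using subspace_neg[OF grade_subspace] by (simp add: sg_def)

lemma sum_grade: "(\<And>i. i \<in> S \<Longrightarrow> f i \<in> grade n) \<Longrightarrow> sum f S \<in> grade n"
  using subspace_sum[OF grade_subspace] by metis

lemma add_grade: "x \<in> grade n \<Longrightarrow> y \<in> grade n \<Longrightarrow> x + y \<in> grade n"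
  using subspace_add[OF grade_subspace] .

end

lemma module_hom_additive: "module_hom s t f \<Longrightarrow> additive f"
  by (simp add: additive_def module_hom.add)

lemma additive_sg_comp: "additive f \<Longrightarrow> additive (\<lambda>a. sg n (f a))"
  by (simp add: additive_def sg_plus)

lemma sum_fst_Suc: "(\<Sum>x\<leftarrow>xs. fst x + 1) = sdeg xs + int (length xs)"
  by (induction xs) auto

lemma bi_additive_bi_shift:
  fixes F :: "'a::ab_group_add list \<Rightarrow> 'm::ab_group_add \<Rightarrow> 'a list \<Rightarrow> 'n::ab_group_add"
  assumes "bi_multilinear sA sM sN F"
  shows "bi_additive (\<lambda>xs y zs. snd (bi_shift D F xs y zs))"
  unfolding bi_additive_def slot_additive_def bi_shift_def
proof (intro conjI allI)
  fix us vs zs :: "'a shifted list" and d and y :: "'m shifted"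
  have "additive (\<lambda>a. F (map snd us @ a # map snd vs) (snd y) (map snd zs))"
    using assms by (auto simp: bi_multilinear_def intro!: module_hom_additive)
  from additive_sg_comp[OF this]
  show "additive (\<lambda>a. snd (D + sdeg (us @ (d, a) # vs) + fst y + sdeg zs,
     sg (desusp (map fst (us @ (d, a) # vs) @ fst y # map fst zs)) (F (map snd (us @ (d, a) # vs)) (snd y) (map snd zs))))"
    by simp
next
  fix xs zs :: "'a shifted list" and d :: int
  have "additive (\<lambda>a. F (map snd xs) a (map snd zs))"
    using assms by (auto simp: bi_multilinear_def intro!: module_hom_additive)
  from additive_sg_comp[OF this]
  show "additive (\<lambda>a. snd (D + sdeg xs + fst (d, a) + sdeg zs,
     sg (desusp (map fst xs @ fst (d, a) # map fst zs)) (F (map snd xs) (snd (d, a)) (map snd zs))))"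
    by simp
next
  fix xs us vs :: "'a shifted list" and d and y :: "'m shifted"
  have "additive (\<lambda>a. F (map snd xs) (snd y) (map snd us @ a # map snd vs))"
    using assms unfolding bi_multilinear_def by (blast intro: module_hom_additive)
  from additive_sg_comp[OF this]
  show "additive (\<lambda>a. snd (D + sdeg xs + fst y + sdeg (us @ (d, a) # vs),
     sg (desusp (map fst xs @ fst y # map fst (us @ (d, a) # vs))) (F (map snd xs) (snd y) (map snd (us @ (d, a) # vs)))))"
    by simp
qed

context ainf_algebra
begin

lemma slot_additive_mu: "slot_additive (\<lambda>xs. snd (alg_shift mu xs))"
  unfolding slot_additive_def alg_shift_def
  using additive_sg_comp[OF module_hom_additive[OF mu_multilinear]] by simp

lemma is_shifted_alg_shift:
  assumes "xs \<noteq> []" "\<forall>x\<in>set xs. is_shifted A x"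
  shows "is_shifted A (alg_shift mu xs)"
  using mu_degree[OF assms] unfolding sum_fst_Suc
  by (auto simp: is_shifted_def alg_shift_def add.commute intro: sg_grade)

text \<open>Sum of \<open>mu_relation\<close> over all cuts of \<open>[p, q)\<close>: collecting the
  terms by the block that the inner operation merges yields the curvature of that block.\<close>

lemma bianchi_A:
  assumes "p < q" and X: "\<And>u v. p \<le> u \<Longrightarrow> u \<le> v \<Longrightarrow> v < q \<Longrightarrow> is_shifted A (block_entry w X (u, v))"
  shows "(\<Sum>bs | chain p bs q. variation (\<lambda>xs. snd (alg_shift mu xs)) (block_entry w X)
     (\<lambda>b. signed (weight w p (fst b)) (curvature_A mu w X b)) bs) = 0"
proof -
  let ?e = "block_entry w X"
  have "(\<Sum>bs | chain p bs q. variation (\<lambda>xs. snd (alg_shift mu xs)) ?e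
      (\<lambda>b. signed (weight w p (fst b)) (curvature_A mu w X b)) bs) =
    (\<Sum>bs | chain p bs q. \<Sum>i<length bs. \<Sum>l=1..length bs - i. sg (sdeg (map ?e (take i bs)))
      (snd (alg_shift mu (map ?e (take i bs) @ alg_shift mu (map ?e (take l (drop i bs))) # map ?e (drop (i + l) bs)))))"
    using sum_inner_alg[OF slot_additive_mu, where d = 0 and w = w and X = X and mu = mu] by simp
  also have "\<dots> = 0"
  proof (rule sum.neutral, rule ballI)
    fix bs assume "bs \<in> {bs. chain p bs q}"
    then have bs: "chain p bs q" by simp
    then have "map ?e bs \<noteq> []" using \<open>p < q\<close> by auto
    moreover have "\<forall>x\<in>set (map ?e bs). is_shifted A x"
      using X chain_mem[OF bs] by auto
    ultimately show "(\<Sum>i<length bs. \<Sum>l=1..length bs - i. sg (sdeg (map ?e (take i bs)))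
      (snd (alg_shift mu (map ?e (take i bs) @ alg_shift mu (map ?e (take l (drop i bs))) # map ?e (drop (i + l) bs))))) = 0"
      using mu_relation[of "map ?e bs"] by (simp add: take_map drop_map)
  qed
  finally show ?thesis .
qed

lemma is_shifted_curvature_A:
  assumes "u \<le> v" and X: "\<And>u' v'. u \<le> u' \<Longrightarrow> u' \<le> v' \<Longrightarrow> v' \<le> v \<Longrightarrow> is_shifted A (block_entry w X (u', v'))"
  shows "is_shifted A (curvature_A mu w X (u, v))"
proof -
  \<comment> \<open>One unit of the \<open>+ 2\<close> is the degree of the shifted operation, the
    other undoes the shift.\<close>
  have "snd (alg_shift mu (map (block_entry w X) bs)) \<in> A (weight w u (Suc v) + 2)" if bs: "chain u bs (Suc v)" for bs
  proof -
    have "bs \<noteq> []" using bs \<open>u \<le> v\<close> by auto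
    moreover have "\<forall>x\<in>set (map (block_entry w X) bs). is_shifted A x"
      using X chain_mem[OF bs] by (fastforce simp: less_Suc_eq_le)
    ultimately have "is_shifted A (alg_shift mu (map (block_entry w X) bs))"
      by (intro is_shifted_alg_shift) auto
    then show ?thesis using sdeg_chain[OF bs, of w X] by (simp add: is_shifted_def alg_shift_def add.commute)
  qed
  then show ?thesis by (auto simp: is_shifted_def curvature_A_def add.commute intro!: sum_grade)
qed

end

context ainf_module
begin

definition homogeneous_family :: "(nat \<Rightarrow> int) \<Rightarrow> nat \<Rightarrow> nat \<Rightarrow> nat \<Rightarrow> (nat \<Rightarrow> nat \<Rightarrow> 'a) \<Rightarrow> (nat \<Rightarrow> nat \<Rightarrow> 'm) \<Rightarrow> bool" where
  "homogeneous_family w lo c hi XA XM \<longleftrightarrow> (\<forall>u v. lo \<le> u \<and> u \<le> v \<and> v \<le> hi \<longrightarrow>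
     (if u \<le> c \<and> c \<le> v then is_shifted M (block_entry w XM (u, v)) else is_shifted A (block_entry w XA (u, v))))"

lemma homogeneous_cut:
  assumes "homogeneous_family w lo c hi XA XM" "(bs, b, bs') \<in> cuts_at c p q" "lo \<le> p" "p \<le> Suc q" "q \<le> hi"
  shows "\<forall>x\<in>set (map (block_entry w XA) bs). is_shifted A x" "is_shifted M (block_entry w XM b)"
    "\<forall>x\<in>set (map (block_entry w XA) bs'). is_shifted A x"
proof -
  note b = cuts_at_block[OF assms(2,4)]
  have l: "lo \<le> fst x \<and> fst x \<le> snd x \<and> snd x < c" if "x \<in> set bs" for x
    using chain_mem[OF b(1) that] b assms by auto
  have r: "c < fst x \<and> fst x \<le> snd x \<and> snd x \<le> hi" if "x \<in> set bs'" for x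
    using chain_mem[OF b(4) that] b assms by auto
  show "is_shifted M (block_entry w XM b)"
    using assms b unfolding homogeneous_family_def by (cases b) auto
  show "\<forall>x\<in>set (map (block_entry w XA) bs). is_shifted A x"
  proof clarsimp
    fix u v assume "(u, v) \<in> set bs"
    then show "is_shifted A (block_entry w XA (u, v))"
      using l[of "(u, v)"] assms(1,5) b(3,6) unfolding homogeneous_family_def by auto
  qed
  show "\<forall>x\<in>set (map (block_entry w XA) bs'). is_shifted A x"
  proof clarsimp
    fix u v assume "(u, v) \<in> set bs'"
    then show "is_shifted A (block_entry w XA (u, v))"
      using r[of "(u, v)"] assms(1,3) b(2,5) unfolding homogeneous_family_def by auto
  qed
qed

lemmas bi_additive_beta = bi_additive_bi_shift[OF beta_multilinear, of 1]

lemma bianchi_M: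
  assumes "homogeneous_family w lo c hi XA XM" "lo \<le> p" "p \<le> Suc q" "q \<le> hi"
  shows "(\<Sum>(bs, b, bs')\<in>cuts_at c p q. bi_variation (\<lambda>xs y zs. snd (bi_shift 1 beta xs y zs))
       (block_entry w XA) (block_entry w XM)
       (\<lambda>b. signed (weight w p (fst b)) (curvature_A mu w XA b))
       (\<lambda>b. signed (weight w p (fst b)) (curvature_M beta w c XA XM b)) bs b bs') = 0"
  unfolding sum_inner_sum_of[OF bi_additive_beta assms(3), where w = w, symmetric]
proof (intro sum.neutral ballI, clarify)
  fix bs u v bs' assume "(bs, (u, v), bs') \<in> cuts_at c p q"
  then show "inner_sum_of mu beta (\<lambda>xs y zs. snd (bi_shift 1 beta xs y zs)) (map (block_entry w XA) bs)
     (block_entry w XM (u, v)) (map (block_entry w XA) bs') = 0"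
    unfolding inner_sum_eq[symmetric]
    using beta_relation[OF homogeneous_cut[OF assms(1) _ assms(2-4)]] by blast
qed

lemma is_shifted_bi_shift:
  assumes "bi_degree A M N D F" "\<forall>x\<in>set xs. is_shifted A x" "is_shifted M y" "\<forall>z\<in>set zs. is_shifted A z"
  shows "F (map snd xs) (snd y) (map snd zs) \<in> N (fst (bi_shift D F xs y zs) + 1)"
proof -
  have "F (map snd xs) (snd y) (map snd zs) \<in> N (D - int (length xs) - int (length zs)
             + (\<Sum>x\<leftarrow>xs. fst x + 1) + (fst y + 1) + (\<Sum>z\<leftarrow>zs. fst z + 1))"
    using assms unfolding bi_degree_def by blast
  then show ?thesis unfolding sum_fst_Suc by (simp add: bi_shift_def algebra_simps)
qed

lemma sdeg_cut:
  assumes "(bs, b, bs') \<in> cuts_at c p q" "p \<le> Suc q"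
  shows "sdeg (map (block_entry w XA) bs) + (fst (block_entry w XM b) + sdeg (map (block_entry w XA) bs')) = weight w p (Suc q)"
proof -
  note b = cuts_at_block[OF assms]
  have "weight w p (fst b) + (weight w (fst b) (Suc (snd b)) + weight w (Suc (snd b)) (Suc q)) = weight w p (Suc q)"
    using b weight_add[of "fst b" "Suc (snd b)" "Suc q" w] weight_add[of p "fst b" "Suc q" w] by auto
  then show ?thesis by (simp add: sdeg_chain[OF b(1)] sdeg_chain[OF b(4)] block_entry_def)
qed

lemma is_shifted_curvature_M:
  assumes "homogeneous_family w lo c hi XA XM" "lo \<le> p" "p \<le> Suc q" "q \<le> hi"
  shows "is_shifted M (curvature_M beta w c XA XM (p, q))"
proof -
  have "snd (bi_shift 1 beta (map (block_entry w XA) bs) (block_entry w XM b) (map (block_entry w XA) bs'))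
      \<in> M (weight w p (Suc q) + 2)" if b: "(bs, b, bs') \<in> cuts_at c p q" for bs b bs'
    using M.sg_grade[OF is_shifted_bi_shift[OF beta_degree homogeneous_cut[OF assms(1) b assms(2-4)]]]
      sdeg_cut[OF b assms(3), of w XA XM]
    by (simp add: bi_shift_def algebra_simps)
  then show ?thesis by (auto simp: is_shifted_def curvature_M_def add.commute intro!: M.sum_grade)
qed

end

text \<open>Made for comparing the inserted family (primed) with the correction of the given one. A
  term vanishes on both sides unless its slot is marked by \<open>H\<close>, and then all remaining
  entries agree. \<open>G' = G\<close> is asked only in the presence of a marked block, because the
  outer maps contain the arguments on the other side of a module operation, which agree only if the
  marked block is not among them.\<close>

lemma variation_rescale:
  assumes G: "slot_additive G" and G': "slot_additive G'"
    and same: "\<And>b. b \<in> set bs \<Longrightarrow> H b \<Longrightarrow> G' = G"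
    and off: "\<And>b. b \<in> set bs \<Longrightarrow> \<not> H b \<Longrightarrow> snd (z b) = 0 \<and> snd (z' b) = 0"
    and on: "\<And>b. b \<in> set bs \<Longrightarrow> H b \<Longrightarrow> z' b = signed n (z b)"
    and e: "\<And>b b'. b \<in> set bs \<Longrightarrow> b' \<in> set bs \<Longrightarrow> H b \<Longrightarrow> b' \<noteq> b \<Longrightarrow> e' b' = e b'"
    and "distinct bs"
  shows "variation G' e' z' bs = sg n (variation G e z bs)"
  unfolding variation_def sg_sum
proof (intro sum.cong refl)
  fix j assume "j \<in> {..<length bs}"
  then have j: "j < length bs" by simp
  let ?b = "bs ! j" and ?us = "map e (take j bs)" and ?vs = "map e (drop (Suc j) bs)"
    and ?us' = "map e' (take j bs)" and ?vs' = "map e' (drop (Suc j) bs)"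
  show "G' (?us' @ z' ?b # ?vs') = sg n (G (?us @ z ?b # ?vs))"
  proof (cases "H ?b")
    case True
    have bs: "bs = take j bs @ ?b # drop (Suc j) bs" using id_take_nth_drop[OF j] .
    have "?b \<notin> set (take j bs) \<union> set (drop (Suc j) bs)"
      using \<open>distinct bs\<close> by (subst (asm) bs) auto
    then have "e' b' = e b'" if "b' \<in> set (take j bs) \<union> set (drop (Suc j) bs)" for b'
      using that e[of ?b b'] True j by (metis UnE in_set_dropD in_set_takeD nth_mem)
    then have "?us' = ?us" "?vs' = ?vs" by auto
    moreover have "G' = G" "z' ?b = signed n (z ?b)" using same[of ?b] on[of ?b] True j by auto
    ultimately show ?thesis
      using additive_sg[OF slot_additiveD[OF G], of ?us "fst (z ?b)" n "snd (z ?b)" ?vs]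
      by (simp add: signed_def del: map_eq_conv)
  next
    case False
    then have "z ?b = (fst (z ?b), 0)" "z' ?b = (fst (z' ?b), 0)" using off[of ?b] j by (auto simp: prod_eq_iff)
    then show ?thesis
      using additive.zero[OF slot_additiveD[OF G]] additive.zero[OF slot_additiveD[OF G']] by (metis sg_zero)
  qed
qed

lemma bi_variation_rescale:
  assumes G: "bi_additive G"
    and off: "\<And>x. x \<in> set bs \<union> set bs' \<Longrightarrow> \<not> H x \<Longrightarrow> snd (zA x) = 0 \<and> snd (zA' x) = 0"
      "\<not> H b \<Longrightarrow> snd (zM b) = 0 \<and> snd (zM' b) = 0"
    and on: "\<And>x. x \<in> set bs \<union> set bs' \<Longrightarrow> H x \<Longrightarrow> zA' x = signed n (zA x)" "H b \<Longrightarrow> zM' b = signed n (zM b)"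
    and e: "\<And>x y. x \<in> set (bs @ b # bs') \<Longrightarrow> y \<in> set bs \<union> set bs' \<Longrightarrow> H x \<Longrightarrow> y \<noteq> x \<Longrightarrow> e' y = e y"
    and m: "\<And>x. x \<in> set bs \<union> set bs' \<Longrightarrow> H x \<Longrightarrow> m' b = m b"
    and d: "distinct (bs @ b # bs')"
  shows "bi_variation G e' m' zA' zM' bs b bs' = sg n (bi_variation G e m zA zM bs b bs')"
proof -
  note G' = bi_additiveD[OF G]
  \<comment> \<open>A marked block in the middle or on the right leaves the left list unchanged, and
    symmetrically for \<open>r\<close>; this yields the equality of the outer maps.\<close>
  have l: "map e' bs = map e bs" if "x \<in> set (b # bs')" "H x" for x
    using e[of x] that d by auto
  have r: "map e' bs' = map e bs'" if "x \<in> set (bs @ [b])" "H x" for x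
    using e[of x] that d by auto
  have "variation (\<lambda>xs. G xs (m' b) (map e' bs')) e' zA' bs = sg n (variation (\<lambda>xs. G xs (m b) (map e bs')) e zA bs)"
  proof (rule variation_rescale[OF G'(1) G'(1), where H = H], goal_cases)
    case (1 x)
    then show ?case using m[of x] r[of x] by (simp del: map_eq_conv)
  qed (use off on e d in auto)
  moreover have "variation (G (map e' bs) (m' b)) e' zA' bs' = sg n (variation (G (map e bs) (m b)) e zA bs')"
  proof (rule variation_rescale[OF G'(3) G'(3), where H = H], goal_cases)
    case (1 x)
    then show ?case using m[of x] l[of x] by (simp del: map_eq_conv)
  qed (use off on e d in auto)
  moreover have "G (map e' bs) (zM' b) (map e' bs') = sg n (G (map e bs) (zM b) (map e bs'))"
  proof (cases "H b")
    case True
    then show ?thesis using l[of b] r[of b] on(2) additive_sg[OF G'(2), of "map e bs" "fst (zM b)" n "snd (zM b)" "map e bs'"]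
      by (simp add: signed_def del: map_eq_conv)
  next
    case False
    then have "zM b = (fst (zM b), 0)" "zM' b = (fst (zM' b), 0)" using off(2) by (auto simp: prod_eq_iff)
    then show ?thesis using additive.zero[OF G'(2)] by (metis sg_zero)
  qed
  ultimately show ?thesis by (simp add: bi_variation_def sg_plus)
qed

section \<open>Changing one entry by a coboundary\<close>

text \<open>The changed position is a predicate instead of a number, because in the extended
  numbering an index may appear both as \<open>i\<close> and as \<open>N + i\<close>.\<close>

definition hits :: "(nat \<Rightarrow> bool) \<Rightarrow> nat \<times> nat \<Rightarrow> bool" where
  "hits h b \<longleftrightarrow> (\<exists>m\<in>{fst b..snd b}. h m)"

text \<open>The degrees of the tuple with \<open>y\<close> in place of the changed entry:
  \<open>y\<close> lies one degree below its coboundary.\<close>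

definition lowered :: "(nat \<Rightarrow> int) \<Rightarrow> (nat \<Rightarrow> bool) \<Rightarrow> nat \<Rightarrow> int" where
  "lowered w h m = (if h m then w m - 1 else w m)"

text \<open>The new entry \<open>y\<close> is the only one that covers the position, so every cut with a nonzero
  contribution has it as a block of its own.\<close>

definition inserted :: "(nat \<Rightarrow> bool) \<Rightarrow> 'b::zero \<Rightarrow> (nat \<Rightarrow> nat \<Rightarrow> 'b) \<Rightarrow> nat \<Rightarrow> nat \<Rightarrow> 'b" where
  "inserted h y X u v = (if hits h (u, v) then if u = v then y else 0 else X u v)"

text \<open>In the sequel \<open>s u\<close> is the total shifted degree of the entries between \<open>u\<close> and the changed position,
  so that \<open>sg (s u)\<close> is the Koszul sign of moving an odd operator past them.\<close>

definition correction_A ::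
  "('a list \<Rightarrow> 'a::ab_group_add) \<Rightarrow> (nat \<Rightarrow> int) \<Rightarrow> (nat \<Rightarrow> bool) \<Rightarrow> (nat \<Rightarrow> int) \<Rightarrow> 'a \<Rightarrow>
   (nat \<Rightarrow> nat \<Rightarrow> 'a) \<Rightarrow> nat \<Rightarrow> nat \<Rightarrow> 'a" where
  "correction_A mu w h s y X u v =
     (if hits h (u, v) then sg (s u) (snd (curvature_A mu (lowered w h) (inserted h y X) (u, v))) else 0)"

definition correction_M ::
  "('a list \<Rightarrow> 'm \<Rightarrow> 'a list \<Rightarrow> 'm::ab_group_add) \<Rightarrow> (nat \<Rightarrow> int) \<Rightarrow> (nat \<Rightarrow> bool) \<Rightarrow> (nat \<Rightarrow> int) \<Rightarrow> nat \<Rightarrow>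
   'a::ab_group_add \<Rightarrow> 'm \<Rightarrow> (nat \<Rightarrow> nat \<Rightarrow> 'a) \<Rightarrow> (nat \<Rightarrow> nat \<Rightarrow> 'm) \<Rightarrow> nat \<Rightarrow> nat \<Rightarrow> 'm" where
  "correction_M beta w h s c yA yM XA XM u v =
     (if hits h (u, v) then sg (s u) (snd (curvature_M beta (lowered w h) c (inserted h yA XA) (inserted h yM XM) (u, v))) else 0)"

lemma weight_lowered_nohit: "(\<And>m. u \<le> m \<Longrightarrow> m < v \<Longrightarrow> \<not> h m) \<Longrightarrow> weight (lowered w h) u v = weight w u v"
  by (simp add: weight_def lowered_def)

lemma weight_lowered_single:
  assumes "u \<le> i" "i < v" "\<And>m. u \<le> m \<Longrightarrow> m < v \<Longrightarrow> h m \<longleftrightarrow> m = i"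
  shows "weight (lowered w h) u v = weight w u v - 1"
proof -
  have "weight (lowered w h) u v = (\<Sum>m=u..<v. w m - (if m = i then 1 else 0))"
    unfolding weight_def by (intro sum.cong refl) (use assms in \<open>auto simp: lowered_def\<close>)
  then show ?thesis using assms by (simp add: sum_subtractf weight_def)
qed

lemma hits_shift:
  assumes "\<And>m. u \<le> m \<Longrightarrow> m \<le> v \<Longrightarrow> h (n + m) \<longleftrightarrow> h m"
  shows "hits h (n + u, n + v) \<longleftrightarrow> hits h (u, v)"
proof
  assume "hits h (n + u, n + v)"
  then obtain m where m: "n + u \<le> m" "m \<le> n + v" "h m" by (auto simp: hits_def)
  then have "h (m - n)" using assms[of "m - n"] by auto
  then show "hits h (u, v)" using m by (auto simp: hits_def intro!: bexI[of _ "m - n"])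
next
  assume "hits h (u, v)"
  then obtain m where m: "u \<le> m" "m \<le> v" "h m" by (auto simp: hits_def)
  then show "hits h (n + u, n + v)" using assms[of m] by (auto simp: hits_def intro!: bexI[of _ "n + m"])
qed

lemma block_entry_nohit:
  "\<not> hits h b \<Longrightarrow> block_entry (lowered w h) (inserted h y X) b = block_entry w X b"
  by (cases b) (simp add: block_entry_def inserted_def hits_def weight_lowered_nohit)

lemma hits_mono: "hits h b' \<Longrightarrow> fst b \<le> fst b' \<Longrightarrow> snd b' \<le> snd b \<Longrightarrow> hits h b"
  by (force simp: hits_def)

lemma curvature_A_nohit:
  assumes "\<not> hits h b"
  shows "curvature_A mu (lowered w h) (inserted h y X) b = curvature_A mu w X b"
proof -
  have "map (block_entry (lowered w h) (inserted h y X)) bs = map (block_entry w X) bs"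
    if "chain (fst b) bs (Suc (snd b))" for bs
    using assms chain_mem[OF that] hits_mono[of h _ b] by (auto intro!: block_entry_nohit simp: less_Suc_eq_le)
  then have "(\<Sum>bs | chain (fst b) bs (Suc (snd b)). snd (alg_shift mu (map (block_entry (lowered w h) (inserted h y X)) bs)))
    = (\<Sum>bs | chain (fst b) bs (Suc (snd b)). snd (alg_shift mu (map (block_entry w X) bs)))"
    by (intro sum.cong refl) (simp del: map_eq_conv)
  then show ?thesis using assms by (simp add: curvature_A_def weight_lowered_nohit hits_def)
qed

lemma curvature_M_nohit:
  assumes "\<not> hits h b" "fst b \<le> Suc (snd b)"
  shows "curvature_M beta (lowered w h) c (inserted h yA XA) (inserted h yM XM) b = curvature_M beta w c XA XM b"
proof -
  have sub: "map (block_entry (lowered w h) (inserted h yA XA)) bs = map (block_entry w XA) bs"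
    "block_entry (lowered w h) (inserted h yM XM) b' = block_entry w XM b'"
    "map (block_entry (lowered w h) (inserted h yA XA)) bs' = map (block_entry w XA) bs'"
    if "(bs, b', bs') \<in> cuts_at c (fst b) (snd b)" for bs b' bs'
  proof -
    note ch = cuts_at_block(7)[OF that assms(2)]
    have "\<not> hits h x" if "x \<in> set (bs @ b' # bs')" for x
      using assms(1) chain_mem[OF ch that] hits_mono[of h x b] by (auto simp: less_Suc_eq_le)
    note entry = block_entry_nohit[OF this]
    show "map (block_entry (lowered w h) (inserted h yA XA)) bs = map (block_entry w XA) bs"
      by (rule map_cong[OF refl], rule entry) simp
    show "block_entry (lowered w h) (inserted h yM XM) b' = block_entry w XM b'"
      by (rule entry) simp
    show "map (block_entry (lowered w h) (inserted h yA XA)) bs' = map (block_entry w XA) bs'"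
      by (rule map_cong[OF refl], rule entry) simp
  qed
  have "(\<Sum>(bs, b', bs')\<in>cuts_at c (fst b) (snd b).
       snd (bi_shift 1 beta (map (block_entry (lowered w h) (inserted h yA XA)) bs)
         (block_entry (lowered w h) (inserted h yM XM) b') (map (block_entry (lowered w h) (inserted h yA XA)) bs')))
    = (\<Sum>(bs, b', bs')\<in>cuts_at c (fst b) (snd b).
       snd (bi_shift 1 beta (map (block_entry w XA) bs) (block_entry w XM b') (map (block_entry w XA) bs')))"
    by (intro sum.cong refl) (clarify, simp add: sub del: map_eq_conv)
  then show ?thesis using assms by (simp add: curvature_M_def weight_lowered_nohit hits_def)
qed

lemma block_entry_add:
  "block_entry w (\<lambda>u v. X u v + Z u v) b = (fst (block_entry w X b), snd (block_entry w X b) + snd (block_entry w Z b))"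
  by (simp add: block_entry_def)

text \<open>A defining family apart from its prescribed diagonal, with arbitrary degrees. As a
  locale it can be reentered with the corrected entries.\<close>

locale flat_family = ainf_module sA A mu sM M beta
  for sA :: "'r::comm_ring_1 \<Rightarrow> 'a::ab_group_add \<Rightarrow> 'a" and A :: "int \<Rightarrow> 'a set"
    and mu :: "'a list \<Rightarrow> 'a"
    and sM :: "'r \<Rightarrow> 'm::ab_group_add \<Rightarrow> 'm" and M :: "int \<Rightarrow> 'm set"
    and beta :: "'a list \<Rightarrow> 'm \<Rightarrow> 'a list \<Rightarrow> 'm" +
  fixes w :: "nat \<Rightarrow> int" and lo c hi :: nat
    and XA :: "nat \<Rightarrow> nat \<Rightarrow> 'a" and XM :: "nat \<Rightarrow> nat \<Rightarrow> 'm"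
  assumes homogeneous: "homogeneous_family w lo c hi XA XM"
    and flat_A: "lo \<le> u \<Longrightarrow> u \<le> v \<Longrightarrow> v \<le> hi \<Longrightarrow> \<not> (u \<le> c \<and> c \<le> v) \<Longrightarrow> snd (curvature_A mu w XA (u, v)) = 0"
    and flat_M: "lo \<le> u \<Longrightarrow> u \<le> c \<Longrightarrow> c \<le> v \<Longrightarrow> v \<le> hi \<Longrightarrow> snd (curvature_M beta w c XA XM (u, v)) = 0"

text \<open>The exponent \<open>s\<close> is characterised instead of defined, since the two
  families of a cyclic system meet the changed index at different positions and must share it: along
  a stretch without a hit it drops by the degree passed, and it is zero at the hit. As
  \<open>w m\<close> is the shifted degree of the changed entry, it is the unshifted degree required
  of \<open>y\<close>. Both \<open>yA\<close> and \<open>yM\<close> are carried because the position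
  may lie in either module.\<close>

locale entry_change = flat_family +
  fixes h :: "nat \<Rightarrow> bool" and s :: "nat \<Rightarrow> int" and yA :: 'b and yM :: 'c
  assumes unique_hit: "m \<in> {lo..hi} \<Longrightarrow> m' \<in> {lo..hi} \<Longrightarrow> h m \<Longrightarrow> h m' \<Longrightarrow> m = m'"
    and sign_step: "lo \<le> u \<Longrightarrow> u \<le> v \<Longrightarrow> v \<le> hi \<Longrightarrow> (\<And>m. u \<le> m \<Longrightarrow> m < v \<Longrightarrow> \<not> h m) \<Longrightarrow>
      s u = weight w u v + s v"
    and sign_hit: "m \<in> {lo..hi} \<Longrightarrow> h m \<Longrightarrow> s m = 0"
    and yA: "m \<in> {lo..hi} \<Longrightarrow> h m \<Longrightarrow> m \<noteq> c \<Longrightarrow> yA \<in> A (w m)"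
    and yM: "h c \<Longrightarrow> yM \<in> M (w c)"
begin

abbreviation "w' \<equiv> lowered w h"
abbreviation "XA' \<equiv> inserted h yA XA"
abbreviation "XM' \<equiv> inserted h yM XM"
abbreviation "ZA \<equiv> correction_A mu w h s yA XA"
abbreviation "ZM \<equiv> correction_M beta w h s c yA yM XA XM"

lemma weight_hit:
  assumes "lo \<le> u" "u \<le> v" "v \<le> hi" "hits h (u, v)"
  shows "weight w' u (Suc v) = weight w u (Suc v) - 1"
proof -
  obtain m where m: "u \<le> m" "m \<le> v" "h m" using assms(4) by (auto simp: hits_def)
  show ?thesis
    by (rule weight_lowered_single[of _ m]) (use assms m unique_hit in auto)
qed

lemma hits_unique_block:
  assumes "chain p bs q" "lo \<le> p" "q \<le> Suc hi" "b \<in> set bs" "b' \<in> set bs" "hits h b" "hits h b'"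
  shows "b' = b"
proof -
  obtain m where m: "fst b \<le> m" "m \<le> snd b" "h m" using assms(6) by (auto simp: hits_def)
  obtain m' where m': "fst b' \<le> m'" "m' \<le> snd b'" "h m'" using assms(7) by (auto simp: hits_def)
  have "m \<in> {lo..hi}" "m' \<in> {lo..hi}"
    using chain_mem[OF assms(1,4)] chain_mem[OF assms(1,5)] m m' assms(2,3) by auto
  then have "m' = m" using unique_hit m m' by blast
  then show ?thesis using chain_disjoint[OF assms(1,5,4)] m m' by blast
qed

text \<open>The sign relating the two sides depends on the start \<open>p\<close> of the interval only, so it factors out of
  every sum over the cuts of that interval.\<close>

lemma curvature_inserted:
  assumes b: "lo \<le> p" "p \<le> fst b" "fst b \<le> snd b" "snd b \<le> hi" "hits h b"
    and C: "fst C = 1 + weight w' (fst b) (Suc (snd b))"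
  shows "signed (weight w' p (fst b)) C =
    signed (s p) (weight w (fst b) (Suc (snd b)), sg (s (fst b)) (snd C))"
proof (cases "\<exists>m. p \<le> m \<and> m < fst b \<and> h m")
  case False
  then have "s p = weight w p (fst b) + s (fst b)" "weight w' p (fst b) = weight w p (fst b)"
    using sign_step[of p "fst b"] b weight_lowered_nohit[of p "fst b" h w] by auto
  \<comment> \<open>The exponents \<open>weight w p (fst b)\<close> and
    \<open>s p + s (fst b)\<close> agree modulo 2. The labels agree too: the operator raises the
    degree by one and lowering at the hit takes it back.\<close>
  then show ?thesis using C weight_hit[of "fst b" "snd b"] b
    by (simp add: signed_def sg_def)
next
  case True
  then obtain m m' where "p \<le> m" "m < fst b" "h m" "fst b \<le> m'" "m' \<le> snd b" "h m'" using b(5) by (auto simp: hits_def)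
  then show ?thesis using unique_hit[of m m'] b by auto
qed

lemma homogeneous_inserted: "homogeneous_family w' lo c hi XA' XM'"
  unfolding homogeneous_family_def
proof (intro allI impI)
  fix u v assume uv: "lo \<le> u \<and> u \<le> v \<and> v \<le> hi"
  show "if u \<le> c \<and> c \<le> v then is_shifted M (block_entry w' XM' (u, v)) else is_shifted A (block_entry w' XA' (u, v))"
  proof (cases "hits h (u, v)")
    case False
    then show ?thesis using homogeneous uv
      unfolding homogeneous_family_def by (auto simp: block_entry_nohit)
  next
    case hit: True
    show ?thesis
    proof (cases "u = v")
      case True
      then have h: "h u" using hit by (simp add: hits_def)
      then have "weight w' u (Suc v) = w u - 1" using True by (simp add: weight_def lowered_def)
      then show ?thesis using yA[of u] yM uv h hit True
        by (auto simp: is_shifted_def block_entry_def inserted_def)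
    next
      case False
      then show ?thesis using hit
        by (simp add: is_shifted_def block_entry_def inserted_def zero_grade M.zero_grade)
    qed
  qed
qed

lemma homogeneous_A:
  assumes "lo \<le> u" "u \<le> v" "v \<le> hi" "\<not> (u \<le> c \<and> c \<le> v)"
  shows "is_shifted A (block_entry w XA (u, v))" "is_shifted A (block_entry w' XA' (u, v))"
    "is_shifted A (block_entry w ZA (u, v))"
proof -
  have 1: "is_shifted A (block_entry w XA (u, v))" "is_shifted A (block_entry w' XA' (u, v))"
    if "lo \<le> u" "u \<le> v" "v \<le> hi" "\<not> (u \<le> c \<and> c \<le> v)" for u v
    using homogeneous homogeneous_inserted that unfolding homogeneous_family_def by metis+
  show "is_shifted A (block_entry w XA (u, v))" "is_shifted A (block_entry w' XA' (u, v))"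
    using 1 assms by blast+
  show "is_shifted A (block_entry w ZA (u, v))"
  proof (cases "hits h (u, v)")
    case False
    then show ?thesis by (simp add: is_shifted_def block_entry_def correction_A_def zero_grade)
  next
    case True
    have "is_shifted A (curvature_A mu w' XA' (u, v))"
      by (rule is_shifted_curvature_A) (use assms 1 in auto)
    then show ?thesis using True weight_hit[OF assms(1-3) True]
      by (auto simp: is_shifted_def block_entry_def correction_A_def curvature_A_def intro: sg_grade)
  qed
qed

lemma homogeneous_M:
  assumes "lo \<le> u" "u \<le> c" "c \<le> v" "v \<le> hi"
  shows "is_shifted M (block_entry w XM (u, v))" "is_shifted M (block_entry w ZM (u, v))"
proof -
  show "is_shifted M (block_entry w XM (u, v))"
    using homogeneous assms unfolding homogeneous_family_def by auto
  show "is_shifted M (block_entry w ZM (u, v))"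
  proof (cases "hits h (u, v)")
    case False
    then show ?thesis by (simp add: is_shifted_def block_entry_def correction_M_def M.zero_grade)
  next
    case True
    have "is_shifted M (curvature_M beta w' c XA' XM' (u, v))"
      by (rule is_shifted_curvature_M[OF homogeneous_inserted]) (use assms in auto)
    then show ?thesis using True weight_hit[of u v] assms
      by (auto simp: is_shifted_def block_entry_def correction_M_def curvature_M_def intro: M.sg_grade)
  qed
qed

end

lemma sum_curvature_M:
  "snd (curvature_M beta w c XA XM (p, q)) = (\<Sum>(bs, b, bs')\<in>cuts_at c p q.
     snd (bi_shift 1 beta (map (block_entry w XA) bs) (block_entry w XM b) (map (block_entry w XA) bs')))"
  by (simp add: curvature_M_def)

context entry_change
begin

abbreviation "slotA p \<equiv> \<lambda>b. signed (weight w' p (fst b)) (curvature_A mu w' XA' b)"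
abbreviation "slotM p \<equiv> \<lambda>b. signed (weight w' p (fst b)) (curvature_M beta w' c XA' XM' b)"

text \<open>Describes what a block contributes to the Bianchi identity of the inserted family.
  Without a hit its curvature is that of the flat family, hence zero; with a hit it is the
  correction, up to the sign common to all cuts from \<open>p\<close>.\<close>

lemma slotA:
  assumes "lo \<le> p" "p \<le> fst b" "fst b \<le> snd b" "snd b \<le> hi" "\<not> (fst b \<le> c \<and> c \<le> snd b)"
  shows "\<not> hits h b \<Longrightarrow> snd (block_entry w ZA b) = 0 \<and> snd (slotA p b) = 0"
    "hits h b \<Longrightarrow> slotA p b = signed (s p) (block_entry w ZA b)"
proof -
  obtain u v where b: "b = (u, v)" by (cases b)
  show "snd (block_entry w ZA b) = 0 \<and> snd (slotA p b) = 0" if "\<not> hits h b"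
    using that assms flat_A[of u v] by (simp add: b block_entry_def correction_A_def signed_def curvature_A_nohit)
  show "slotA p b = signed (s p) (block_entry w ZA b)" if "hits h b"
    using curvature_inserted[OF assms(1-4) that, of "curvature_A mu w' XA' b"] that
    by (simp add: b block_entry_def correction_A_def curvature_A_def)
qed

lemma slotM:
  assumes "lo \<le> p" "p \<le> fst b" "fst b \<le> c" "c \<le> snd b" "snd b \<le> hi"
  shows "\<not> hits h b \<Longrightarrow> snd (block_entry w ZM b) = 0 \<and> snd (slotM p b) = 0"
    "hits h b \<Longrightarrow> slotM p b = signed (s p) (block_entry w ZM b)"
proof -
  obtain u v where b: "b = (u, v)" by (cases b)
  show "snd (block_entry w ZM b) = 0 \<and> snd (slotM p b) = 0" if "\<not> hits h b"
    using that assms flat_M[of u v] by (simp add: b block_entry_def correction_M_def signed_def curvature_M_nohit)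
  show "slotM p b = signed (s p) (block_entry w ZM b)" if "hits h b"
    using curvature_inserted[OF assms(1,2) _ assms(5) that, of "curvature_M beta w' c XA' XM' b"] that assms(3,4)
    by (simp add: b block_entry_def correction_M_def curvature_M_def)
qed

lemma block_entry_hit_elsewhere:
  assumes "chain p bs q" "lo \<le> p" "q \<le> Suc hi" "x \<in> set bs" "y \<in> set bs" "hits h x" "y \<noteq> x"
  shows "block_entry w' (inserted h z X) y = block_entry w X y"
  using hits_unique_block[OF assms(1-5,6)] assms(7) block_entry_nohit by blast

text \<open>At most one block of a cut is corrected, so the curvature changes by a linear term only;
  up to \<open>sg (s p)\<close> this term is the Bianchi sum of the inserted family.\<close>

lemma corrected_flat_A:
  assumes "lo \<le> p" "p \<le> q" "q \<le> hi" "\<not> (p \<le> c \<and> c \<le> q)"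
  shows "snd (curvature_A mu w (\<lambda>u v. XA u v + ZA u v) (p, q)) = 0"
proof -
  let ?G = "\<lambda>xs. snd (alg_shift mu xs)"
  let ?e = "block_entry w XA" and ?z = "block_entry w ZA"
  have block: "lo \<le> p \<and> p \<le> fst b \<and> fst b \<le> snd b \<and> snd b \<le> hi \<and> \<not> (fst b \<le> c \<and> c \<le> snd b)"
    if "chain p bs (Suc q)" "b \<in> set bs" for bs b
    using chain_mem[OF that] assms by auto
  have hi: "Suc q \<le> Suc hi" using assms by simp
  have "snd (curvature_A mu w (\<lambda>u v. XA u v + ZA u v) (p, q)) =
    (\<Sum>bs | chain p bs (Suc q). ?G (map ?e bs) + variation ?G ?e ?z bs)"
    unfolding curvature_A_def fst_conv snd_conv
  proof (intro sum.cong refl)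
    fix bs assume "bs \<in> {bs. chain p bs (Suc q)}"
    then have bs: "chain p bs (Suc q)" by simp
    show "?G (map (block_entry w (\<lambda>u v. XA u v + ZA u v)) bs) = ?G (map ?e bs) + variation ?G ?e ?z bs"
    \<comment> \<open>The choice picks the block that contains the position. If there is none, its
      value is arbitrary and no block changes.\<close>
    proof (rule variation_single[OF slot_additive_mu, where ?b0.0 = "SOME b. b \<in> set bs \<and> hits h b"])
      fix b assume b: "b \<in> set bs" "b \<noteq> (SOME b. b \<in> set bs \<and> hits h b)"
      have "\<not> hits h b"
      proof
        assume hb: "hits h b"
        then have "(SOME b. b \<in> set bs \<and> hits h b) \<in> set bs \<and> hits h (SOME b. b \<in> set bs \<and> hits h b)"
          using b(1) someI[where P = "\<lambda>b. b \<in> set bs \<and> hits h b"] by blast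
        then show False using hits_unique_block[OF bs assms(1) hi _ b(1)] hb b(2) by blast
      qed
      then show "snd (?z b) = 0" by (simp add: block_entry_def correction_A_def)
    next
      show "distinct bs" using chain_distinct[OF bs] .
    qed (simp_all add: block_entry_add, simp add: block_entry_def)
  qed
  also have "\<dots> = snd (curvature_A mu w XA (p, q)) + (\<Sum>bs | chain p bs (Suc q). variation ?G ?e ?z bs)"
    by (simp add: curvature_A_def sum.distrib)
  also have "(\<Sum>bs | chain p bs (Suc q). variation ?G ?e ?z bs) = 0"
  proof -
    have eq: "variation ?G (block_entry w' XA') (slotA p) bs = sg (s p) (variation ?G ?e ?z bs)"
      if bs: "chain p bs (Suc q)" for bs
      by (rule variation_rescale[OF slot_additive_mu slot_additive_mu, where H = "hits h"])
        (use block[OF bs] slotA[of p] block_entry_hit_elsewhere[OF bs assms(1) hi] chain_distinct[OF bs] in blast)+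
    have "(\<Sum>bs | chain p bs (Suc q). variation ?G (block_entry w' XA') (slotA p) bs) = 0"
      by (rule bianchi_A) (use homogeneous_A assms in auto)
    then have "sg (s p) (\<Sum>bs | chain p bs (Suc q). variation ?G ?e ?z bs) = 0"
      unfolding sg_sum using eq by simp
    then show ?thesis by (simp only: sg_eq_0_iff)
  qed
  finally show ?thesis using flat_A[of p q] assms by simp
qed

text \<open>Stated for an arbitrary \<open>G\<close> since it is needed twice: with
  \<open>beta\<close> for the flatness of the corrected family, and with \<open>I\<close> for the
  change of the inner product.\<close>

lemma corrected_cut:
  assumes cut: "(bs, b, bs') \<in> cuts_at c p q" and "lo \<le> p" "p \<le> Suc q" "q \<le> hi" and G: "bi_additive G"
  shows "G (map (block_entry w (\<lambda>u v. XA u v + ZA u v)) bs) (block_entry w (\<lambda>u v. XM u v + ZM u v) b)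
      (map (block_entry w (\<lambda>u v. XA u v + ZA u v)) bs') =
    G (map (block_entry w XA) bs) (block_entry w XM b) (map (block_entry w XA) bs')
    + bi_variation G (block_entry w XA) (block_entry w XM) (block_entry w ZA) (block_entry w ZM) bs b bs'"
proof -
  note ch = cuts_at_block[OF cut assms(3)]
  let ?L = "bs @ b # bs'" and ?b0 = "SOME x. x \<in> set (bs @ b # bs') \<and> hits h x"
  have hi: "Suc q \<le> Suc hi" using assms by simp
  have no: "\<not> hits h x" if x: "x \<in> set ?L" "x \<noteq> ?b0" for x
  proof
    assume hx: "hits h x"
    then have "?b0 \<in> set ?L \<and> hits h ?b0"
      using x(1) someI[where P = "\<lambda>x. x \<in> set ?L \<and> hits h x"] by blast
    then show False using hits_unique_block[OF ch(7) assms(2) hi _ x(1)] hx x(2) by blast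
  qed
  show ?thesis
  proof (rule bi_variation_single[OF G, where ?b0.0 = ?b0])
    show "distinct ?L" using chain_distinct[OF ch(7)] .
    show "snd (block_entry w ZA x) = 0" if "x \<in> set bs \<union> set bs'" "x \<noteq> ?b0" for x
      using no[of x] that by (simp add: block_entry_def correction_A_def)
    show "snd (block_entry w ZM b) = 0" if "b \<noteq> ?b0"
      using no[of b] that by (simp add: block_entry_def correction_M_def)
  qed (simp_all add: block_entry_add, simp_all add: block_entry_def)
qed

lemma rescaled_cut:
  assumes cut: "(bs, b, bs') \<in> cuts_at c p q" and "lo \<le> p" "p \<le> Suc q" "q \<le> hi" and G: "bi_additive G"
  shows "bi_variation G (block_entry w' XA') (block_entry w' XM') (slotA p) (slotM p) bs b bs' =
    sg (s p) (bi_variation G (block_entry w XA) (block_entry w XM) (block_entry w ZA) (block_entry w ZM) bs b bs')"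
proof -
  note ch = cuts_at_block[OF cut assms(3)]
  let ?L = "bs @ b # bs'"
  have hi: "Suc q \<le> Suc hi" using assms by simp
  have b: "lo \<le> p" "p \<le> fst b" "fst b \<le> c" "c \<le> snd b" "snd b \<le> hi" using ch assms by auto
  have block: "lo \<le> p" "p \<le> fst x" "fst x \<le> snd x" "snd x \<le> hi" "\<not> (fst x \<le> c \<and> c \<le> snd x)"
    if x: "x \<in> set bs \<union> set bs'" for x
    using x chain_mem[OF ch(1), of x] chain_mem[OF ch(4), of x] b assms by auto
  have elsewhere: "block_entry w' (inserted h z X) y = block_entry w X y"
    if "x \<in> set ?L" "y \<in> set ?L" "hits h x" "y \<noteq> x" for x y z and X :: "nat \<Rightarrow> nat \<Rightarrow> 'z::zero"
    by (rule block_entry_hit_elsewhere[OF ch(7) assms(2) hi that])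
  have d: "distinct ?L" using chain_distinct[OF ch(7)] .
  show ?thesis
  proof (rule bi_variation_rescale[OF G, where H = "hits h"])
    show "distinct ?L" using d .
    show "snd (block_entry w ZA x) = 0 \<and> snd (slotA p x) = 0" if "x \<in> set bs \<union> set bs'" "\<not> hits h x" for x
      using slotA(1)[OF block[OF that(1)]] that(2) by blast
    show "slotA p x = signed (s p) (block_entry w ZA x)" if "x \<in> set bs \<union> set bs'" "hits h x" for x
      using slotA(2)[OF block[OF that(1)]] that(2) by blast
    show "snd (block_entry w ZM b) = 0 \<and> snd (slotM p b) = 0" if "\<not> hits h b" using slotM(1)[OF b that] .
    show "slotM p b = signed (s p) (block_entry w ZM b)" if "hits h b" using slotM(2)[OF b that] .
    show "block_entry w' XA' y = block_entry w XA y"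
      if "x \<in> set ?L" "y \<in> set bs \<union> set bs'" "hits h x" "y \<noteq> x" for x y
      using elsewhere[of x y] that by auto
    show "block_entry w' XM' b = block_entry w XM b" if "x \<in> set bs \<union> set bs'" "hits h x" for x
      using elsewhere[of x b] that d by auto
  qed
qed

lemma corrected_flat_M:
  assumes "lo \<le> p" "p \<le> c" "c \<le> q" "q \<le> hi"
  shows "snd (curvature_M beta w c (\<lambda>u v. XA u v + ZA u v) (\<lambda>u v. XM u v + ZM u v) (p, q)) = 0"
proof -
  let ?G = "\<lambda>xs y zs. snd (bi_shift 1 beta xs y zs)"
  let ?V = "bi_variation ?G (block_entry w XA) (block_entry w XM) (block_entry w ZA) (block_entry w ZM)"
  have pq: "p \<le> Suc q" using assms by simp
  have "snd (curvature_M beta w c (\<lambda>u v. XA u v + ZA u v) (\<lambda>u v. XM u v + ZM u v) (p, q)) =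
    (\<Sum>(bs, b, bs')\<in>cuts_at c p q. ?G (map (block_entry w XA) bs) (block_entry w XM b) (map (block_entry w XA) bs') + ?V bs b bs')"
    unfolding sum_curvature_M
    by (intro sum.cong refl) (use corrected_cut[OF _ assms(1) pq assms(4) bi_additive_beta] in auto)
  also have "\<dots> = snd (curvature_M beta w c XA XM (p, q)) + (\<Sum>(bs, b, bs')\<in>cuts_at c p q. ?V bs b bs')"
    unfolding sum_curvature_M by (simp add: split_def sum.distrib)
  also have "(\<Sum>(bs, b, bs')\<in>cuts_at c p q. ?V bs b bs') = 0"
  proof -
    have "(\<Sum>(bs, b, bs')\<in>cuts_at c p q. bi_variation ?G (block_entry w' XA') (block_entry w' XM') (slotA p) (slotM p) bs b bs') = 0"
      by (rule bianchi_M[OF homogeneous_inserted assms(1) pq assms(4)])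
    also have "(\<Sum>(bs, b, bs')\<in>cuts_at c p q. bi_variation ?G (block_entry w' XA') (block_entry w' XM') (slotA p) (slotM p) bs b bs') =
        (\<Sum>(bs, b, bs')\<in>cuts_at c p q. sg (s p) (?V bs b bs'))"
      by (intro sum.cong refl) (use rescaled_cut[OF _ assms(1) pq assms(4) bi_additive_beta] in auto)
    finally have "sg (s p) (\<Sum>(bs, b, bs')\<in>cuts_at c p q. ?V bs b bs') = 0"
      by (simp add: sg_sum split_def)
    then show ?thesis by (simp only: sg_eq_0_iff)
  qed
  finally show ?thesis using flat_M[of p q] assms by simp
qed

lemma corrected_family:
  "flat_family sA A mu sM M beta w lo c hi (\<lambda>u v. XA u v + ZA u v) (\<lambda>u v. XM u v + ZM u v)"
proof unfold_locales
  show "homogeneous_family w lo c hi (\<lambda>u v. XA u v + ZA u v) (\<lambda>u v. XM u v + ZM u v)"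
    unfolding homogeneous_family_def
    using homogeneous_A(1,3) homogeneous_M
    by (auto simp: is_shifted_def block_entry_def intro!: add_grade M.add_grade)
qed (use corrected_flat_A corrected_flat_M in auto)

end

section \<open>The morphism relation of the inner product and the cyclic Bianchi identity\<close>

lemma sum_apply: "(\<Sum>i\<in>S. f i) x = (\<Sum>i\<in>S. f i x)"
  by (induction S rule: infinite_finite_induct) auto

lemma sg_apply: "sg n f x = sg n (f x)"
  by (simp add: sg_def)

lemma (in graded_module) hcomp_homogeneous:
  assumes "x \<in> grade n"
  shows "hcomp grade i x = (if i = n then x else 0)"
proof -
  let ?c = "\<lambda>i. if i = n then x else 0"
  let ?P = "\<lambda>c. (\<forall>n. c n \<in> grade n) \<and> finite {n. c n \<noteq> 0} \<and> x = (\<Sum>n | c n \<noteq> 0. c n)"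
  have "{m. ?c m \<noteq> 0} = (if x = 0 then {} else {n})" by auto
  then have "?P ?c" using assms zero_grade by auto
  then have "(THE c. ?P c) = ?c" using grade_direct_sum by (intro the1_equality) auto
  then show ?thesis by (simp add: hcomp_def)
qed

text \<open>When the block \<open>x'\<^bsub>q+1,p-1\<^esub>\<close> that wraps around is cut further, its core is \<open>x'\<^bsub>q0+1,p0-1\<^esub>\<close> and the
  rest consists of cuts of \<open>[p0, p)\<close> and of \<open>(q, q0]\<close>.\<close>

definition left_tails :: "nat \<Rightarrow> (nat \<times> (nat \<times> nat) list) set" where
  "left_tails p = {(p0, ds). 1 \<le> p0 \<and> chain p0 ds p}"

definition right_tails :: "nat \<Rightarrow> nat \<Rightarrow> (nat \<times> (nat \<times> nat) list) set" where
  "right_tails n q = {(q0, ds). q0 < n \<and> chain (Suc q) ds (Suc q0)}"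

lemma finite_left_tails [simp]: "finite (left_tails p)"
proof (rule finite_subset)
  show "left_tails p \<subseteq> (SIGMA p0:{..p}. {ds. chain p0 ds p})"
    by (auto simp: left_tails_def dest: chain_le)
qed simp

lemma finite_right_tails [simp]: "finite (right_tails n q)"
proof (rule finite_subset)
  show "right_tails n q \<subseteq> (SIGMA q0:{..n}. {ds. chain (Suc q) ds (Suc q0)})"
    by (auto simp: right_tails_def)
qed simp

text \<open>The structure map of the dual module takes the outermost blocks of a cut on both sides.
  Stripping them off leaves a cut of a smaller interval, and the stripped parts are its tails; on
  the right, \<open>p0\<close> and \<open>q0\<close> are the former ends.\<close>

lemma sum_cyclic_cuts:
  fixes F :: "nat \<Rightarrow> nat \<Rightarrow> (nat \<times> nat) list \<Rightarrow> (nat \<times> nat) list \<Rightarrow> nat \<times> nat \<Rightarrow> (nat \<times> nat) list \<Rightarrow> (nat \<times> nat) list \<Rightarrow> 'g::comm_monoid_add"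
  shows "(\<Sum>p=1..c. \<Sum>q\<in>{c..<n}. \<Sum>(bs, b, bs')\<in>cuts_at c p q. \<Sum>i\<le>length bs. \<Sum>l\<le>length bs'.
            F p q (take i bs) (drop i bs) b (take l bs') (drop l bs')) =
         (\<Sum>p=1..c. \<Sum>q\<in>{c..<n}. \<Sum>(cs, b, cs')\<in>cuts_at c p q.
            \<Sum>(p0, ds)\<in>left_tails p. \<Sum>(q0, ds')\<in>right_tails n q. F p0 q0 ds cs b cs' ds')"
proof -
  let ?S = "SIGMA p:{1..c}. SIGMA q:{c..<n}. SIGMA t:cuts_at c p q. SIGMA i:{..length (fst t)}. {..length (snd (snd t))}"
  let ?T = "SIGMA p:{1..c}. SIGMA q:{c..<n}. SIGMA t:cuts_at c p q. left_tails p \<times> right_tails n q"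
  have pq: "p \<le> Suc q" if "p \<le> c" "c \<le> q" for p q using that by simp
  have "(\<Sum>p=1..c. \<Sum>q\<in>{c..<n}. \<Sum>(bs, b, bs')\<in>cuts_at c p q. \<Sum>i\<le>length bs. \<Sum>l\<le>length bs'.
            F p q (take i bs) (drop i bs) b (take l bs') (drop l bs')) =
        (\<Sum>(p, q, (bs, b, bs'), i, l)\<in>?S. F p q (take i bs) (drop i bs) b (take l bs') (drop l bs'))"
    by (simp add: sum.Sigma split_def finite_cuts_at)
  also have "\<dots> = (\<Sum>(p, q, (cs, b, cs'), (p0, ds), (q0, ds'))\<in>?T. F p0 q0 ds cs b cs' ds')"
  proof (rule sum.reindex_bij_witness[where
          j = "\<lambda>(p, q, (bs, b, bs'), i, l). (fst (hd (drop i bs @ [b])), snd (last (b # take l bs')),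
                  (drop i bs, b, take l bs'), (p, take i bs), (q, drop l bs'))" and
          i = "\<lambda>(p, q, (cs, b, cs'), (p0, ds), (q0, ds')). (p0, q0, (ds @ cs, b, cs' @ ds'), length ds, length cs')"], goal_cases)
    case (1 t)
    then show ?case by auto
  next
    case (2 t)
    obtain p q bs b bs' i l where t: "t = (p, q, (bs, b, bs'), i, l)" by (metis prod.collapse)
    then have pq: "1 \<le> p" "p \<le> c" "c \<le> q" "q < n" "(bs, b, bs') \<in> cuts_at c p q" using 2 by auto
    then have "p \<le> Suc q" by simp
    note b = cuts_at_block[OF pq(5) this]
    have "chain p (take i bs @ drop i bs) (fst b)" "chain (Suc (snd b)) (take l bs' @ drop l bs') (Suc q)"
      using b by auto
    then obtain u v where uv: "chain p (take i bs) u" "chain u (drop i bs) (fst b)"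
      "chain (Suc (snd b)) (take l bs') v" "chain v (drop l bs') (Suc q)"
      unfolding chain_append by blast
    then obtain v' where v': "v = Suc v'" using chain_le by (metis Suc_le_D)
    have le: "p \<le> u" "u \<le> fst b" "snd b \<le> v'" "v' \<le> q" using uv[THEN chain_le] v' by auto
    then have uv': "u \<le> Suc v'" using b by simp
    have "(drop i bs, b, take l bs') \<in> cuts_at c u v'"
      using uv b unfolding cuts_at_chain[OF uv'] v' by simp
    then show ?case using uv le b pq chain_hd[OF uv(2)] chain_last[OF uv(3)[unfolded v']] unfolding t
      by (simp add: left_tails_def right_tails_def v' del: last.simps)
  next
    case (3 t)
    obtain p q cs b cs' p0 ds q0 ds' where t: "t = (p, q, (cs, b, cs'), (p0, ds), (q0, ds'))" by (metis prod.collapse)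
    then have "(cs, b, cs') \<in> cuts_at c p q" "p \<le> Suc q" using 3 by auto
    from cuts_at_block[OF this] show ?case using chain_hd chain_last by (simp add: t del: last.simps)
  next
    case (4 t)
    obtain p q cs b cs' p0 ds q0 ds' where t: "t = (p, q, (cs, b, cs'), (p0, ds), (q0, ds'))" by (metis prod.collapse)
    then have pq: "p \<le> c" "c \<le> q" "(cs, b, cs') \<in> cuts_at c p q" "1 \<le> p0" "q0 < n" "chain p0 ds p" "chain (Suc q) ds' (Suc q0)"
      using 4 by (auto simp: left_tails_def right_tails_def)
    then have le: "p \<le> Suc q" "p0 \<le> p" "q \<le> q0" using chain_le by fastforce+
    have "p0 \<le> Suc q0" using le pq by simp
    note c = cuts_at_chain[OF this] and b = cuts_at_block[OF pq(3) le(1)]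
    have "(ds @ cs, b, cs' @ ds') \<in> cuts_at c p0 q0"
      using b pq unfolding c by (auto simp: chain_append)
    then show ?case using le pq by (simp add: t)
  next
    case (5 t)
    then show ?case by auto
  qed
  also have "\<dots> = (\<Sum>p=1..c. \<Sum>q\<in>{c..<n}. \<Sum>(cs, b, cs')\<in>cuts_at c p q.
            \<Sum>(p0, ds)\<in>left_tails p. \<Sum>(q0, ds')\<in>right_tails n q. F p0 q0 ds cs b cs' ds')"
    by (simp add: sum.Sigma split_def finite_cuts_at)
  finally show ?thesis .
qed

abbreviation "shift_blocks n \<equiv> map (\<lambda>(u, v). (u + n, v + n :: nat))"

text \<open>Around the module position \<open>n\<close>, a cut of the wrapped interval consists of a
  right tail, a core block and a left tail moved up by \<open>n\<close>, since the positions above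
  \<open>n\<close> stand for the first indices of the cyclic word.\<close>

lemma sum_wrapped_cuts:
  fixes g :: "(nat \<times> nat) list \<Rightarrow> nat \<times> nat \<Rightarrow> (nat \<times> nat) list \<Rightarrow> 'g::comm_monoid_add"
  assumes "1 \<le> p" "q < n"
  shows "(\<Sum>(ds', b, ds)\<in>cuts_at n (q + 1) (n + p - 1). g ds' b ds) =
    (\<Sum>(p0, ds)\<in>left_tails p. \<Sum>(q0, ds')\<in>right_tails n q. g ds' (q0 + 1, n + p0 - 1) (shift_blocks n ds))"
proof -
  let ?f = "\<lambda>((p0, ds), (q0, ds')). (ds', (q0 + 1, n + p0 - 1), shift_blocks n ds)"
  have le: "q + 1 \<le> Suc (n + p - 1)" using assms by simp
  have inj: "inj_on ?f (left_tails p \<times> right_tails n q)"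
    using inj_shift_map[of n] by (auto simp: inj_on_def left_tails_def dest: injD)
  have img: "cuts_at n (q + 1) (n + p - 1) = ?f ` (left_tails p \<times> right_tails n q)"
  proof (intro subset_antisym subsetI)
    fix t assume t: "t \<in> cuts_at n (q + 1) (n + p - 1)"
    obtain ds' u v ds1 where t': "t = (ds', (u, v), ds1)" by (metis prod.collapse)
    have b: "chain (q + 1) ds' u" "u \<le> n" "n \<le> v" "chain (Suc v) ds1 (n + p)"
      using cuts_at_block[OF t[unfolded t'] le] assms by auto
    have "q + 1 \<le> u" using chain_le[OF b(1)] .
    have "ds1 \<in> {bs. chain (Suc (v - n) + n) bs (p + n)}" using b(3,4) by (simp add: add.commute[of n p])
    then obtain ds where ds: "ds1 = shift_blocks n ds" "chain (Suc (v - n)) ds p"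
      unfolding chain_shift_image by auto
    \<comment> \<open>The core block \<open>(u, v)\<close> determines \<open>q0 = u - 1\<close> and
      \<open>p0 = v - n + 1\<close>; neither subtraction truncates, as \<open>q < u\<close> and
      \<open>n \<le> v\<close>.\<close>
    have "t = ?f ((Suc (v - n), ds), (u - 1, ds'))"
      using b \<open>q + 1 \<le> u\<close> by (simp add: t' ds)
    moreover have "((Suc (v - n), ds), (u - 1, ds')) \<in> left_tails p \<times> right_tails n q"
      using ds b \<open>q + 1 \<le> u\<close> by (simp add: left_tails_def right_tails_def)
    ultimately show "t \<in> ?f ` (left_tails p \<times> right_tails n q)" by (rule image_eqI)
  next
    fix t assume "t \<in> ?f ` (left_tails p \<times> right_tails n q)"
    then obtain p0 ds q0 ds' where t: "t = (ds', (q0 + 1, n + p0 - 1), shift_blocks n ds)"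
      and ch: "1 \<le> p0" "chain p0 ds p" "q0 < n" "chain (Suc q) ds' (Suc q0)"
      by (auto simp: left_tails_def right_tails_def)
    then have "chain (Suc (n + p0 - 1)) (shift_blocks n ds) (Suc (n + p - 1))"
      using chain_shift[of p0 n ds p] assms by (simp add: add.commute)
    then show "t \<in> cuts_at n (q + 1) (n + p - 1)"
      unfolding cuts_at_chain[OF le] t using ch by simp
  qed
  show ?thesis
    unfolding img sum.reindex[OF inj] by (simp add: sum.cartesian_product split_def)
qed

context ainf_inner_product
begin

abbreviation "IP xs y zs \<equiv> snd (bi_shift D I xs y zs)"

lemma I_multilinear: "bi_multilinear sA sM dual_scale I"
  and I_degree: "bi_degree A M (dual_grade sM M) D I"
  and I_delta: "\<forall>x\<in>set xs. is_shifted A x \<Longrightarrow> is_shifted M y \<Longrightarrow> \<forall>z\<in>set zs. is_shifted A z \<Longrightarrow>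
        delta mu beta (dual_shifted M beta) D I xs y zs = 0"
  using I_morphism unfolding ainf_module_morphism_def by blast+

lemma bi_additive_IP: "bi_additive (\<lambda>xs y zs. IP xs y zs mt)"
  using bi_additive_bi_shift[OF I_multilinear, of D]
  by (auto simp: bi_additive_def slot_additive_def additive_def)

text \<open>Linearity in the last argument is not part of \<open>bi_multilinear\<close>, which
  concerns the other arguments. It comes from the degree condition, because the elements of
  \<open>dual_grade\<close> are linear; hence the homogeneity hypotheses.\<close>

lemma additive_IP:
  assumes "\<forall>x\<in>set xs. is_shifted A x" "is_shifted M y" "\<forall>z\<in>set zs. is_shifted A z"
  shows "additive (IP xs y zs)"
proof -
  have "module_hom sM (*) (I (map snd xs) (snd y) (map snd zs))"
    using is_shifted_bi_shift[OF I_degree assms] by (simp add: dual_grade_def)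
  then have "additive (I (map snd xs) (snd y) (map snd zs))" by (rule module_hom_additive)
  from additive_sg_comp[OF this] show ?thesis
    by (simp add: bi_shift_def additive_def sg_apply)
qed

text \<open>On a homogeneous element the sum over components has a single term. For
  \<open>mt = 0\<close> it has none, and the right-hand side vanishes by additivity.\<close>

lemma dual_shifted_apply:
  assumes "is_shifted M (j, mt)" "additive (snd f)"
  shows "snd (dual_shifted M beta xs f zs) mt =
    - sg (sdeg xs * (fst f + sdeg zs + j) + fst f) (snd f (snd (bi_shift 1 beta zs (j, mt) xs)))"
proof -
  have mt: "hcomp M (i + 1) mt = (if i = j then mt else 0)" for i
    using M.hcomp_homogeneous[of mt "j + 1" "i + 1"] assms(1) by (simp add: is_shifted_def)
  show ?thesis
  proof (cases "mt = 0")
    case True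
    have "snd (bi_shift 1 beta zs (j, 0) xs) = 0"
      using additive.zero[OF bi_additiveD(2)[OF bi_additive_beta]] .
    moreover have "{i. hcomp M (i + 1) mt \<noteq> 0} = {}" unfolding mt using True by simp
    ultimately show ?thesis using True additive.zero[OF assms(2)] by (simp add: dual_shifted_def)
  next
    case False
    then have "{i. hcomp M (i + 1) mt \<noteq> 0} = {j}" by (auto simp: mt)
    then show ?thesis by (simp add: dual_shifted_def mt)
  qed
qed

text \<open>Evaluating \<open>delta = 0\<close> at \<open>mt\<close> turns the dual structure map
  into \<open>beta\<close> applied to \<open>mt\<close> with the outer arguments around it in
  rotated order. This is the source of the cyclic symmetry.\<close>

lemma IP_relation:
  assumes xs: "\<forall>x\<in>set xs. is_shifted A x" and y: "is_shifted M y" and zs: "\<forall>z\<in>set zs. is_shifted A z"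
    and mt: "is_shifted M (j, mt)"
  shows "inner_sum_of mu beta (\<lambda>xs y zs. IP xs y zs mt) xs y zs +
    (\<Sum>i\<le>length xs. \<Sum>l\<le>length zs.
       sg (sdeg (take i xs) * (sdeg (drop i xs) + fst y + sdeg (take l zs) + sdeg (drop l zs) + j)
            + (sdeg (drop i xs) + fst y + sdeg (take l zs)))
         (IP (drop i xs) y (take l zs) (snd (bi_shift 1 beta (drop l zs) (j, mt) (take i xs))))) = 0"
proof -
  let ?B = "\<lambda>i l. IP (drop i xs) y (take l zs) (snd (bi_shift 1 beta (drop l zs) (j, mt) (take i xs)))"
  let ?E = "\<lambda>i l. sdeg (take i xs) * (sdeg (drop i xs) + fst y + sdeg (take l zs) + sdeg (drop l zs) + j)
            + (sdeg (drop i xs) + fst y + sdeg (take l zs))"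
  have "inner_sum mu beta D I xs y zs mt = inner_sum_of mu beta (\<lambda>xs y zs. IP xs y zs mt) xs y zs"
    by (simp add: inner_sum_eq inner_sum_of_def sum_apply sg_apply)
  moreover have "- sg D (sg (D * sdeg (take i xs))
      (snd (dual_shifted M beta (take i xs) (bi_shift D I (drop i xs) y (take l zs)) (drop l zs)) mt))
    = sg (?E i l) (?B i l)" for i l
  proof -
    have "additive (IP (drop i xs) y (take l zs))"
      by (rule additive_IP) (use xs y zs in \<open>auto dest: in_set_takeD in_set_dropD\<close>)
    note dual = dual_shifted_apply[OF mt, of "bi_shift D I (drop i xs) y (take l zs)" "take i xs" "drop l zs", OF this]
    let ?a = "sdeg (take i xs)" and ?m = "sdeg (drop i xs) + fst y + sdeg (take l zs)"
    \<comment> \<open>Each of \<open>D\<close> and \<open>D * ?a\<close> occurs twice, once from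
      \<open>delta\<close> and once from the dual structure map, so the degree of \<open>I\<close>
      drops out. The minus signs of \<open>delta\<close> and of the dual module cancel as
      well.\<close>
    have "D + D * ?a + (?a * (D + ?m + sdeg (drop l zs) + j) + (D + ?m)) - ?E i l = 2 * (D + D * ?a)"
      by (simp add: algebra_simps)
    then have "sg (D + D * ?a + (?a * (D + ?m + sdeg (drop l zs) + j) + (D + ?m))) (?B i l) = sg (?E i l) (?B i l)"
      by (intro sg_parity) simp
    moreover have "fst (bi_shift D I (drop i xs) y (take l zs)) = D + ?m" by (simp add: bi_shift_def)
    moreover have "sg n (- x) = - sg n x" for n and x :: 'r by (simp add: sg_def)
    ultimately show ?thesis unfolding dual by (simp only: sg_add_exp minus_minus)
  qed
  then have "- (sg D (\<Sum>i\<le>length xs. \<Sum>l\<le>length zs. sg (D * sdeg (take i xs))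
      (snd (dual_shifted M beta (take i xs) (bi_shift D I (drop i xs) y (take l zs)) (drop l zs)) mt)))
    = (\<Sum>i\<le>length xs. \<Sum>l\<le>length zs. sg (?E i l) (?B i l))"
    by (simp add: sg_sum sum_negf[symmetric])
  moreover have "inner_sum mu beta D I xs y zs mt + - (sg D (\<Sum>i\<le>length xs. \<Sum>l\<le>length zs. sg (D * sdeg (take i xs))
      (snd (dual_shifted M beta (take i xs) (bi_shift D I (drop i xs) y (take l zs)) (drop l zs)) mt))) = 0"
    using fun_cong[OF I_delta[OF xs y zs], of mt] by (simp add: delta_def sg_apply sum_apply)
  ultimately show ?thesis by simp
qed

end

lemma weight_shift: "(\<And>m. a \<le> m \<Longrightarrow> m < b \<Longrightarrow> w (n + m) = w m) \<Longrightarrow> weight w (n + a) (n + b) = weight w a b"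
  unfolding weight_def
  using sum.shift_bounds_nat_ivl[of w a n b] by (simp add: add.commute)

text \<open>The compatibility of the two families of a cyclic system on their shared algebra
  entries, together with the periodicity of the degrees that makes the shared entries carry equal
  labels.\<close>

definition glued :: "nat \<Rightarrow> nat \<Rightarrow> (nat \<Rightarrow> int) \<Rightarrow> (nat \<Rightarrow> nat \<Rightarrow> 'a) \<Rightarrow> (nat \<Rightarrow> nat \<Rightarrow> 'a) \<Rightarrow> bool" where
  "glued k n w X X' \<longleftrightarrow> k + 1 < n \<and> (\<forall>m. 1 \<le> m \<and> m \<le> k \<longrightarrow> w (n + m) = w m) \<and>
     (\<forall>i j. 1 \<le> i \<and> i \<le> j \<and> j \<le> k \<longrightarrow> X i j = X' (n + i) (n + j)) \<and>
     (\<forall>i j. k + 2 \<le> i \<and> i \<le> j \<and> j < n \<longrightarrow> X i j = X' i j)"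

lemma glued_tails:
  assumes "glued k n w X X'"
  shows "1 \<le> p0 \<Longrightarrow> p \<le> k + 1 \<Longrightarrow> chain p0 ds p \<Longrightarrow>
      map (block_entry w X') (shift_blocks n ds) = map (block_entry w X) ds"
    "k + 1 \<le> q \<Longrightarrow> q0 < n \<Longrightarrow> chain (Suc q) ds' (Suc q0) \<Longrightarrow>
      map (block_entry w X') ds' = map (block_entry w X) ds'"
proof -
  assume a: "1 \<le> p0" "p \<le> k + 1" "chain p0 ds p"
  have "block_entry w X' (u + n, v + n) = block_entry w X (u, v)" if uv: "(u, v) \<in> set ds" for u v
  proof -
    have b: "1 \<le> u" "u \<le> v" "v \<le> k" using chain_mem[OF a(3) uv] a by auto
    then have "weight w (n + u) (n + Suc v) = weight w u (Suc v)"
      using assms by (intro weight_shift) (auto simp: glued_def)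
    then show ?thesis using assms b by (simp add: block_entry_def glued_def add.commute[of _ n])
  qed
  then show "map (block_entry w X') (shift_blocks n ds) = map (block_entry w X) ds"
    by auto
next
  assume a: "k + 1 \<le> q" "q0 < n" "chain (Suc q) ds' (Suc q0)"
  have "block_entry w X' b = block_entry w X b" if "b \<in> set ds'" for b
    using chain_mem[OF a(3) that] a assms by (auto simp: block_entry_def glued_def)
  then show "map (block_entry w X') ds' = map (block_entry w X) ds'" by simp
qed

text \<open>The Koszul exponent of the staircase inner product, for arbitrary degrees so that its
  values before and after lowering can be compared.\<close>

definition rotation_sign :: "(nat \<Rightarrow> int) \<Rightarrow> nat \<Rightarrow> nat \<Rightarrow> int" where
  "rotation_sign w n p = weight w 1 p * weight w p (n + 1)"

context ainf_inner_product
begin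

text \<open>Sum of \<open>IP_relation\<close> over all cyclic cuts with their rotation signs. The
  terms from the dual module regroup into the curvature of the wrapped block; the extra exponent
  \<open>weight w p (q + 1)\<close> is the cost of moving this operator past the other arguments of
  \<open>I\<close>.\<close>

lemma bianchi_I:
  assumes hom: "homogeneous_family w 1 (k + 1) (n - 1) XA XM"
    and hom': "homogeneous_family w (k + 2) n (n + k) XA' XM'"
    and glue: "glued k n w XA XA'"
  shows "(\<Sum>p=1..k+1. \<Sum>q\<in>{k+1..<n}. \<Sum>(bs, b, bs')\<in>cuts_at (k + 1) p q.
      sg (rotation_sign w n p) (bi_variation (\<lambda>xs y zs. IP xs y zs (XM' (q + 1) (n + p - 1)))
         (block_entry w XA) (block_entry w XM)
         (\<lambda>b. signed (weight w p (fst b)) (curvature_A mu w XA b))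
         (\<lambda>b. signed (weight w p (fst b)) (curvature_M beta w (k + 1) XA XM b)) bs b bs') +
      sg (rotation_sign w n p + weight w p (q + 1))
        (IP (map (block_entry w XA) bs) (block_entry w XM b) (map (block_entry w XA) bs')
          (snd (curvature_M beta w n XA' XM' (q + 1, n + p - 1))))) = 0"
proof -
  let ?e = "block_entry w XA" and ?m = "block_entry w XM" and ?m' = "block_entry w XM'"
  let ?E = "rotation_sign w n"
  define V where "V p q = bi_variation (\<lambda>xs y zs. IP xs y zs (XM' (q + 1) (n + p - 1))) ?e ?m
         (\<lambda>b. signed (weight w p (fst b)) (curvature_A mu w XA b))
         (\<lambda>b. signed (weight w p (fst b)) (curvature_M beta w (k + 1) XA XM b))" for p q
  define F where "F p0 q0 ds cs b cs' ds' = sg (?E p0 +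
     (sdeg (map ?e ds) * (sdeg (map ?e cs) + fst (?m b) + sdeg (map ?e cs') + sdeg (map ?e ds') + fst (?m' (q0 + 1, n + p0 - 1)))
       + (sdeg (map ?e cs) + fst (?m b) + sdeg (map ?e cs'))))
     (IP (map ?e cs) (?m b) (map ?e cs') (snd (bi_shift 1 beta (map ?e ds') (?m' (q0 + 1, n + p0 - 1)) (map ?e ds))))"
    for p0 q0 ds cs b cs' ds'
  have kn: "k + 1 < n" using glue by (simp add: glued_def)
  have IPadd: "additive (IP (map ?e bs) (?m b) (map ?e bs'))"
    if "p \<in> {1..k+1}" "q \<in> {k+1..<n}" "(bs, b, bs') \<in> cuts_at (k + 1) p q" for p q bs b bs'
    by (rule additive_IP; rule homogeneous_cut[OF hom that(3)]) (use that in auto)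
  \<comment> \<open>Matches a term of the dual module with one of the wrapped curvature: moving the
    left tail \<open>ds\<close> from the front to the end turns the rotation sign at
    \<open>p0\<close> into that at \<open>p\<close>.\<close>
  have outer: "F p0 q0 ds cs b cs' ds' = sg (?E p + weight w p (q + 1))
     (IP (map ?e cs) (?m b) (map ?e cs') (snd (bi_shift 1 beta (map (block_entry w XA') ds')
        (?m' (q0 + 1, n + p0 - 1)) (map (block_entry w XA') (shift_blocks n ds)))))"
    if pq: "p \<in> {1..k+1}" "q \<in> {k+1..<n}" "(cs, b, cs') \<in> cuts_at (k + 1) p q"
      and t: "(p0, ds) \<in> left_tails p" "(q0, ds') \<in> right_tails n q" for p q cs b cs' p0 ds q0 ds'
  proof -
    have t': "1 \<le> p0" "chain p0 ds p" "q0 < n" "chain (Suc q) ds' (Suc q0)"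
      using t by (auto simp: left_tails_def right_tails_def)
    have le: "p0 \<le> p" "q \<le> q0" using chain_le t' by fastforce+
    have p: "p \<le> Suc q" using pq by simp
    have "n + 1 \<le> n + p0" using t' by simp
    then have "fst (?m' (q0 + 1, n + p0 - 1)) = weight w (q0 + 1) (n + 1) + weight w (n + 1) (n + p0)"
      using t' weight_add[of "q0 + 1" "n + 1" "n + p0" w] by (simp add: block_entry_def)
    also have "weight w (n + 1) (n + p0) = weight w 1 p0"
      using le pq glue by (intro weight_shift) (auto simp: glued_def)
    finally have m': "fst (?m' (q0 + 1, n + p0 - 1)) = weight w (q0 + 1) (n + 1) + weight w 1 p0" .
    have mid: "sdeg (map ?e cs) + fst (?m b) + sdeg (map ?e cs') = weight w p (q + 1)"
      using sdeg_cut[OF pq(3) p, of w XA XM] by simp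
    have W: "weight w 1 p = weight w 1 p0 + weight w p0 p"
      "weight w p (n + 1) = weight w p (q + 1) + weight w (q + 1) (q0 + 1) + weight w (q0 + 1) (n + 1)"
      "weight w p0 (n + 1) = weight w p0 p + weight w p (n + 1)"
      using t' le pq weight_add[of 1 p0 p w] weight_add[of p "q + 1" "n + 1" w]
        weight_add[of "q + 1" "q0 + 1" "n + 1" w] weight_add[of p0 p "n + 1" w] by auto
    \<comment> \<open>Rotating \<open>[1, p0)\<close> and then \<open>ds\<close> interchanges these
      two stretches twice, compared with rotating \<open>[1, p)\<close> at once; hence the even
      difference.\<close>
    have "?E p0 + (weight w p0 p * (weight w p (q + 1) + weight w (q + 1) (q0 + 1) + (weight w (q0 + 1) (n + 1) + weight w 1 p0))
        + weight w p (q + 1)) - (?E p + weight w p (q + 1)) = 2 * (weight w 1 p0 * weight w p0 p)"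
      unfolding rotation_sign_def W by (simp add: algebra_simps)
    then have sign: "sg (?E p0 + (weight w p0 p * (weight w p (q + 1) + weight w (q + 1) (q0 + 1) + (weight w (q0 + 1) (n + 1) + weight w 1 p0))
        + weight w p (q + 1))) x = sg (?E p + weight w p (q + 1)) x" for x :: 'r
      by (intro sg_parity) simp
    have ds: "sdeg (map ?e ds) = weight w p0 p" "sdeg (map ?e ds') = weight w (q + 1) (q0 + 1)"
      using sdeg_chain[OF t'(2)] sdeg_chain[OF t'(4)] by auto
    have tails: "map (block_entry w XA') (shift_blocks n ds) = map ?e ds" "map (block_entry w XA') ds' = map ?e ds'"
      using glued_tails(1)[OF glue t'(1) _ t'(2)] glued_tails(2)[OF glue _ t'(3,4)] pq by auto
    show ?thesis
      unfolding F_def mid m' ds sign tails by (rule refl)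
  qed
  have "(\<Sum>p=1..k+1. \<Sum>q\<in>{k+1..<n}. \<Sum>(bs, b, bs')\<in>cuts_at (k + 1) p q. sg (?E p) (V p q bs b bs') +
      sg (?E p + weight w p (q + 1)) (IP (map ?e bs) (?m b) (map ?e bs')
          (snd (curvature_M beta w n XA' XM' (q + 1, n + p - 1))))) =
    (\<Sum>p=1..k+1. \<Sum>q\<in>{k+1..<n}. \<Sum>(bs, b, bs')\<in>cuts_at (k + 1) p q. sg (?E p) (V p q bs b bs')) +
    (\<Sum>p=1..k+1. \<Sum>q\<in>{k+1..<n}. \<Sum>(bs, b, bs')\<in>cuts_at (k + 1) p q.
      \<Sum>(p0, ds)\<in>left_tails p. \<Sum>(q0, ds')\<in>right_tails n q. F p0 q0 ds bs b bs' ds')"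
    (is "_ = ?V + ?C")
    unfolding sum.distrib[symmetric]
  proof (intro sum.cong refl, clarify)
    fix p q bs u v bs' assume pq: "p \<in> {1..k+1}" "q \<in> {k+1..<n}" "(bs, (u, v), bs') \<in> cuts_at (k + 1) p q"
    have p: "1 \<le> p" "q < n" using pq by auto
    note add = IPadd[OF pq]
    have "sg (?E p + weight w p (q + 1)) (IP (map ?e bs) (?m (u, v)) (map ?e bs')
          (snd (curvature_M beta w n XA' XM' (q + 1, n + p - 1)))) =
      (\<Sum>(p0, ds)\<in>left_tails p. \<Sum>(q0, ds')\<in>right_tails n q. sg (?E p + weight w p (q + 1))
        (IP (map ?e bs) (?m (u, v)) (map ?e bs') (snd (bi_shift 1 beta (map (block_entry w XA') ds')
        (?m' (q0 + 1, n + p0 - 1)) (map (block_entry w XA') (shift_blocks n ds))))))"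
      unfolding sum_curvature_M sum_wrapped_cuts[OF p]
      by (simp add: additive.sum[OF add] sg_sum split_def del: map_map)
    also have "\<dots> = (\<Sum>(p0, ds)\<in>left_tails p. \<Sum>(q0, ds')\<in>right_tails n q. F p0 q0 ds bs (u, v) bs' ds')"
      by (intro sum.cong refl, clarify, intro sum.cong refl, clarify, rule outer[OF pq, symmetric])
    finally show "sg (?E p) (V p q bs (u, v) bs') +
      sg (?E p + weight w p (q + 1)) (IP (map ?e bs) (?m (u, v)) (map ?e bs')
          (snd (curvature_M beta w n XA' XM' (q + 1, n + p - 1)))) =
      sg (?E p) (V p q bs (u, v) bs') +
      (\<Sum>(p0, ds)\<in>left_tails p. \<Sum>(q0, ds')\<in>right_tails n q. F p0 q0 ds bs (u, v) bs' ds')" by simp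
  qed
  also have "?C = (\<Sum>p=1..k+1. \<Sum>q\<in>{k+1..<n}. \<Sum>(bs, b, bs')\<in>cuts_at (k + 1) p q.
      \<Sum>i\<le>length bs. \<Sum>l\<le>length bs'. F p q (take i bs) (drop i bs) b (take l bs') (drop l bs'))"
    by (rule sum_cyclic_cuts[symmetric])
  also have "?V = (\<Sum>p=1..k+1. \<Sum>q\<in>{k+1..<n}. \<Sum>(bs, b, bs')\<in>cuts_at (k + 1) p q. sg (?E p)
      (inner_sum_of mu beta (\<lambda>xs y zs. IP xs y zs (XM' (q + 1) (n + p - 1))) (map ?e bs) (?m b) (map ?e bs')))"
  proof (rule sum.cong[OF refl], rule sum.cong[OF refl])
    fix p q assume pq: "p \<in> {1..k+1}" "q \<in> {k+1..<n}"
    then have "p \<le> Suc q" by simp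
    from sum_inner_sum_of[OF bi_additive_IP this, where w = w, of mu beta "XM' (q + 1) (n + p - 1)" XA XM "k + 1"]
    have "(\<Sum>(bs, b, bs')\<in>cuts_at (k + 1) p q. V p q bs b bs') = (\<Sum>(bs, b, bs')\<in>cuts_at (k + 1) p q.
        inner_sum_of mu beta (\<lambda>xs y zs. IP xs y zs (XM' (q + 1) (n + p - 1))) (map ?e bs) (?m b) (map ?e bs'))"
      unfolding V_def by simp
    from arg_cong[OF this, of "sg (?E p)"]
    show "(\<Sum>(bs, b, bs')\<in>cuts_at (k + 1) p q. sg (?E p) (V p q bs b bs')) = (\<Sum>(bs, b, bs')\<in>cuts_at (k + 1) p q. sg (?E p)
        (inner_sum_of mu beta (\<lambda>xs y zs. IP xs y zs (XM' (q + 1) (n + p - 1))) (map ?e bs) (?m b) (map ?e bs')))"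
      by (simp add: sg_sum split_def)
  qed
  also have "\<dots> + (\<Sum>p=1..k+1. \<Sum>q\<in>{k+1..<n}. \<Sum>(bs, b, bs')\<in>cuts_at (k + 1) p q.
      \<Sum>i\<le>length bs. \<Sum>l\<le>length bs'. F p q (take i bs) (drop i bs) b (take l bs') (drop l bs')) = 0"
    unfolding sum.distrib[symmetric]
  proof (rule sum.neutral, rule ballI, rule sum.neutral, rule ballI, rule sum.neutral, clarify)
    fix p q bs u v bs' assume pq: "p \<in> {1..k+1}" "q \<in> {k+1..<n}" "(bs, (u, v), bs') \<in> cuts_at (k + 1) p q"
    let ?b = "(u, v)"
    have "is_shifted M (?m' (q + 1, n + p - 1))"
    proof -
      have "k + 2 \<le> q + 1" "q + 1 \<le> n" "n \<le> n + p - 1" "q + 1 \<le> n + p - 1" "n + p - 1 \<le> n + k" using pq by auto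
      then show ?thesis using hom' unfolding homogeneous_family_def by metis
    qed
    moreover have m': "(fst (?m' (q + 1, n + p - 1)), XM' (q + 1) (n + p - 1)) = ?m' (q + 1, n + p - 1)"
      by (simp add: block_entry_def)
    ultimately have mt: "is_shifted M (fst (?m' (q + 1, n + p - 1)), XM' (q + 1) (n + p - 1))"
      by (simp only:)
    have "1 \<le> p" "p \<le> Suc q" "q \<le> n - 1" using pq by auto
    note cut = homogeneous_cut[OF hom pq(3) this]
    have rel: "inner_sum_of mu beta (\<lambda>xs y zs. IP xs y zs (XM' (q + 1) (n + p - 1))) (map ?e bs) (?m ?b) (map ?e bs') +
      (\<Sum>i\<le>length bs. \<Sum>l\<le>length bs'.
       sg (sdeg (map ?e (take i bs)) * (sdeg (map ?e (drop i bs)) + fst (?m ?b) + sdeg (map ?e (take l bs')) + sdeg (map ?e (drop l bs'))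
             + fst (?m' (q + 1, n + p - 1)))
            + (sdeg (map ?e (drop i bs)) + fst (?m ?b) + sdeg (map ?e (take l bs'))))
         (IP (map ?e (drop i bs)) (?m ?b) (map ?e (take l bs')) (snd (bi_shift 1 beta (map ?e (drop l bs'))
           (?m' (q + 1, n + p - 1)) (map ?e (take i bs)))))) = 0"
      using IP_relation[OF cut mt] by (simp only: take_map drop_map length_map m')
    from arg_cong[OF rel, of "sg (?E p)"]
    show "sg (?E p) (inner_sum_of mu beta (\<lambda>xs y zs. IP xs y zs (XM' (q + 1) (n + p - 1))) (map ?e bs) (?m ?b) (map ?e bs')) +
      (\<Sum>i\<le>length bs. \<Sum>l\<le>length bs'. F p q (take i bs) (drop i bs) ?b (take l bs') (drop l bs')) = 0"
      unfolding F_def sg_add_exp[of "?E p"] by (simp only: sg_plus sg_sum sg_zero)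
  qed
  finally show ?thesis unfolding V_def .
qed

end

section \<open>Invariance of the staircase inner product under a change of one entry\<close>

context ainf_inner_product
begin

text \<open>Term by term, the change equals \<open>sg (s 1)\<close> times a term of the cyclic
  Bianchi identity of the two inserted families, so the total change is zero. The single sign is due
  to \<open>s\<close> absorbing the difference between the rotation signs for the lowered and the
  original degrees.\<close>

lemma corrected_inner_product:
  assumes L: "entry_change sA A mu sM M beta w 1 (k + 1) (n - 1) XA XM h s yA yM"
    and R: "entry_change sA A mu sM M beta w (k + 2) n (n + k) YA YM h s yA yM"
    and glue: "glued k n w XA YA"
    and i: "1 \<le> i" "i \<le> n"
    and h: "\<And>m. 1 \<le> m \<Longrightarrow> m \<le> n + k \<Longrightarrow> h m \<longleftrightarrow> m = i \<or> m = n + i"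
    and s: "\<And>u. u \<le> n + i \<Longrightarrow> s u = weight w u (if u \<le> i then i else n + i)"
  defines "XA1 \<equiv> \<lambda>u v. XA u v + correction_A mu w h s yA XA u v"
    and "XM1 \<equiv> \<lambda>u v. XM u v + correction_M beta w h s (k + 1) yA yM XA XM u v"
    and "YM1 \<equiv> \<lambda>u v. YM u v + correction_M beta w h s n yA yM YA YM u v"
  shows "(\<Sum>p=1..k+1. \<Sum>q\<in>{k+1..<n}. \<Sum>(bs, b, bs')\<in>cuts_at (k + 1) p q. sg (rotation_sign w n p)
      (IP (map (block_entry w XA1) bs) (block_entry w XM1 b) (map (block_entry w XA1) bs') (YM1 (q + 1) (n + p - 1)))) =
    (\<Sum>p=1..k+1. \<Sum>q\<in>{k+1..<n}. \<Sum>(bs, b, bs')\<in>cuts_at (k + 1) p q. sg (rotation_sign w n p)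
      (IP (map (block_entry w XA) bs) (block_entry w XM b) (map (block_entry w XA) bs') (YM (q + 1) (n + p - 1))))"
proof -
  interpret L: entry_change sA A mu sM M beta w 1 "k + 1" "n - 1" XA XM h s yA yM by (rule L)
  interpret R: entry_change sA A mu sM M beta w "k + 2" n "n + k" YA YM h s yA yM by (rule R)
  let ?w = "lowered w h"
  let ?e = "block_entry w XA" and ?m = "block_entry w XM"
  let ?e' = "block_entry ?w L.XA'" and ?m' = "block_entry ?w L.XM'"
  let ?zA = "block_entry w L.ZA" and ?zM = "block_entry w L.ZM"
  let ?E = "rotation_sign w n" and ?E' = "rotation_sign ?w n"
  define V where "V p q = bi_variation (\<lambda>xs y zs. IP xs y zs (YM (q + 1) (n + p - 1))) ?e ?m ?zA ?zM" for p q
  have kn: "k + 1 < n" using glue by (simp add: glued_def)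
  have h_shift: "h (n + m) \<longleftrightarrow> h m" if "1 \<le> m" "m \<le> k" for m
    using h[of "n + m"] h[of m] i that kn by auto
  have glue': "glued k n ?w L.XA' R.XA'"
  proof -
    show ?thesis
      using glue h_shift hits_shift[of _ _ h n] unfolding glued_def by (auto simp: lowered_def inserted_def)
  qed
  have per_term: "sg (?E p) (IP (map (block_entry w XA1) bs) (block_entry w XM1 b) (map (block_entry w XA1) bs') (YM1 (q + 1) (n + p - 1))) =
      sg (?E p) (IP (map ?e bs) (?m b) (map ?e bs') (YM (q + 1) (n + p - 1))) +
      sg (?E p) (V p q bs b bs' + IP (map ?e bs) (?m b) (map ?e bs') (R.ZM (q + 1) (n + p - 1)))" (is ?first)
    and per_term': "sg (?E' p) (bi_variation (\<lambda>xs y zs. IP xs y zs (R.XM' (q + 1) (n + p - 1))) ?e' ?m' (L.slotA p) (L.slotM p) bs b bs') +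
      sg (?E' p + weight ?w p (q + 1)) (IP (map ?e' bs) (?m' b) (map ?e' bs')
          (snd (curvature_M beta ?w n R.XA' R.XM' (q + 1, n + p - 1)))) =
      sg (s 1) (sg (?E p) (V p q bs b bs' + IP (map ?e bs) (?m b) (map ?e bs') (R.ZM (q + 1) (n + p - 1))))" (is ?second)
    if pq: "p \<in> {1..k+1}" "q \<in> {k+1..<n}" and cut: "(bs, b, bs') \<in> cuts_at (k + 1) p q" for p q bs b bs'
  proof -
    have p: "1 \<le> p" "p \<le> Suc q" "q \<le> n - 1" using pq by auto
    note ch = cuts_at_block[OF cut p(2)]
    have add: "additive (IP (map ?e bs) (?m b) (map ?e bs'))"
      by (rule additive_IP; rule homogeneous_cut[OF L.homogeneous cut p])
    have add': "additive (IP (map ?e' bs) (?m' b) (map ?e' bs'))"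
      by (rule additive_IP; rule homogeneous_cut[OF L.homogeneous_inserted cut p])
    note corrected = L.corrected_cut[OF cut p bi_additive_IP, folded XA1_def XM1_def]
    note rescaled = L.rescaled_cut[OF cut p bi_additive_IP]
    have W: "weight w p (n + 1) = weight w p (q + 1) + weight w (q + 1) (n + 1)"
      using pq weight_add[of p "q + 1" "n + 1" w] by simp
    have "?first \<and> ?second"
    \<comment> \<open>The changed index lies either in the interval \<open>[p, q]\<close> that
      supplies the arguments of \<open>I\<close> or in the wrapped block, never in both.\<close>
    proof (cases "p \<le> i \<and> i \<le> q")
      case True
      then have nohit: "\<not> hits h (q + 1, n + p - 1)"
        using h pq by (auto simp: hits_def)
      then have ZM: "R.ZM (q + 1) (n + p - 1) = 0" "YM1 (q + 1) (n + p - 1) = YM (q + 1) (n + p - 1)"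
        "R.XM' (q + 1) (n + p - 1) = YM (q + 1) (n + p - 1)"
        by (auto simp: YM1_def correction_M_def inserted_def)
      have curv: "snd (curvature_M beta ?w n R.XA' R.XM' (q + 1, n + p - 1)) = 0"
      proof -
        have "fst (q + 1, n + p - 1) \<le> Suc (snd (q + 1, n + p - 1))" using pq by simp
        from curvature_M_nohit[OF nohit this, of beta w n yA YA yM YM]
        moreover have "n \<le> n + p - 1" "n + p - 1 \<le> n + k" using pq by auto
        ultimately show ?thesis using R.flat_M[of "q + 1" "n + p - 1"] pq by simp
      qed
      have a: "weight ?w 1 p = weight w 1 p"
        by (rule weight_lowered_nohit) (use True h pq in auto)
      have b: "weight ?w p (n + 1) = weight w p (n + 1) - 1"
        by (rule weight_lowered_single[of _ i]) (use True h pq i in auto)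
      have c: "s 1 = weight w 1 p + s p"
        using True i pq weight_add[of 1 p i w] by (simp add: s)
      have "?E' p + s p - (s 1 + ?E p) = - 2 * weight w 1 p"
        unfolding rotation_sign_def a b c by (simp add: algebra_simps)
      then have sign: "sg (?E' p) (sg (s p) x) = sg (s 1) (sg (?E p) x)" for x :: 'r
        unfolding sg_add_exp[symmetric] by (intro sg_parity) simp
      show ?thesis
        unfolding ZM curv additive.zero[OF add] additive.zero[OF add'] corrected rescaled V_def
        by (simp add: sg_plus sign)
    next
      case False
      have no: "\<not> hits h x" if "x \<in> set (bs @ b # bs')" for x
        using chain_mem[OF ch(7) that] False h pq kn i by (auto simp: hits_def)
      \<comment> \<open>For \<open>i < p\<close> the wrapped interval contains \<open>n + i\<close>;
        otherwise \<open>q < i \<le> n\<close> and it contains \<open>i\<close> itself.\<close>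
      have hit: "hits h (q + 1, n + p - 1)"
        using False h[of i] h[of "n + i"] pq i kn
        by (cases "i < p") (force simp: hits_def)+
      have zA: "snd (?zA x) = 0" if "x \<in> set bs \<union> set bs'" for x
        using no[of x] that by (auto simp: block_entry_def correction_A_def)
      have zM: "snd (?zM b) = 0"
        using no[of b] by (auto simp: block_entry_def correction_M_def)
      have V0: "bi_variation (\<lambda>xs y zs. IP xs y zs mt) ?e ?m ?zA ?zM bs b bs' = 0" for mt
        by (rule bi_variation_eq_0[OF bi_additive_IP]) (use zA zM in blast)+
      have e': "map ?e' bs = map ?e bs" "?m' b = ?m b" "map ?e' bs' = map ?e bs'"
        using no by (simp_all add: block_entry_nohit)
      let ?C = "snd (curvature_M beta ?w n R.XA' R.XM' (q + 1, n + p - 1))"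
      have "R.ZM (q + 1) (n + p - 1) = sg (s (q + 1)) ?C"
        using hit by (simp add: correction_M_def)
      then have C: "?C = sg (s (q + 1)) (R.ZM (q + 1) (n + p - 1))"
        by (simp add: sg_def)
      have mid: "weight ?w p (q + 1) = weight w p (q + 1)"
        by (rule weight_lowered_nohit) (use False h pq kn i in auto)
      \<comment> \<open>For \<open>i < p\<close> lowering affects the first factor of the rotation
        exponent, and the exponents agree exactly. For \<open>q < i\<close> it affects the second
        factor, and they differ by twice the degree of \<open>[1, p)\<close>.\<close>
      have "even (?E' p + weight ?w p (q + 1) + s (q + 1) - (s 1 + ?E p))"
      proof (cases "i < p")
        case True
        have a: "weight ?w 1 p = weight w 1 p - 1"
          by (rule weight_lowered_single[of _ i]) (use True h pq i in auto)
        have b: "weight ?w p (n + 1) = weight w p (n + 1)"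
          by (rule weight_lowered_nohit) (use True h pq i in auto)
        have c: "s (q + 1) = weight w (q + 1) (n + 1) + weight w (n + 1) (n + i)"
          using True pq i weight_add[of "q + 1" "n + 1" "n + i" w] by (simp add: s)
        have d: "weight w (n + 1) (n + i) = s 1"
          using True pq i glue weight_shift[of 1 i w n] by (auto simp: s glued_def)
        have "?E' p + weight ?w p (q + 1) + s (q + 1) - (s 1 + ?E p) = 0"
          unfolding rotation_sign_def mid a b c d W by (simp add: algebra_simps)
        then show ?thesis by simp
      next
        case i': False
        have a: "weight ?w 1 p = weight w 1 p"
          by (rule weight_lowered_nohit) (use i' h pq kn in auto)
        have b: "weight ?w p (n + 1) = weight w p (n + 1) - 1"
          by (rule weight_lowered_single[of _ i]) (use i' h pq i in auto)
        have c: "s 1 = weight w 1 p + weight w p (q + 1) + s (q + 1)"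
          using i' False i pq weight_add[of 1 p i w] weight_add[of p "q + 1" i w] by (simp add: s)
        have "?E' p + weight ?w p (q + 1) + s (q + 1) - (s 1 + ?E p) = - 2 * weight w 1 p"
          unfolding rotation_sign_def mid a b c by (simp add: algebra_simps)
        then show ?thesis by simp
      qed
      then have sign: "sg (?E' p + weight ?w p (q + 1)) (sg (s (q + 1)) x) = sg (s 1) (sg (?E p) x)" for x :: 'r
        unfolding sg_add_exp[symmetric] by (rule sg_parity)
      have ?first
        unfolding corrected V0 V_def YM1_def additive.add[OF add] by (simp add: sg_plus)
      moreover have ?second
        unfolding rescaled V0 V_def e' C additive_sg[OF add] sign by simp
      ultimately show ?thesis by blast
    qed
    then show ?first ?second by blast+
  qed
  let ?S = "\<Sum>p=1..k+1. \<Sum>q\<in>{k+1..<n}. \<Sum>(bs, b, bs')\<in>cuts_at (k + 1) p q.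
      sg (?E p) (V p q bs b bs' + IP (map ?e bs) (?m b) (map ?e bs') (R.ZM (q + 1) (n + p - 1)))"
  have "0 = (\<Sum>p=1..k+1. \<Sum>q\<in>{k+1..<n}. \<Sum>(bs, b, bs')\<in>cuts_at (k + 1) p q.
      sg (?E' p) (bi_variation (\<lambda>xs y zs. IP xs y zs (R.XM' (q + 1) (n + p - 1))) ?e' ?m' (L.slotA p) (L.slotM p) bs b bs') +
      sg (?E' p + weight ?w p (q + 1)) (IP (map ?e' bs) (?m' b) (map ?e' bs')
          (snd (curvature_M beta ?w n R.XA' R.XM' (q + 1, n + p - 1)))))"
    using bianchi_I[OF L.homogeneous_inserted R.homogeneous_inserted glue'] by simp
  also have "\<dots> = (\<Sum>p=1..k+1. \<Sum>q\<in>{k+1..<n}. \<Sum>(bs, b, bs')\<in>cuts_at (k + 1) p q. sg (s 1)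
      (sg (?E p) (V p q bs b bs' + IP (map ?e bs) (?m b) (map ?e bs') (R.ZM (q + 1) (n + p - 1)))))"
    by (intro sum.cong[OF refl]) (use per_term' in auto)
  also have "\<dots> = sg (s 1) ?S" by (simp only: sg_sum split_def)
  finally have "sg (s 1) ?S = 0" by (rule sym)
  then have "?S = 0" by (simp only: sg_eq_0_iff)
  moreover have "(\<Sum>p=1..k+1. \<Sum>q\<in>{k+1..<n}. \<Sum>(bs, b, bs')\<in>cuts_at (k + 1) p q. sg (?E p)
      (IP (map (block_entry w XA1) bs) (block_entry w XM1 b) (map (block_entry w XA1) bs') (YM1 (q + 1) (n + p - 1)))) =
    (\<Sum>p=1..k+1. \<Sum>q\<in>{k+1..<n}. \<Sum>(bs, b, bs')\<in>cuts_at (k + 1) p q.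
      sg (?E p) (IP (map ?e bs) (?m b) (map ?e bs') (YM (q + 1) (n + p - 1))) +
      sg (?E p) (V p q bs b bs' + IP (map ?e bs) (?m b) (map ?e bs') (R.ZM (q + 1) (n + p - 1))))"
    by (intro sum.cong[OF refl]) (use per_term in auto)
  ultimately show ?thesis by (simp add: sum.distrib split_def)
qed

end

section \<open>Cyclic defining systems as flat families\<close>

abbreviation index_weight :: "nat \<Rightarrow> (nat \<Rightarrow> int) \<Rightarrow> nat \<Rightarrow> int" where
  "index_weight N deg \<equiv> \<lambda>m. deg (label N m) - 1"

lemma entry_eq: "entry N deg X = block_entry (index_weight N deg) X"
  by (auto simp: entry_def block_entry_def seg_deg_def weight_def atLeastLessThanSuc_atLeastAtMost)

text \<open>The one-block cut contributes the differential, without a sign because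
  \<open>desusp\<close> of a one-element list is zero; the remaining cuts make up the
  staircase.\<close>

lemma curvature_A_staircase:
  assumes "i \<le> j"
  shows "snd (curvature_A mu (index_weight N deg) X (i, j)) = diff_A mu (X i j) + staircase_A mu N deg X i j"
proof -
  have "{bs. chain i bs (Suc j)} = insert [(i, j)] {bs. bs \<in> cuts i j \<and> 2 \<le> length bs}"
  proof (intro subset_antisym subsetI)
    fix bs assume bs: "bs \<in> {bs. chain i bs (Suc j)}"
    show "bs \<in> insert [(i, j)] {bs. bs \<in> cuts i j \<and> 2 \<le> length bs}"
    proof (cases bs)
      case Nil
      then show ?thesis using bs assms by simp
    next
      case (Cons b cs)
      then show ?thesis using bs assms by (cases cs) (auto simp: cuts_chain prod_eq_iff)
    qed
  qed (use assms in \<open>auto simp: cuts_chain\<close>)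
  then have "snd (curvature_A mu (index_weight N deg) X (i, j)) =
      snd (alg_shift mu (map (block_entry (index_weight N deg) X) [(i, j)])) + staircase_A mu N deg X i j"
    unfolding curvature_A_def staircase_A_def entry_eq by (simp add: finite_cuts)
  then show ?thesis by (simp add: alg_shift_def desusp_def block_entry_def diff_A_def sg_def)
qed

lemma curvature_M_staircase:
  assumes "i \<le> c" "c \<le> j"
  shows "snd (curvature_M beta (index_weight N deg) c XA XM (i, j)) =
    diff_M beta (XM i j) + staircase_M beta N deg c XA XM i j"
proof -
  let ?S = "{(bs, b, bs'). (bs, b, bs') \<in> cuts_at c i j \<and> 2 \<le> length (bs @ b # bs')}"
  have ij: "i \<le> Suc j" using assms by simp
  have "cuts_at c i j = insert ([], (i, j), []) ?S"
  proof (intro subset_antisym subsetI)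
    fix t assume t: "t \<in> cuts_at c i j"
    obtain bs b bs' where t': "t = (bs, b, bs')" by (metis prod.collapse)
    note ch = cuts_at_block[OF t[unfolded t'] ij]
    show "t \<in> insert ([], (i, j), []) ?S"
      using t ch by (cases bs; cases bs') (auto simp: t' prod_eq_iff)
  qed (use assms in \<open>auto simp: cuts_at_chain[OF ij]\<close>)
  moreover have "finite ?S" by (rule finite_subset[OF _ finite_cuts_at[of c i j]]) auto
  ultimately have "sum f (cuts_at c i j) = f ([], (i, j), []) + sum f ?S"
    for f :: "(nat \<times> nat) list \<times> (nat \<times> nat) \<times> (nat \<times> nat) list \<Rightarrow> 'a"
  proof -
    assume cuts: "cuts_at c i j = insert ([], (i, j), []) ?S" and "finite ?S"
    then have "sum f (insert ([], (i, j), []) ?S) = f ([], (i, j), []) + sum f ?S" by (intro sum.insert) auto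
    then show ?thesis using arg_cong[OF cuts, of "sum f"] by (rule trans[rotated])
  qed
  then have "snd (curvature_M beta (index_weight N deg) c XA XM (i, j)) =
      snd (bi_shift 1 beta [] (block_entry (index_weight N deg) XM (i, j)) []) + staircase_M beta N deg c XA XM i j"
    unfolding sum_curvature_M staircase_M_def entry_eq by simp
  then show ?thesis by (simp add: bi_shift_def desusp_def block_entry_def diff_M_def sg_def)
qed

lemma (in ainf_module) defining_family_iff:
  "defining_family A mu M beta N deg xA xM lo c hi XA XM \<longleftrightarrow>
     (\<forall>i\<in>{lo..hi}. if i = c then XM i i = xM (label N i) else XA i i = xA (label N i)) \<and>
     flat_family sA A mu sM M beta (index_weight N deg) lo c hi XA XM"
proof -
  have "flat_family sA A mu sM M beta (index_weight N deg) lo c hi XA XM \<longleftrightarrow>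
    (\<forall>i j. lo \<le> i \<and> i \<le> j \<and> j \<le> hi \<longrightarrow>
        (if i \<le> c \<and> c \<le> j
         then is_shifted M (entry N deg XM (i, j)) \<and>
              diff_M beta (XM i j) = - staircase_M beta N deg c XA XM i j
         else is_shifted A (entry N deg XA (i, j)) \<and>
              diff_A mu (XA i j) = - staircase_A mu N deg XA i j))"
    unfolding flat_family_def flat_family_axioms_def homogeneous_family_def entry_eq
    using ainf_module_axioms
    by (auto simp: curvature_A_staircase curvature_M_staircase eq_neg_iff_add_eq_0)
  then show ?thesis unfolding defining_family_def by blast
qed

text \<open>An interval with a single position has only the trivial cut, and the sign is trivial
  because \<open>s\<close> vanishes at the hit; so the diagonal entry changes by exactly the
  coboundary of \<open>y\<close>.\<close>

lemma correction_A_diag: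
  assumes "h m" "s m = 0"
  shows "correction_A mu w h s y X m m = diff_A mu y"
proof -
  have "{bs. chain m bs (Suc m)} = {[(m, m)]}"
  proof (intro subset_antisym subsetI)
    fix bs assume "bs \<in> {bs. chain m bs (Suc m)}"
    then have bs: "chain m bs (Suc m)" by simp
    then obtain b cs where b: "bs = b # cs" by (cases bs) auto
    then have "chain (Suc (snd b)) cs (Suc m)" "fst b = m" "m \<le> snd b" using bs by auto
    then have "snd b = m" using chain_le by fastforce
    then show "bs \<in> {[(m, m)]}" using bs b by (auto simp: chain_refl prod_eq_iff)
  qed auto
  then show ?thesis
    using assms by (simp add: correction_A_def hits_def curvature_A_def alg_shift_def desusp_def
        block_entry_def inserted_def diff_A_def sg_def)
qed

lemma correction_M_diag:
  assumes "h m" "s m = 0"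
  shows "correction_M beta w h s m yA yM XA XM m m = diff_M beta yM"
proof -
  have "cuts_at m m m = {([], (m, m), [])}"
  proof (intro subset_antisym subsetI)
    fix t assume t: "t \<in> cuts_at m m m"
    obtain bs b bs' where t': "t = (bs, b, bs')" by (metis prod.collapse)
    have "m \<le> Suc m" by simp
    note ch = cuts_at_block[OF t[unfolded t'] this]
    then have "b = (m, m)" by (simp add: prod_eq_iff)
    then show "t \<in> {([], (m, m), [])}" using ch by (simp add: t' chain_refl)
  qed (simp add: cuts_at_chain)
  then show ?thesis
    using assms by (simp add: correction_M_def hits_def curvature_M_def bi_shift_def desusp_def
        block_entry_def inserted_def diff_M_def sg_def)
qed

lemma curvature_A_cong:
  assumes "\<And>u v. fst b \<le> u \<Longrightarrow> u \<le> v \<Longrightarrow> v \<le> snd b \<Longrightarrow> X u v = Y u v"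
  shows "curvature_A mu w X b = curvature_A mu w Y b"
proof -
  have "map (block_entry w X) bs = map (block_entry w Y) bs" if "chain (fst b) bs (Suc (snd b))" for bs
    using assms chain_mem[OF that] by (simp add: block_entry_def less_Suc_eq_le)
  then show ?thesis unfolding curvature_A_def by (intro arg_cong[where f = "Pair _"] sum.cong refl) (simp del: map_eq_conv)
qed

text \<open>Compares the indices \<open>1, ..., k\<close> with their copies beyond \<open>N\<close>;
  it keeps the corrected families compatible there.\<close>

lemma curvature_A_shift:
  assumes w: "\<And>m. u \<le> m \<Longrightarrow> m \<le> v \<Longrightarrow> w (n + m) = w m"
    and X: "\<And>i j. u \<le> i \<Longrightarrow> i \<le> j \<Longrightarrow> j \<le> v \<Longrightarrow> X i j = Y (n + i) (n + j)"
  shows "snd (curvature_A mu w Y (n + u, n + v)) = snd (curvature_A mu w X (u, v))"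
proof -
  have "map (block_entry w Y) (shift_blocks n bs) = map (block_entry w X) bs" if ch: "chain u bs (Suc v)" for bs
  proof -
    have "block_entry w Y (i + n, j + n) = block_entry w X (i, j)" if "(i, j) \<in> set bs" for i j
    proof -
      have ij: "u \<le> i" "i \<le> j" "j \<le> v" using chain_mem[OF ch that] by auto
      then have "weight w (n + i) (n + Suc j) = weight w i (Suc j)"
        by (intro weight_shift w) auto
      then show ?thesis using X ij by (simp add: block_entry_def add.commute[of _ n])
    qed
    then show ?thesis by auto
  qed
  moreover have "{bs. chain (n + u) bs (Suc (n + v))} = shift_blocks n ` {bs. chain u bs (Suc v)}"
    using chain_shift_image[of u n "Suc v"] by (simp add: add.commute)
  ultimately show ?thesis
    unfolding curvature_A_def fst_conv snd_conv
    by (simp add: sum.reindex[OF inj_on_subset[OF inj_shift_map]] del: map_map map_eq_conv)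
qed

section \<open>The Massey inner product set\<close>

lemma inner_product_eq:
  "staircase_inner_product D I k l deg XA XM XM' =
    (\<Sum>p=1..k+1. \<Sum>q\<in>{k+1..<k+l+2}. \<Sum>(bs, b, bs')\<in>cuts_at (k + 1) p q.
       sg (rotation_sign (index_weight (k + l + 2) deg) (k + l + 2) p)
         (snd (bi_shift D I (map (block_entry (index_weight (k + l + 2) deg) XA) bs)
             (block_entry (index_weight (k + l + 2) deg) XM b)
             (map (block_entry (index_weight (k + l + 2) deg) XA) bs'))
           (XM' (q + 1) (k + l + 2 + p - 1))))"
proof -
  let ?N = "k + l + 2"
  have w: "index_weight ?N deg m = deg m - 1" if "m \<le> ?N" for m using that by (simp add: label_def)
  have "(\<Sum>m=1..<p. deg m - 1) * (\<Sum>m=p..?N. deg m - 1) = rotation_sign (index_weight ?N deg) ?N p"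
    if "p \<le> k + 1" for p
  proof -
    have "(\<Sum>m=1..<p. deg m - 1) = weight (index_weight ?N deg) 1 p"
      unfolding weight_def using that by (intro sum.cong refl) (auto simp: label_def)
    moreover have "(\<Sum>m=p..?N. deg m - 1) = weight (index_weight ?N deg) p (?N + 1)"
      unfolding weight_def by (intro sum.cong) (auto simp: label_def)
    ultimately show ?thesis by (simp add: rotation_sign_def)
  qed
  moreover have "{k+1..k+l+1} = {k+1..<k+l+2}" by auto
  ultimately show ?thesis
    unfolding staircase_inner_product_def Let_def entry_eq by (intro sum.cong) auto
qed

text \<open>Lets tuples be updated as total functions: their values at positions of the other kind
  carry no meaning.\<close>

lemma massey_inner_product_cong:
  assumes "\<And>i. i \<in> A_idx k l \<Longrightarrow> xA i = xA' i" "\<And>i. i \<in> M_idx k l \<Longrightarrow> xM i = xM' i"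
  shows "massey_inner_product A mu M beta D I k l deg xA xM = massey_inner_product A mu M beta D I k l deg xA' xM'"
proof -
  let ?N = "k + l + 2"
  have 1: "defining_family A mu M beta ?N deg xA xM 1 (k + 1) (?N - 1) XA XM \<longleftrightarrow>
      defining_family A mu M beta ?N deg xA' xM' 1 (k + 1) (?N - 1) XA XM" for XA XM
  proof -
    have "xA (label ?N i) = xA' (label ?N i)" if "i \<in> {1..?N - 1}" "i \<noteq> k + 1" for i
      using that by (intro assms) (auto simp: label_def A_idx_def)
    moreover have "xM (label ?N (k + 1)) = xM' (label ?N (k + 1))"
      by (intro assms) (auto simp: label_def M_idx_def)
    ultimately have "(\<forall>i\<in>{1..?N - 1}. if i = k + 1 then XM i i = xM (label ?N i) else XA i i = xA (label ?N i)) \<longleftrightarrow>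
      (\<forall>i\<in>{1..?N - 1}. if i = k + 1 then XM i i = xM' (label ?N i) else XA i i = xA' (label ?N i))" by auto
    then show ?thesis unfolding defining_family_def by blast
  qed
  have 2: "defining_family A mu M beta ?N deg xA xM (k + 2) ?N (?N + k) XA XM \<longleftrightarrow>
      defining_family A mu M beta ?N deg xA' xM' (k + 2) ?N (?N + k) XA XM" for XA XM
  proof -
    have "xA (label ?N i) = xA' (label ?N i)" if "i \<in> {k + 2..?N + k}" "i \<noteq> ?N" for i
      using that by (intro assms) (auto simp: label_def A_idx_def)
    moreover have "xM (label ?N ?N) = xM' (label ?N ?N)"
      by (intro assms) (auto simp: label_def M_idx_def)
    ultimately have "(\<forall>i\<in>{k + 2..?N + k}. if i = ?N then XM i i = xM (label ?N i) else XA i i = xA (label ?N i)) \<longleftrightarrow>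
      (\<forall>i\<in>{k + 2..?N + k}. if i = ?N then XM i i = xM' (label ?N i) else XA i i = xA' (label ?N i))" by auto
    then show ?thesis unfolding defining_family_def by blast
  qed
  show ?thesis unfolding massey_inner_product_def cyclic_defining_system_def Let_def 1 2 ..
qed

context ainf_inner_product
begin

text \<open>Both functions are updated at \<open>i\<close>, which avoids separate arguments for
  algebra and module positions.\<close>

lemma massey_change_entry:
  fixes k l :: nat and deg :: "nat \<Rightarrow> int"
  assumes i: "i \<in> A_idx k l \<union> M_idx k l"
    and yA: "i \<in> A_idx k l \<Longrightarrow> yA \<in> A (deg i - 1)" and yM: "i \<in> M_idx k l \<Longrightarrow> yM \<in> M (deg i - 1)"
  shows "massey_inner_product A mu M beta D I k l deg xA xM \<subseteq>
    massey_inner_product A mu M beta D I k l deg (xA(i := xA i + diff_A mu yA)) (xM(i := xM i + diff_M beta yM))"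
proof
  define N where "N = k + l + 2"
  define w where "w = index_weight N deg"
  define h where "h m \<longleftrightarrow> label N m = i" for m
  \<comment> \<open>The degree from \<open>u\<close> to the next occurrence of \<open>i\<close>,
    which is \<open>i\<close> or \<open>N + i\<close>. Beyond \<open>N + i\<close> no further hit
    lies in the range; \<open>N + N + i\<close> serves there as a reference point that keeps
    \<open>s\<close> additive.\<close>
  define s where "s u = weight w u (if u \<le> i then i else if u \<le> N + i then N + i else N + N + i)" for u
  let ?xA = "xA(i := xA i + diff_A mu yA)" and ?xM = "xM(i := xM i + diff_M beta yM)"
  have iN: "1 \<le> i" "i \<le> N" using i by (auto simp: A_idx_def M_idx_def N_def)
  have h: "h m \<longleftrightarrow> m = i \<or> m = N + i" if "1 \<le> m" for m
    using that iN by (auto simp: h_def label_def)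
  have w_shift: "w (N + m) = w m" if "1 \<le> m" "m \<le> k" for m
    using that by (simp add: w_def label_def N_def)
  have wi: "w m = deg i - 1" if "h m" for m using that by (simp add: w_def h_def)
  fix r assume "r \<in> massey_inner_product A mu M beta D I k l deg xA xM"
  then obtain XA XM YA YM where S: "r = staircase_inner_product D I k l deg XA XM YM"
    and sys: "cyclic_defining_system A mu M beta k l deg xA xM XA XM YA YM"
    unfolding massey_inner_product_def by blast
  have X: "\<forall>i\<in>{1..N - 1}. if i = k + 1 then XM i i = xM (label N i) else XA i i = xA (label N i)"
      "flat_family sA A mu sM M beta w 1 (k + 1) (N - 1) XA XM"
    and Y: "\<forall>i\<in>{k + 2..N + k}. if i = N then YM i i = xM (label N i) else YA i i = xA (label N i)"
      "flat_family sA A mu sM M beta w (k + 2) N (N + k) YA YM"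
    and glue: "\<And>i j. 1 \<le> i \<Longrightarrow> i \<le> j \<Longrightarrow> j \<le> k \<Longrightarrow> XA i j = YA (N + i) (N + j)"
      "\<And>i j. k + 2 \<le> i \<Longrightarrow> i \<le> j \<Longrightarrow> j < N \<Longrightarrow> XA i j = YA i j"
    using sys unfolding cyclic_defining_system_def Let_def defining_family_iff N_def[symmetric] w_def[symmetric]
    by (auto simp: N_def)
  have step: "s u = weight w u v + s v" if "1 \<le> u" "u \<le> v" "v \<le> N + k" "\<And>m. u \<le> m \<Longrightarrow> m < v \<Longrightarrow> \<not> h m" for u v
  proof -
    have "u \<le> i \<Longrightarrow> v \<le> i" "u \<le> N + i \<Longrightarrow> v \<le> N + i" "v \<le> N + N + i"
      using that(4)[of i] that(4)[of "N + i"] h[of i] h[of "N + i"] iN that(1-3)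
      by (force simp: not_less, force simp: not_less, simp add: N_def)
    then show ?thesis
      using that weight_add[of u v i w] weight_add[of u v "N + i" w] weight_add[of u v "N + N + i" w]
      by (auto simp: s_def)
  qed
  have s0: "s m = 0" if "1 \<le> m" "h m" for m
    using h[OF that(1)] that iN by (auto simp: s_def weight_def)
  have L: "entry_change sA A mu sM M beta w 1 (k + 1) (N - 1) XA XM h s yA yM"
  proof (intro entry_change.intro X(2) entry_change_axioms.intro)
    show "m = m'" if "m \<in> {1..N - 1}" "m' \<in> {1..N - 1}" "h m" "h m'" for m m'
      using that h iN by auto
    show "s u = weight w u v + s v" if "1 \<le> u" "u \<le> v" "v \<le> N - 1" "\<And>m. u \<le> m \<Longrightarrow> m < v \<Longrightarrow> \<not> h m" for u v
      using that by (intro step) auto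
    show "s m = 0" if "m \<in> {1..N - 1}" "h m" for m using that s0 by auto
    show "yA \<in> A (w m)" if "m \<in> {1..N - 1}" "h m" "m \<noteq> k + 1" for m
    proof -
      have "i = m" using that h[of m] iN by auto
      then have "i \<in> A_idx k l" using that by (auto simp: A_idx_def N_def)
      then show ?thesis using yA wi[OF that(2)] by simp
    qed
    show "yM \<in> M (w (k + 1))" if "h (k + 1)"
    proof -
      have "i = k + 1" using that by (simp add: h_def label_def N_def)
      then show ?thesis using that yM wi[of "k + 1"] by (auto simp: M_idx_def)
    qed
  qed
  have R: "entry_change sA A mu sM M beta w (k + 2) N (N + k) YA YM h s yA yM"
  proof (intro entry_change.intro Y(2) entry_change_axioms.intro)
    show "m = m'" if "m \<in> {k + 2..N + k}" "m' \<in> {k + 2..N + k}" "h m" "h m'" for m m'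
      using that h[of m] h[of m'] iN by auto
    show "s u = weight w u v + s v" if "k + 2 \<le> u" "u \<le> v" "v \<le> N + k" "\<And>m. u \<le> m \<Longrightarrow> m < v \<Longrightarrow> \<not> h m" for u v
      using that by (intro step) auto
    show "s m = 0" if "m \<in> {k + 2..N + k}" "h m" for m using that s0 by auto
    show "yA \<in> A (w m)" if "m \<in> {k + 2..N + k}" "h m" "m \<noteq> N" for m
    proof -
      have "i \<in> A_idx k l" using that by (auto simp: h_def label_def N_def A_idx_def split: if_splits)
      then show ?thesis using yA wi[OF that(2)] by simp
    qed
    show "yM \<in> M (w N)" if "h N"
    proof -
      have "i = N" using that by (simp add: h_def label_def)
      then show ?thesis using that yM wi[of N] by (auto simp: M_idx_def N_def)
    qed
  qed
  define XA1 where "XA1 = (\<lambda>u v. XA u v + correction_A mu w h s yA XA u v)"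
  define XM1 where "XM1 = (\<lambda>u v. XM u v + correction_M beta w h s (k + 1) yA yM XA XM u v)"
  define YA1 where "YA1 = (\<lambda>u v. YA u v + correction_A mu w h s yA YA u v)"
  define YM1 where "YM1 = (\<lambda>u v. YM u v + correction_M beta w h s N yA yM YA YM u v)"
  have flat: "flat_family sA A mu sM M beta w 1 (k + 1) (N - 1) XA1 XM1"
    "flat_family sA A mu sM M beta w (k + 2) N (N + k) YA1 YM1"
    unfolding XA1_def XM1_def YA1_def YM1_def
    using entry_change.corrected_family[OF L] entry_change.corrected_family[OF R] by blast+
  have diag_A: "Z m m + correction_A mu w h s yA Z m m = ?xA (label N m)"
    if "1 \<le> m" "Z m m = xA (label N m)" for m Z
    using that s0[OF that(1)] correction_A_diag[of h m s mu w yA Z] by (cases "h m") (auto simp: h_def correction_A_def hits_def)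
  have diag_M: "Z m m + correction_M beta w h s m yA yM Z' Z m m = ?xM (label N m)"
    if "1 \<le> m" "Z m m = xM (label N m)" for m Z Z'
    using that s0[OF that(1)] correction_M_diag[of h m s beta w yA yM Z' Z] by (cases "h m") (auto simp: h_def correction_M_def hits_def)
  have base_X: "\<forall>i\<in>{1..N - 1}. if i = k + 1 then XM1 i i = ?xM (label N i) else XA1 i i = ?xA (label N i)"
  proof
    fix m assume "m \<in> {1..N - 1}"
    then show "if m = k + 1 then XM1 m m = ?xM (label N m) else XA1 m m = ?xA (label N m)"
      using X(1) diag_A[of m XA] diag_M[of m XM XA]
      by (cases "m = k + 1") (simp_all add: XA1_def XM1_def del: fun_upd_apply)
  qed
  have base_Y: "\<forall>i\<in>{k + 2..N + k}. if i = N then YM1 i i = ?xM (label N i) else YA1 i i = ?xA (label N i)"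
  proof
    fix m assume "m \<in> {k + 2..N + k}"
    then show "if m = N then YM1 m m = ?xM (label N m) else YA1 m m = ?xA (label N m)"
      using Y(1) diag_A[of m YA] diag_M[of m YM YA]
      by (cases "m = N") (simp_all add: YA1_def YM1_def del: fun_upd_apply)
  qed
  have glue1: "XA1 u v = YA1 (N + u) (N + v)" if uv: "1 \<le> u" "u \<le> v" "v \<le> k" for u v
  proof -
    have kN: "k < N" by (simp add: N_def)
    have h_shift: "h (N + m) \<longleftrightarrow> h m" if "1 \<le> m" "m \<le> k" for m
      using that h[of m] h[of "N + m"] iN kN by auto
    have hits: "hits h (N + u', N + v') \<longleftrightarrow> hits h (u', v')" if "1 \<le> u'" "v' \<le> k" for u' v'
      by (rule hits_shift) (use h_shift that in auto)
    have "correction_A mu w h s yA XA u v = correction_A mu w h s yA YA (N + u) (N + v)"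
    proof (cases "hits h (u, v)")
      case True
      then obtain m where "u \<le> m" "m \<le> v" "h m" by (auto simp: hits_def)
      then have ui: "u \<le> i" "i \<le> v" using h[of m] uv kN by auto
      \<comment> \<open>Since \<open>i \<le> v \<le> k\<close>, periodicity gives the stretches from
        \<open>u\<close> to \<open>i\<close> and from \<open>N + u\<close> to \<open>N + i\<close>
        the same degree, so the two corrections carry the same sign.\<close>
      have "s (N + u) = s u"
        using ui uv iN w_shift weight_shift[of u i w N] by (auto simp: s_def)
      moreover have "snd (curvature_A mu (lowered w h) (inserted h yA YA) (N + u, N + v)) =
          snd (curvature_A mu (lowered w h) (inserted h yA XA) (u, v))"
        using uv w_shift h_shift hits glue(1) by (intro curvature_A_shift) (auto simp: lowered_def inserted_def)
      ultimately show ?thesis using True hits[OF uv(1,3)] by (simp add: correction_A_def)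
    next
      case False
      then show ?thesis using hits[OF uv(1,3)] by (simp add: correction_A_def)
    qed
    then show ?thesis using glue(1)[OF uv] by (simp add: XA1_def YA1_def)
  qed
  have glue2: "XA1 u v = YA1 u v" if uv: "k + 2 \<le> u" "u \<le> v" "v \<le> k + l + 1" for u v
  proof -
    have "curvature_A mu (lowered w h) (inserted h yA XA) (u, v) = curvature_A mu (lowered w h) (inserted h yA YA) (u, v)"
      using uv glue(2) by (intro curvature_A_cong) (auto simp: inserted_def N_def)
    then show ?thesis using uv glue(2)[of u v] by (simp add: XA1_def YA1_def correction_A_def N_def)
  qed
  have sys1: "cyclic_defining_system A mu M beta k l deg ?xA ?xM XA1 XM1 YA1 YM1"
    unfolding cyclic_defining_system_def Let_def defining_family_iff N_def[symmetric] w_def[symmetric]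
    using flat base_X base_Y glue1 glue2 by blast
  have glued: "glued k N w XA YA"
    using glue w_shift by (auto simp: glued_def N_def)
  have s_eq: "s u = weight w u (if u \<le> i then i else N + i)" if "u \<le> N + i" for u
    using that by (simp add: s_def)
  have "staircase_inner_product D I k l deg XA1 XM1 YM1 = r"
    unfolding S inner_product_eq N_def[symmetric] w_def[symmetric] XA1_def XM1_def YM1_def
    by (rule corrected_inner_product[OF L R glued iN h s_eq])
  then show "r \<in> massey_inner_product A mu M beta D I k l deg ?xA ?xM"
    using sys1 unfolding massey_inner_product_def by blast
qed

text \<open>Induction over the set \<open>J\<close> of positions already replaced. One inclusion is
  enough, as the other follows by exchanging the tuples.\<close>

lemma massey_cohomologous_subset:
  fixes k l :: nat and deg :: "nat \<Rightarrow> int"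
  assumes A: "\<And>i. i \<in> A_idx k l \<Longrightarrow> xA' i - xA i \<in> diff_A mu ` A (deg i - 1)"
    and M: "\<And>i. i \<in> M_idx k l \<Longrightarrow> xM' i - xM i \<in> diff_M beta ` M (deg i - 1)"
  shows "massey_inner_product A mu M beta D I k l deg xA xM \<subseteq> massey_inner_product A mu M beta D I k l deg xA' xM'"
proof -
  let ?P = "massey_inner_product A mu M beta D I k l deg"
  have "?P xA xM \<subseteq> ?P (\<lambda>i. if i \<in> J then xA' i else xA i) (\<lambda>i. if i \<in> J then xM' i else xM i)"
    if "finite J" "J \<subseteq> A_idx k l \<union> M_idx k l" for J
    using that
  proof (induction J rule: finite_induct)
    case empty
    then show ?case by simp
  next
    case (insert i J)
    let ?a = "\<lambda>i. if i \<in> J then xA' i else xA i" and ?m = "\<lambda>i. if i \<in> J then xM' i else xM i"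
    \<comment> \<open>At a module position the implication is vacuous and any \<open>yA\<close> will
      do; in this way \<open>yA\<close> and \<open>yM\<close> are available at every
      position.\<close>
    have "\<exists>yA. i \<in> A_idx k l \<longrightarrow> yA \<in> A (deg i - 1) \<and> xA' i = xA i + diff_A mu yA"
      using A[of i] by (auto simp: algebra_simps image_iff)
    then obtain yA where yA: "i \<in> A_idx k l \<Longrightarrow> yA \<in> A (deg i - 1)" "i \<in> A_idx k l \<Longrightarrow> xA' i = xA i + diff_A mu yA"
      by blast
    have "\<exists>yM. i \<in> M_idx k l \<longrightarrow> yM \<in> M (deg i - 1) \<and> xM' i = xM i + diff_M beta yM"
      using M[of i] by (auto simp: algebra_simps image_iff)
    then obtain yM where yM: "i \<in> M_idx k l \<Longrightarrow> yM \<in> M (deg i - 1)" "i \<in> M_idx k l \<Longrightarrow> xM' i = xM i + diff_M beta yM"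
      by blast
    have "?P xA xM \<subseteq> ?P ?a ?m" using insert by simp
    also have "?P ?a ?m \<subseteq> ?P (?a(i := ?a i + diff_A mu yA)) (?m(i := ?m i + diff_M beta yM))"
      by (rule massey_change_entry) (use insert.prems yA yM in auto)
    also have "\<dots> = ?P (\<lambda>j. if j \<in> insert i J then xA' j else xA j) (\<lambda>j. if j \<in> insert i J then xM' j else xM j)"
      by (rule massey_inner_product_cong) (use insert.hyps yA yM in auto)
    finally show ?case .
  qed
  from this[of "A_idx k l \<union> M_idx k l"]
  have "?P xA xM \<subseteq> ?P (\<lambda>i. if i \<in> A_idx k l \<union> M_idx k l then xA' i else xA i)
      (\<lambda>i. if i \<in> A_idx k l \<union> M_idx k l then xM' i else xM i)"
    by (simp add: A_idx_def M_idx_def)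
  also have "\<dots> = ?P xA' xM'" by (rule massey_inner_product_cong) auto
  finally show ?thesis .
qed

text \<open>Needed to read off from equal classes that the representatives are related: each one
  must lie in its own class, for which zero has to be a coboundary.\<close>

lemma cohomologous_refl:
  "x \<in> cocycles A (diff_A mu) n \<Longrightarrow> (x, x) \<in> cohomologous A (diff_A mu) n"
  "m \<in> cocycles M (diff_M beta) n \<Longrightarrow> (m, m) \<in> cohomologous M (diff_M beta) n"
proof -
  have "mu [0] = 0"
    using additive.zero[OF module_hom_additive[OF mu_multilinear[of "[]" "[]"]]] by simp
  then have "0 \<in> diff_A mu ` A (n - 1)" using zero_grade[of "n - 1"] by (auto simp: diff_A_def intro!: image_eqI[of _ _ 0])
  then show "(x, x) \<in> cohomologous A (diff_A mu) n" if "x \<in> cocycles A (diff_A mu) n"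
    using that by (simp add: cohomologous_def)
  have "module_hom sM sM (\<lambda>m. beta [] m [])" using beta_multilinear unfolding bi_multilinear_def by blast
  then have "beta [] 0 [] = 0" using additive.zero[OF module_hom_additive] by blast
  then have "0 \<in> diff_M beta ` M (n - 1)" using M.zero_grade[of "n - 1"] by (auto simp: diff_M_def intro!: image_eqI[of _ _ 0])
  then show "(m, m) \<in> cohomologous M (diff_M beta) n" if "m \<in> cocycles M (diff_M beta) n"
    using that by (simp add: cohomologous_def)
qed

lemma massey_coclass_eq:
  fixes k l :: nat and deg :: "nat \<Rightarrow> int"
  assumes xA: "xA \<in> (\<Pi> i\<in>A_idx k l. cocycles A (diff_A mu) (deg i))" "xA' \<in> (\<Pi> i\<in>A_idx k l. cocycles A (diff_A mu) (deg i))"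
    and xM: "xM \<in> (\<Pi> i\<in>M_idx k l. cocycles M (diff_M beta) (deg i))" "xM' \<in> (\<Pi> i\<in>M_idx k l. cocycles M (diff_M beta) (deg i))"
    and eqA: "\<And>i. i \<in> A_idx k l \<Longrightarrow> coclass A (diff_A mu) (deg i) (xA i) = coclass A (diff_A mu) (deg i) (xA' i)"
    and eqM: "\<And>i. i \<in> M_idx k l \<Longrightarrow> coclass M (diff_M beta) (deg i) (xM i) = coclass M (diff_M beta) (deg i) (xM' i)"
  shows "massey_inner_product A mu M beta D I k l deg xA xM = massey_inner_product A mu M beta D I k l deg xA' xM'"
proof
  have A: "(xA i, xA' i) \<in> cohomologous A (diff_A mu) (deg i)" "(xA' i, xA i) \<in> cohomologous A (diff_A mu) (deg i)"
    if "i \<in> A_idx k l" for i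
    using eqA[OF that] cohomologous_refl(1)[of "xA i" "deg i"] cohomologous_refl(1)[of "xA' i" "deg i"] that xA
    by (auto simp: coclass_def)
  have M: "(xM i, xM' i) \<in> cohomologous M (diff_M beta) (deg i)" "(xM' i, xM i) \<in> cohomologous M (diff_M beta) (deg i)"
    if "i \<in> M_idx k l" for i
    using eqM[OF that] cohomologous_refl(2)[of "xM i" "deg i"] cohomologous_refl(2)[of "xM' i" "deg i"] that xM
    by (auto simp: coclass_def)
  show "massey_inner_product A mu M beta D I k l deg xA xM \<subseteq> massey_inner_product A mu M beta D I k l deg xA' xM'"
    by (rule massey_cohomologous_subset) (use A(2) M(2) in \<open>auto simp: cohomologous_def\<close>)
  show "massey_inner_product A mu M beta D I k l deg xA' xM' \<subseteq> massey_inner_product A mu M beta D I k l deg xA xM"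
    by (rule massey_cohomologous_subset) (use A(1) M(1) in \<open>auto simp: cohomologous_def\<close>)
qed

end

section \<open>The induced map on tuples of cohomology classes\<close>

lemma cohomology_representatives:
  assumes "c \<in> (\<Pi>\<^sub>E i\<in>J. cohomology G d (deg i))"
  obtains x where "x \<in> (\<Pi> i\<in>J. cocycles G d (deg i))" "c = (\<lambda>i\<in>J. coclass G d (deg i) (x i))"
proof -
  have "\<exists>x. x \<in> cocycles G d (deg i) \<and> c i = coclass G d (deg i) x" if "i \<in> J" for i
    using assms that unfolding cohomology_def coclass_def by (auto simp: PiE_iff elim!: quotientE)
  then obtain x where x: "\<And>i. i \<in> J \<Longrightarrow> x i \<in> cocycles G d (deg i) \<and> c i = coclass G d (deg i) (x i)" by metis
  have "c = (\<lambda>i\<in>J. coclass G d (deg i) (x i))"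
    using assms x by (intro extensionalityI[of _ J]) (auto simp: PiE_iff)
  then show ?thesis using that[of x] x by auto
qed

text \<open>A map constant on the fibres of a surjection factors through it. Uniqueness holds on
  \<open>E\<close> by surjectivity and outside \<open>E\<close> because members of
  \<open>PiE\<close> are fixed there.\<close>

lemma ex1_PiE_factor:
  assumes f: "\<And>x. x \<in> S \<Longrightarrow> f x \<in> E" "E \<subseteq> f ` S"
    and g: "\<And>x y. x \<in> S \<Longrightarrow> y \<in> S \<Longrightarrow> f x = f y \<Longrightarrow> g x = g y" "\<And>x. x \<in> S \<Longrightarrow> g x \<in> T"
  shows "\<exists>!\<Phi>. \<Phi> \<in> E \<rightarrow>\<^sub>E T \<and> (\<forall>x\<in>S. \<Phi> (f x) = g x)"
proof
  let ?\<Phi> = "\<lambda>e\<in>E. g (SOME x. x \<in> S \<and> f x = e)"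
  have some: "(SOME x. x \<in> S \<and> f x = e) \<in> S \<and> f (SOME x. x \<in> S \<and> f x = e) = e" if e: "e \<in> E" for e
  proof -
    obtain x where "x \<in> S \<and> f x = e" using f(2) e by blast
    then show ?thesis by (rule someI)
  qed
  show "?\<Phi> \<in> E \<rightarrow>\<^sub>E T \<and> (\<forall>x\<in>S. ?\<Phi> (f x) = g x)"
  proof (intro conjI ballI)
    show "?\<Phi> \<in> E \<rightarrow>\<^sub>E T"
      unfolding restrict_PiE_iff using some g(2) by blast
    fix x assume x: "x \<in> S"
    note some = some[OF f(1)[OF x]]
    have "g (SOME x'. x' \<in> S \<and> f x' = f x) = g x"
      by (rule g(1)) (use some x in blast)+
    then show "?\<Phi> (f x) = g x" using f(1)[OF x] by simp
  qed
  fix \<Phi> assume "\<Phi> \<in> E \<rightarrow>\<^sub>E T \<and> (\<forall>x\<in>S. \<Phi> (f x) = g x)"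
  then have \<Phi>: "\<Phi> \<in> E \<rightarrow>\<^sub>E T" "\<And>x. x \<in> S \<Longrightarrow> \<Phi> (f x) = g x" by auto
  show "\<Phi> = ?\<Phi>"
  proof
    fix e show "\<Phi> e = ?\<Phi> e"
    proof (cases "e \<in> E")
      case True
      then show ?thesis using some[OF True] \<Phi>(2)[of "SOME x. x \<in> S \<and> f x = e"] by simp
    next
      case False
      then show ?thesis using \<Phi>(1) by (auto simp: PiE_iff extensional_def)
    qed
  qed
qed

theorem lemma4p6:
  fixes sA :: "'r::comm_ring_1 \<Rightarrow> 'a::ab_group_add \<Rightarrow> 'a"
    and A :: "int \<Rightarrow> 'a set"
    and mu :: "'a list \<Rightarrow> 'a"
    and sM :: "'r \<Rightarrow> 'm::ab_group_add \<Rightarrow> 'm"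
    and M :: "int \<Rightarrow> 'm set"
    and beta :: "'a list \<Rightarrow> 'm \<Rightarrow> 'a list \<Rightarrow> 'm"
    and D :: int
    and I :: "'a list \<Rightarrow> 'm \<Rightarrow> 'a list \<Rightarrow> 'm \<Rightarrow> 'r"
    and k l :: nat
    and deg :: "nat \<Rightarrow> int"
  assumes "ainf_inner_product sA A mu sM M beta D I"
    and "k + l \<ge> 1"
  shows "\<exists>!\<Phi>.
    \<Phi> \<in> (\<Pi>\<^sub>E i\<in>A_idx k l. cohomology A (diff_A mu) (deg i)) \<times>
          (\<Pi>\<^sub>E i\<in>M_idx k l. cohomology M (diff_M beta) (deg i)) \<rightarrow>\<^sub>E Pow (UNIV :: 'r set) \<and>
    (\<forall>xA \<in> \<Pi> i\<in>A_idx k l. cocycles A (diff_A mu) (deg i).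
     \<forall>xM \<in> \<Pi> i\<in>M_idx k l. cocycles M (diff_M beta) (deg i).
       \<Phi> (\<lambda>i\<in>A_idx k l. coclass A (diff_A mu) (deg i) (xA i),
           \<lambda>i\<in>M_idx k l. coclass M (diff_M beta) (deg i) (xM i))
         = massey_inner_product A mu M beta D I k l deg xA xM)"
proof -
  interpret ainf_inner_product sA A mu sM M beta D I by (rule assms(1))
  let ?CA = "\<Pi> i\<in>A_idx k l. cocycles A (diff_A mu) (deg i)" and ?CM = "\<Pi> i\<in>M_idx k l. cocycles M (diff_M beta) (deg i)"
  let ?f = "\<lambda>(xA, xM). (\<lambda>i\<in>A_idx k l. coclass A (diff_A mu) (deg i) (xA i),
           \<lambda>i\<in>M_idx k l. coclass M (diff_M beta) (deg i) (xM i))"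
  let ?g = "\<lambda>(xA, xM). massey_inner_product A mu M beta D I k l deg xA xM"
  let ?E = "(\<Pi>\<^sub>E i\<in>A_idx k l. cohomology A (diff_A mu) (deg i)) \<times> (\<Pi>\<^sub>E i\<in>M_idx k l. cohomology M (diff_M beta) (deg i))"
  have "\<exists>!\<Phi>. \<Phi> \<in> ?E \<rightarrow>\<^sub>E Pow UNIV \<and> (\<forall>x\<in>?CA \<times> ?CM. \<Phi> (?f x) = ?g x)"
  proof (rule ex1_PiE_factor)
    show "?f x \<in> ?E" if "x \<in> ?CA \<times> ?CM" for x
      using that unfolding cohomology_def coclass_def
      by (cases x) (simp add: restrict_PiE_iff Pi_iff quotientI)
    show "?E \<subseteq> ?f ` (?CA \<times> ?CM)"
    proof clarify
      fix a b assume ab: "a \<in> (\<Pi>\<^sub>E i\<in>A_idx k l. cohomology A (diff_A mu) (deg i))"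
        "b \<in> (\<Pi>\<^sub>E i\<in>M_idx k l. cohomology M (diff_M beta) (deg i))"
      obtain xA where xA: "xA \<in> ?CA" "a = (\<lambda>i\<in>A_idx k l. coclass A (diff_A mu) (deg i) (xA i))"
        by (rule cohomology_representatives[OF ab(1)])
      obtain xM where xM: "xM \<in> ?CM" "b = (\<lambda>i\<in>M_idx k l. coclass M (diff_M beta) (deg i) (xM i))"
        by (rule cohomology_representatives[OF ab(2)])
      show "(a, b) \<in> ?f ` (?CA \<times> ?CM)"
        by (rule image_eqI[of _ _ "(xA, xM)"]) (simp_all add: xA xM)
    qed
    show "?g x = ?g y" if x: "x \<in> ?CA \<times> ?CM" and y: "y \<in> ?CA \<times> ?CM" and eq: "?f x = ?f y" for x y
    proof -
      obtain xA xM where x': "x = (xA, xM)" by (cases x)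
      obtain yA yM where y': "y = (yA, yM)" by (cases y)
      have eq': "(\<lambda>i\<in>A_idx k l. coclass A (diff_A mu) (deg i) (xA i)) = (\<lambda>i\<in>A_idx k l. coclass A (diff_A mu) (deg i) (yA i))"
        "(\<lambda>i\<in>M_idx k l. coclass M (diff_M beta) (deg i) (xM i)) = (\<lambda>i\<in>M_idx k l. coclass M (diff_M beta) (deg i) (yM i))"
        using eq by (simp_all only: x' y' prod.case prod.inject)
      note eqs = eq'[THEN fun_cong]
      have "coclass A (diff_A mu) (deg i) (xA i) = coclass A (diff_A mu) (deg i) (yA i)" if "i \<in> A_idx k l" for i
        using eqs(1)[of i] that by simp
      moreover have "coclass M (diff_M beta) (deg i) (xM i) = coclass M (diff_M beta) (deg i) (yM i)" if "i \<in> M_idx k l" for i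
        using eqs(2)[of i] that by simp
      moreover have "xA \<in> ?CA" "yA \<in> ?CA" "xM \<in> ?CM" "yM \<in> ?CM" using x y by (simp_all only: x' y' mem_Times_iff fst_conv snd_conv)
      ultimately show ?thesis unfolding x' y' prod.case by (intro massey_coclass_eq)
    qed
  qed auto
  then show ?thesis by (simp only: split_paired_Ball_Sigma prod.case)
qed

end
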